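(* A map $\operatorname{z}\colon\operatorname{Conv}(\mathbb{R}^n;\mathbb{R})\to\mathbb{R}^n$ is a continuous, dually translation covariant, vertically translation invariant valuation that is homogeneous of degree $n+1$ if and only if there exists $\zeta\in C_c(\mathbb{R}^n)$ such that $\operatorname{z}(v)=\int_{\mathbb{R}^n\times\mathbb{R}^n}\zeta(x)\,y\,\mathrm{d}\Theta_0(v;(x,y))$ for every $v\in\operatorname{Conv}(\mathbb{R}^n;\mathbb{R})$. For $n\geq2$, such a $\operatorname{z}$ is in addition rotation equivariant if and only if there exists $\alpha\in C_c([0,\infty))$ with $\operatorname{z}=\operatorname{m}^*_\alpha$. For $n=1$ the same holds with rotation equivariance replaced by reflection equivariance.
   Context: $\operatorname{Conv}(\mathbb{R}^n;\mathbb{R})$: convex functions $\mathbb{R}^n\to\mathbb{R}$ with the topology of pointwise convergence. Valuation: $\operatorname{z}(v\vee w)+\operatorname{z}(v\wedge w)=\operatorname{z}(v)+\operatorname{z}(w)$ whenever $v,w,v\vee w,v\wedge w$ are in the space. Dually translation covariant: there is $\operatorname{z}^0$ with $\operatorname{z}(v+\langle x,\cdot\rangle)=\operatorname{z}(v)+\operatorname{z}^0(v)x$. Vertically translation invariant: $\operatorname{z}(v+c)=\operatorname{z}(v)$. Homogeneous of degree $s$: $\operatorname{z}(\lambda v)=\lambda^s\operatorname{z}(v)$, $\lambda>0$. Rotation equivariant: $\operatorname{z}(v\circ\vartheta^{-1})=\vartheta\operatorname{z}(v)$, $\vartheta\in\operatorname{SO}(n)$; reflection equivariant ($n=1$): $\operatorname{z}(v(-\,\cdot))=-\operatorname{z}(v)$.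 $\Theta_0(v;\cdot)$ is the Hessian measure: the unique Borel measure on $\mathbb{R}^n\times\mathbb{R}^n$, weakly continuous in $v$, with $\int\eta\,\mathrm{d}\Theta_0(v;\cdot)=\int_{\mathbb{R}^n}\eta(x,\nabla v(x))\det(\operatorname{Hess}v(x))\,\mathrm{d}x$ for $C^2$ convex $v$ and continuous $\eta$ with compact support in the first variable. $\operatorname{m}^*_\alpha(v)=\int\alpha(|x|)\,y\,\mathrm{d}\Theta_0(v;(x,y))$. *)

theory Defs
  imports "HOL-Analysis.Analysis"
begin

type_synonym 'n cvfun = "real^'n \<Rightarrow> real"

definition Conv :: "('n::finite) cvfun set" where
  "Conv = {v. convex_on UNIV v}"

text \<open>Pointwise convergence of a sequence of functions (the topology of Conv is that of
pointwise convergence; it is metrizable, so sequences suffice).\<close>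
definition pw_conv :: "(nat \<Rightarrow> ('n::finite) cvfun) \<Rightarrow> 'n cvfun \<Rightarrow> bool" where
  "pw_conv vs v \<longleftrightarrow> (\<forall>x. (\<lambda>k. vs k x) \<longlonglongrightarrow> v x)"

definition C2_with :: "('n::finite) cvfun \<Rightarrow> (real^'n \<Rightarrow> real^'n) \<Rightarrow> (real^'n \<Rightarrow> real^'n^'n) \<Rightarrow> bool" where
  "C2_with v g H \<longleftrightarrow>
     (\<forall>x. (v has_derivative (\<lambda>h. g x \<bullet> h)) (at x)) \<and>
     (\<forall>x. (g has_derivative (\<lambda>h. H x *v h)) (at x)) \<and>
     continuous_on UNIV H"

definition is_hessian_measure_op ::
  "(('n::finite) cvfun \<Rightarrow> ((real^'n) \<times> (real^'n)) measure) \<Rightarrow> bool" where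
  "is_hessian_measure_op Th \<longleftrightarrow>
     (\<forall>v. v \<notin> Conv \<longrightarrow> Th v = null_measure borel) \<and>
     (\<forall>v\<in>Conv. sets (Th v) = sets borel \<and>
        (\<forall>K. compact K \<longrightarrow> emeasure (Th v) K < \<infinity>)) \<and>
     \<comment> \<open>weak continuity in v\<close>
     (\<forall>vs v. (\<forall>k. vs k \<in> Conv) \<longrightarrow> v \<in> Conv \<longrightarrow> pw_conv vs v \<longrightarrow>
        (\<forall>\<eta>::((real^'n) \<times> (real^'n)) \<Rightarrow> real.
           continuous_on UNIV \<eta> \<longrightarrow> compact (closure {p. \<eta> p \<noteq> 0}) \<longrightarrow>
           (\<lambda>k. integral\<^sup>L (Th (vs k)) \<eta>) \<longlonglongrightarrow> integral\<^sup>L (Th v) \<eta>)) \<and>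
     \<comment> \<open>representation for C^2 convex functions\<close>
     (\<forall>v g H. v \<in> Conv \<longrightarrow> C2_with v g H \<longrightarrow>
        (\<forall>\<eta>::((real^'n) \<times> (real^'n)) \<Rightarrow> real.
           continuous_on UNIV \<eta> \<longrightarrow>
           (\<exists>K. compact K \<and> (\<forall>x y. x \<notin> K \<longrightarrow> \<eta> (x, y) = 0)) \<longrightarrow>
           integral\<^sup>L (Th v) \<eta> =
             integral\<^sup>L lborel (\<lambda>x. \<eta> (x, g x) * det (H x))))"

definition Theta0 :: "('n::finite) cvfun \<Rightarrow> ((real^'n) \<times> (real^'n)) measure" where
  "Theta0 = (THE Th. is_hessian_measure_op Th)"

definition hess_vec :: "(real^'n \<Rightarrow> real) \<Rightarrow> ('n::finite) cvfun \<Rightarrow> real^'n" where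
  "hess_vec \<zeta> v = integral\<^sup>L (Theta0 v) (\<lambda>(x, y). \<zeta> x *\<^sub>R y)"

definition m_star :: "(real \<Rightarrow> real) \<Rightarrow> ('n::finite) cvfun \<Rightarrow> real^'n" where
  "m_star \<alpha> = hess_vec (\<lambda>x. \<alpha> (norm x))"

definition val_continuous :: "(('n::finite) cvfun \<Rightarrow> real^'n) \<Rightarrow> bool" where
  "val_continuous z \<longleftrightarrow> (\<forall>vs v. (\<forall>k. vs k \<in> Conv) \<longrightarrow> v \<in> Conv \<longrightarrow> pw_conv vs v \<longrightarrow>
      (\<lambda>k. z (vs k)) \<longlonglongrightarrow> z v)"

definition is_valuation :: "(('n::finite) cvfun \<Rightarrow> real^'n) \<Rightarrow> bool" where
  "is_valuation z \<longleftrightarrow> (\<forall>v w. v \<in> Conv \<longrightarrow> w \<in> Conv \<longrightarrow>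
      (\<lambda>x. max (v x) (w x)) \<in> Conv \<longrightarrow> (\<lambda>x. min (v x) (w x)) \<in> Conv \<longrightarrow>
      z (\<lambda>x. max (v x) (w x)) + z (\<lambda>x. min (v x) (w x)) = z v + z w)"

definition dually_transl_cov :: "(('n::finite) cvfun \<Rightarrow> real^'n) \<Rightarrow> bool" where
  "dually_transl_cov z \<longleftrightarrow> (\<exists>z0 :: 'n cvfun \<Rightarrow> real. \<forall>v\<in>Conv. \<forall>x.
      z (\<lambda>t. v t + x \<bullet> t) = z v + z0 v *\<^sub>R x)"

definition vert_transl_inv :: "(('n::finite) cvfun \<Rightarrow> real^'n) \<Rightarrow> bool" where
  "vert_transl_inv z \<longleftrightarrow> (\<forall>v\<in>Conv. \<forall>c::real. z (\<lambda>t. v t + c) = z v)"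

definition homogeneous_deg :: "real \<Rightarrow> (('n::finite) cvfun \<Rightarrow> real^'n) \<Rightarrow> bool" where
  "homogeneous_deg s z \<longleftrightarrow> (\<forall>v\<in>Conv. \<forall>r::real. r > 0 \<longrightarrow>
      z (\<lambda>t. r * v t) = (r powr s) *\<^sub>R z v)"

text \<open>SO(n) acting on R^n via matrices; v \<circ> \<vartheta>^{-1} = v \<circ> \<vartheta>^T.\<close>
definition rotation_equivariant :: "(('n::finite) cvfun \<Rightarrow> real^'n) \<Rightarrow> bool" where
  "rotation_equivariant z \<longleftrightarrow> (\<forall>A::real^'n^'n. orthogonal_matrix A \<longrightarrow> det A = 1 \<longrightarrow>
      (\<forall>v\<in>Conv. z (\<lambda>t. v (transpose A *v t)) = A *v z v))"

definition reflection_equivariant :: "(('n::finite) cvfun \<Rightarrow> real^'n) \<Rightarrow> bool" where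
  "reflection_equivariant z \<longleftrightarrow> (\<forall>v\<in>Conv. z (\<lambda>t. v (- t)) = - z v)"

definition Cc :: "((real^'n::finite) \<Rightarrow> real) set" where
  "Cc = {\<zeta>. continuous_on UNIV \<zeta> \<and> compact (closure {x. \<zeta> x \<noteq> 0})}"

definition Cc_halfline :: "(real \<Rightarrow> real) set" where
  "Cc_halfline = {\<alpha>. continuous_on {0..} \<alpha> \<and> compact (closure {t\<in>{0..}. \<alpha> t \<noteq> 0})}"

end

theory Submission
  imports Defs
begin

text \<open>
For convex \<open>v\<close>, almost every \<open>y\<close> is a subgradient of \<open>v\<close> at no more than one point \<open>T y\<close>, and
\<open>\<Theta>\<^sub>0(v)\<close> is the image of Lebesgue measure under \<open>y \<mapsto> (T y, y)\<close>: for \<open>C\<^sup>2\<close> functions this is the change of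
variables \<open>y = \<nabla>v(x)\<close>, and smooth functions (log-sum-exp) are dense. Hence
\<open>\<integral>\<eta> d\<Theta>\<^sub>0(v) = \<integral>\<eta>(T y, y) dy\<close>, from which the properties of the Hessian integrals are read off pointwise in \<open>y\<close>.

Conversely, write a convex function as conjugate of some \<open>u\<close> restricted to a box \<open>D\<close>. Cutting \<open>D\<close> by a
hyperplane is an instance of the valuation property. Bisect \<open>D\<close> repeatedly, keep the piece with the larger
value of the valuation, and rescale it to the original size: a box with \<open>m\<close> nontrivial sides costs a
factor \<open>2\<^sup>m\<close> per step, homogeneity of degree \<open>s\<close> gains \<open>2\<^sup>s\<close>, and the rescaled functions converge to a
translated support function. So the valuation vanishes if \<open>m < s\<close>, and if \<open>m = s\<close> it is determined by its
values \<open>\<zeta>(p)\<close> on the support functions of the unit cube centered at \<open>p\<close>. Applied to the scalar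
valuation \<open>z\<^sup>0\<close> of degree \<open>n\<close> this produces \<open>\<zeta>\<close>; applied to \<open>z\<close> minus its Hessian integral, which
is translation invariant of degree \<open>n + 1\<close>, it yields zero.
\<close>

subsection \<open>Subgradients of convex functions\<close>

text \<open>Bisection only sees limits of rescalings, so the conjugate \<open>u\<close> must be
  differentiable with a quadratic remainder. A small multiple of the squared norm added to
  \<open>v\<close> ensures this: the conjugate becomes finite everywhere with Lipschitz gradient,
  and continuity of the valuation removes the extra term. The degree of \<open>z0\<close> is one
  less than that of \<open>z\<close> because pulling a factor \<open>r\<close> out of
  \<open>r * v + <x, .>\<close> divides \<open>x\<close> by \<open>r\<close>. Once \<zeta> is known,
  \<open>z\<close> and its Hessian integral share the same \<open>z0\<close>, so their difference
  ignores linear terms; its degree exceeds the dimension, hence \<open>m = s\<close> never occurs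
  for it. The obstacle is the compact support of \<zeta>. The support function of the cube, centered
  at \<open>p\<close>, is a sum of one-dimensional kinks at the coordinates of \<open>p\<close>, and
  a vanishing coordinate leaves a kink at the origin however large \<open>p\<close> is. A shear
  removes it without changing the value: up to slices of value zero, the cube and its shear consist
  of the same pieces up to translation. Functions that vanish on growing balls could then be
  rescaled to converge to 0 while \<open>Z\<close> stays 1 in absolute value, which continuity
  forbids.\<close>

definition subpts :: "('a::real_inner \<Rightarrow> real) \<Rightarrow> 'a \<Rightarrow> 'a set" where
  "subpts v y = {x. \<forall>x'. v x + y \<bullet> (x' - x) \<le> v x'}"

lemma subptsI: "(\<And>x'. v x + y \<bullet> (x' - x) \<le> v x') \<Longrightarrow> x \<in> subpts v y"
  by (simp add: subpts_def)

lemma subptsD: "x \<in> subpts v y \<Longrightarrow> v x + y \<bullet> (x' - x) \<le> v x'"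
  by (simp add: subpts_def)

text \<open>A hyperplane separates the graph point from the strict epigraph. Its normal points
  downwards because the epigraph is unbounded above, and it is not horizontal because
  \<open>v\<close> is finite everywhere, in particular at \<open>x + p\<close>.\<close>

lemma subgradient_exists:
  fixes v :: "'a::euclidean_space \<Rightarrow> real"
  assumes cv: "convex_on UNIV v"
  obtains y where "x \<in> subpts v y"
proof -
  let ?S = "{p. v (fst p) < snd p} :: ('a \<times> real) set"
  let ?T = "{(x, v x)}"
  have "convex ?S"
  proof (rule convexI)
    fix p q :: "'a \<times> real" and s t :: real
    assume *: "p \<in> ?S" "q \<in> ?S" "0 \<le> s" "0 \<le> t" "s + t = 1"
    have "v (s *\<^sub>R fst p + t *\<^sub>R fst q) \<le> s * v (fst p) + t * v (fst q)"
      using cv * by (auto simp: convex_on_def)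
    also have "\<dots> < s * snd p + t * snd q"
    proof (cases "s = 0")
      case True then show ?thesis using * by simp
    next
      case False
      then have "s * v (fst p) < s * snd p" using * by simp
      moreover have "t * v (fst q) \<le> t * snd q" using * by (simp add: mult_left_mono)
      ultimately show ?thesis by linarith
    qed
    finally show "s *\<^sub>R p + t *\<^sub>R q \<in> ?S" by simp
  qed
  moreover have "?S \<noteq> {}"
  proof -
    have "(x, v x + 1) \<in> ?S" by simp
    then show ?thesis by blast
  qed
  moreover have "?S \<inter> ?T = {}" by auto
  ultimately obtain a b where ab: "a \<noteq> 0" "\<forall>p\<in>?S. a \<bullet> p \<le> b" "\<forall>p\<in>?T. a \<bullet> p \<ge> b"
    using separating_hyperplane_sets[of ?S ?T] by auto
  obtain p c where a: "a = (p, c)" by fastforce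
  have key: "p \<bullet> (x' - x) + c * (t - v x) \<le> 0" if "v x' < t" for x' t
  proof -
    have "a \<bullet> (x', t) \<le> a \<bullet> (x, v x)" using ab that by force
    then show ?thesis by (simp add: a inner_diff_right algebra_simps)
  qed
  have "c \<le> 0" using key[of x "v x + 1"] by simp
  moreover have "c \<noteq> 0"
  proof
    assume "c = 0"
    then have "p \<bullet> p \<le> 0" using key[of "x + p" "v (x + p) + 1"] by simp
    then have "p = 0" by (metis inner_gt_zero_iff not_le)
    then show False using \<open>c = 0\<close> ab a by (simp add: zero_prod_def)
  qed
  ultimately have c: "c < 0" by simp
  \<comment> \<open>\<open>key\<close> speaks about points strictly above the graph, so the
    subgradient inequality is reached up to every \<open>e > 0\<close>.\<close>
  have "v x + ((1 / - c) *\<^sub>R p) \<bullet> (x' - x) \<le> v x'" for x'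
  proof (rule field_le_epsilon)
    fix e :: real assume "0 < e"
    then have "p \<bullet> (x' - x) \<le> (- c) * (v x' + e - v x)"
      using key[of x' "v x' + e"] by (simp add: algebra_simps)
    then have "(1 / - c) * (p \<bullet> (x' - x)) \<le> v x' + e - v x"
      using c by (simp add: field_simps)
    then show "v x + ((1 / - c) *\<^sub>R p) \<bullet> (x' - x) \<le> v x' + e" by simp
  qed
  then show ?thesis using that subptsI by blast
qed

text \<open>A supremum of affine functions that is attained everywhere is convex. Convexity of
  log-sum-exp, conjugates and composed functions is derived this way, by exhibiting
  subgradients.\<close>

lemma convex_on_subgradientI:
  fixes v :: "'a::real_inner \<Rightarrow> real"
  assumes "\<And>x. \<exists>y. x \<in> subpts v y"
  shows "convex_on UNIV v"
proof -
  have "v ((1 - t) *\<^sub>R a + t *\<^sub>R b) \<le> (1 - t) * v a + t * v b"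
    if t: "0 < t" "t < 1" for t a b
  proof -
    let ?x = "(1 - t) *\<^sub>R a + t *\<^sub>R b"
    obtain y where y: "?x \<in> subpts v y" using assms by blast
    have "(1 - t) * (v ?x + y \<bullet> (a - ?x)) + t * (v ?x + y \<bullet> (b - ?x)) \<le> (1 - t) * v a + t * v b"
      using t subptsD[OF y] by (intro add_mono mult_left_mono) auto
    moreover have "(1 - t) * (v ?x + y \<bullet> (a - ?x)) + t * (v ?x + y \<bullet> (b - ?x)) = v ?x"
      by (simp add: inner_diff_right inner_add_right algebra_simps)
    ultimately show ?thesis by simp
  qed
  then show ?thesis by (intro convex_onI) auto
qed

lemma subpts_monotone:
  assumes "x \<in> subpts v y" "x' \<in> subpts v y'"
  shows "0 \<le> (y' - y) \<bullet> (x' - x)"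
  using subptsD[OF assms(1), of x'] subptsD[OF assms(2), of x]
  by (simp add: inner_diff_left inner_diff_right)

lemma convex_subpts: "convex (subpts v y)" if "convex_on UNIV v" for v :: "'a::real_inner \<Rightarrow> real"
proof (rule convexI)
  fix a b and s t :: real
  assume *: "a \<in> subpts v y" "b \<in> subpts v y" "0 \<le> s" "0 \<le> t" "s + t = 1"
  let ?x = "s *\<^sub>R a + t *\<^sub>R b"
  have 1: "v ?x \<le> s * v a + t * v b"
    using that * by (auto simp: convex_on_def)
  show "?x \<in> subpts v y"
  proof (rule subptsI)
    fix x'
    have "s * (v a + y \<bullet> (x' - a)) + t * (v b + y \<bullet> (x' - b)) \<le> s * v x' + t * v x'"
      using * by (intro add_mono mult_left_mono subptsD) auto
    also have "\<dots> = v x'" using * by (simp flip: distrib_right)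
    finally have 2: "s * (v a + y \<bullet> (x' - a)) + t * (v b + y \<bullet> (x' - b)) \<le> v x'" .
    have s: "s = 1 - t" using * by simp
    have "s * (v a + y \<bullet> (x' - a)) + t * (v b + y \<bullet> (x' - b))
        = s * v a + t * v b + y \<bullet> (x' - ?x)"
      unfolding s by (simp add: inner_diff_right inner_add_right algebra_simps)
    then show "v ?x + y \<bullet> (x' - ?x) \<le> v x'" using 1 2 by linarith
  qed
qed

text \<open>Moving one unit from \<open>x\<close> in the direction of \<open>y\<close> raises
  \<open>v\<close> by at least \<open>norm y\<close>, but both values are bounded by
  \<open>M\<close>.\<close>

lemma subgradient_bound:
  fixes v :: "'a::real_inner \<Rightarrow> real"
  assumes bd: "\<And>x. x \<in> cball 0 (R + 1) \<Longrightarrow> \<bar>v x\<bar> \<le> M"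
    and x: "norm x \<le> R" "x \<in> subpts v y"
  shows "norm y \<le> 2 * M"
proof (cases "y = 0")
  case True
  have "\<bar>v x\<bar> \<le> M" using bd x by simp
  then show ?thesis using True by simp
next
  case False
  let ?x = "x + y /\<^sub>R norm y"
  have "norm ?x \<le> R + 1"
    using norm_triangle_ineq[of x "y /\<^sub>R norm y"] x False by simp
  then have "\<bar>v ?x\<bar> \<le> M" using bd by simp
  moreover have "\<bar>v x\<bar> \<le> M" using bd x by simp
  moreover have "v x + y \<bullet> (?x - x) \<le> v ?x" by (rule subptsD[OF x(2)])
  moreover have "y \<bullet> (?x - x) = norm y" 
    using False by (simp add: dot_square_norm power2_eq_square)
  ultimately show ?thesis by linarith
qed

text \<open>A cube around the ball has finitely many vertices, and convexity bounds each function
  above by its vertex values. The lower bound comes from the midpoint inequality for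
  \<open>x\<close> and \<open>- x\<close>, hence the term \<open>2 * K 0\<close>.\<close>

lemma convex_seq_locally_bounded:
  fixes vs :: "nat \<Rightarrow> 'a::euclidean_space \<Rightarrow> real"
  assumes cv: "\<And>k. convex_on UNIV (vs k)" and lim: "\<And>x. (\<lambda>k. vs k x) \<longlonglongrightarrow> v x"
  obtains M where "\<And>k x. norm x \<le> R \<Longrightarrow> \<bar>vs k x\<bar> \<le> M"
proof -
  obtain b where b: "cball (0::'a) R \<subseteq> cbox (- b) b"
    using bounded_subset_cbox_symmetric[OF bounded_cball] by blast
  obtain S where S: "finite S" "cbox (- b) b = convex hull S"
    by (rule closed_interval_as_convex_hull)
  have "\<exists>K. \<forall>k. \<bar>vs k x\<bar> \<le> K" for x
  proof -
    have "Bseq (\<lambda>k. vs k x)" using lim convergent_imp_Bseq convergentI by blast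
    then show ?thesis by (auto simp: Bseq_def)
  qed
  then obtain K where K: "\<And>k x. \<bar>vs k x\<bar> \<le> K x" by metis
  define M where "M = (\<Sum>s\<in>S. K s)"
  have KM: "K s \<le> M" if "s \<in> S" for s
    unfolding M_def using S that K
    by (intro member_le_sum) (auto intro: order_trans[OF abs_ge_zero])
  have up: "vs k x \<le> M" if "x \<in> cbox (- b) b" for k x
  proof -
    have "\<forall>s\<in>S. vs k s \<le> M" using K KM by (meson abs_le_D1 order_trans)
    moreover have "convex_on (convex hull S) (vs k)"
      using cv by (rule convex_on_subset) auto
    ultimately show ?thesis using convex_on_convex_hull_bound S that by blast
  qed
  have "\<bar>vs k x\<bar> \<le> M + 2 * K 0" if "norm x \<le> R" for k x
  proof -
    have 1: "x \<in> cbox (- b) b" "- x \<in> cbox (- b) b" using b that by (auto simp: subset_iff)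
    have "vs k ((1/2) *\<^sub>R x + (1/2) *\<^sub>R (- x)) \<le> (1/2) * vs k x + (1/2) * vs k (- x)"
      using convex_onD[OF cv[of k], of "1/2" x "- x"] by simp
    then have "2 * vs k 0 \<le> vs k x + vs k (- x)" by simp
    then show ?thesis using up[OF 1(1), of k] up[OF 1(2), of k] K[of k 0] by linarith
  qed
  then show ?thesis using that by blast
qed

lemma convex_seq_subgradient_bound:
  fixes vs :: "nat \<Rightarrow> 'a::euclidean_space \<Rightarrow> real"
  assumes cv: "\<And>k. convex_on UNIV (vs k)" and lim: "\<And>x. (\<lambda>k. vs k x) \<longlonglongrightarrow> v x"
  obtains L where "\<And>k x y. norm x \<le> R \<Longrightarrow> x \<in> subpts (vs k) y \<Longrightarrow> norm y \<le> L"
proof -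
  obtain M where M: "\<And>k x. norm x \<le> R + 1 \<Longrightarrow> \<bar>vs k x\<bar> \<le> M"
    using convex_seq_locally_bounded[OF assms] by blast
  have "norm y \<le> 2 * M" if "norm x \<le> R" "x \<in> subpts (vs k) y" for k x y
    by (rule subgradient_bound[OF _ that]) (use M in auto)
  then show ?thesis using that by blast
qed

lemma convex_subgradient_bound:
  fixes v :: "'a::euclidean_space \<Rightarrow> real"
  assumes "convex_on UNIV v"
  obtains L where "\<And>x y. norm x \<le> R \<Longrightarrow> x \<in> subpts v y \<Longrightarrow> norm y \<le> L"
  using convex_seq_subgradient_bound[of "\<lambda>_. v" v R] assms by auto

lemma subgradient_bound_imp_lipschitz:
  fixes v :: "'a::euclidean_space \<Rightarrow> real"
  assumes cv: "convex_on UNIV v" and L: "\<And>x y. norm x \<le> R \<Longrightarrow> x \<in> subpts v y \<Longrightarrow> norm y \<le> L"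
    and x: "norm x \<le> R" "norm x' \<le> R"
  shows "\<bar>v x - v x'\<bar> \<le> L * norm (x - x')"
proof -
  have *: "v a - v b \<le> L * norm (a - b)" if a: "norm a \<le> R" and b: "norm b \<le> R" for a b
  proof -
    obtain y where y: "a \<in> subpts v y" using subgradient_exists[OF cv] .
    have "v a - v b \<le> y \<bullet> (a - b)" using subptsD[OF y, of b] by (simp add: inner_diff_right)
    also have "\<dots> \<le> norm y * norm (a - b)" by (rule norm_cauchy_schwarz)
    also have "\<dots> \<le> L * norm (a - b)" using L[OF a y] by (simp add: mult_right_mono)
    finally show ?thesis .
  qed
  from *[OF x] *[OF x(2,1)] show ?thesis by (simp add: norm_minus_commute abs_le_iff)
qed

text \<open>A Lipschitz constant common to all \<open>k\<close> turns pointwise convergence into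
  convergence along moving points. Minimizers pass to the limit through this fact.\<close>

lemma convex_seq_continuous_convergence:
  fixes vs :: "nat \<Rightarrow> 'a::euclidean_space \<Rightarrow> real"
  assumes cv: "\<And>k. convex_on UNIV (vs k)" and lim: "\<And>x. (\<lambda>k. vs k x) \<longlonglongrightarrow> v x"
    and X: "X \<longlonglongrightarrow> x"
  shows "(\<lambda>k. vs k (X k)) \<longlonglongrightarrow> v x"
proof -
  have "Bseq X" using X convergent_imp_Bseq convergent_def by blast
  then obtain R0 where R0: "\<And>k. norm (X k) \<le> R0" by (auto simp: Bseq_def)
  define R where "R = max R0 (norm x)"
  have R: "norm (X k) \<le> R" "norm x \<le> R" for k using R0[of k] by (auto simp: R_def)
  obtain L where L: "\<And>k x y. norm x \<le> R \<Longrightarrow> x \<in> subpts (vs k) y \<Longrightarrow> norm y \<le> L"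
    using convex_seq_subgradient_bound[OF cv lim] by blast
  have "(\<lambda>k. vs k (X k) - vs k x) \<longlonglongrightarrow> 0"
  proof (rule Lim_null_comparison)
    show "\<forall>\<^sub>F k in sequentially. norm (vs k (X k) - vs k x) \<le> L * norm (X k - x)"
      using subgradient_bound_imp_lipschitz[OF cv L R] by auto
    show "(\<lambda>k. L * norm (X k - x)) \<longlonglongrightarrow> 0"
      by (rule tendsto_mult_right_zero[OF tendsto_norm_zero[OF LIM_zero[OF X]]])
  qed
  from tendsto_add[OF this lim[of x]] show ?thesis by simp
qed

lemma convex_continuous: "continuous_on UNIV v" if "convex_on UNIV v" 
  for v :: "'a::euclidean_space \<Rightarrow> real"
  using that by (simp add: convex_on_continuous)

subsection \<open>Points of differentiability of the conjugate\<close>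

text \<open>Compactness of \<open>C\<close> prevents the points of contact from escaping while
  \<open>y\<close> converges; the subgradient inequality itself is closed.\<close>

lemma closed_subpts_hit:
  fixes v :: "'a::euclidean_space \<Rightarrow> real"
  assumes cv: "convex_on UNIV v" and C: "compact C"
  shows "closed {y. subpts v y \<inter> C \<noteq> {}}"
  unfolding closed_sequential_limits
proof (intro allI impI)
  fix Y l assume *: "(\<forall>n. Y n \<in> {y. subpts v y \<inter> C \<noteq> {}}) \<and> Y \<longlonglongrightarrow> l"
  then have "\<forall>n. \<exists>x. x \<in> C \<and> x \<in> subpts v (Y n)" by auto
  then obtain X where X: "\<And>n. X n \<in> C" "\<And>n. X n \<in> subpts v (Y n)" by metis
  obtain x r where r: "x \<in> C" "strict_mono r" "(X \<circ> r) \<longlonglongrightarrow> x"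
    using C X(1) unfolding compact_def by blast
  have Yr: "(Y \<circ> r) \<longlonglongrightarrow> l" using * r(2) LIMSEQ_subseq_LIMSEQ by blast
  have "x \<in> subpts v l"
  proof (rule subptsI)
    fix x'
    have vx: "(\<lambda>n. v ((X \<circ> r) n)) \<longlonglongrightarrow> v x"
      using convex_continuous[OF cv] r(3) by (rule continuous_on_tendsto_compose) auto
    show "v x + l \<bullet> (x' - x) \<le> v x'"
    proof (rule LIMSEQ_le_const2)
      show "(\<lambda>n. v ((X \<circ> r) n) + (Y \<circ> r) n \<bullet> (x' - (X \<circ> r) n)) \<longlonglongrightarrow> v x + l \<bullet> (x' - x)"
        by (intro tendsto_intros vx Yr r(3))
      show "\<exists>N. \<forall>n\<ge>N. v ((X \<circ> r) n) + (Y \<circ> r) n \<bullet> (x' - (X \<circ> r) n) \<le> v x'"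
        using subptsD[OF X(2)] by auto
    qed
  qed
  then show "l \<in> {y. subpts v y \<inter> C \<noteq> {}}" using r(1) by auto
qed

text \<open>Infinitely many congruent, pairwise disjoint translates stay in one ball, so their
  common measure is zero. Applied below to sets that meet every line in direction \<open>i\<close>
  at most once; it takes the place of an almost everywhere differentiability theorem.\<close>

lemma negligible_disjoint_translates:
  fixes E :: "'a::euclidean_space set"
  assumes E: "closed E" "bounded E" and i: "i \<noteq> 0"
    and disj: "\<And>y t. y \<in> E \<Longrightarrow> 0 < t \<Longrightarrow> y + t *\<^sub>R i \<notin> E"
  shows "negligible E"
proof -
  have cE: "compact E" using E compact_eq_bounded_closed by blast
  define F where "F j = (+) ((1 / (real j + 1)) *\<^sub>R i) ` E" for j :: nat
  have mF: "F j \<in> sets lebesgue" for j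
    unfolding F_def using cE by (intro lmeasurable_compact fmeasurableD compact_translation)
  have eqF: "measure lebesgue (F j) = measure lebesgue E" for j
    by (simp add: F_def measure_translation)
  have dF: "F j \<inter> F k = {}" if "j < k" for j k
  proof (rule ccontr)
    assume "F j \<inter> F k \<noteq> {}"
    then obtain a b where ab: "a \<in> E" "b \<in> E" 
      "(1 / (real j + 1)) *\<^sub>R i + a = (1 / (real k + 1)) *\<^sub>R i + b"
      unfolding F_def by auto
    then have "b = a + (1 / (real j + 1) - 1 / (real k + 1)) *\<^sub>R i"
      by (simp add: algebra_simps)
    moreover have "0 < 1 / (real j + 1) - 1 / (real k + 1)" using that by (simp add: divide_strict_left_mono)
    ultimately show False using disj ab by blast
  qed
  then have disjF: "disjoint_family F"
    unfolding disjoint_family_on_def by (metis Int_commute linorder_neqE_nat)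
  obtain B where B: "\<And>x. x \<in> E \<Longrightarrow> norm x \<le> B" using E bounded_iff by metis
  have sub: "\<Union> (range F) \<subseteq> cball 0 (norm i + B)"
  proof
    fix x assume "x \<in> \<Union> (range F)"
    then obtain j a where a: "a \<in> E" "x = (1 / (real j + 1)) *\<^sub>R i + a" by (auto simp: F_def)
    have "norm ((1 / (real j + 1)) *\<^sub>R i) \<le> norm i" by (simp add: divide_simps mult_left_mono) (simp add: mult_le_cancel_left1)
    then show "x \<in> cball 0 (norm i + B)" using a B[of a] norm_triangle_ineq[of "(1 / (real j + 1)) *\<^sub>R i" a] by simp
  qed
  have "emeasure lebesgue (\<Union> (range F)) \<le> emeasure lebesgue (cball (0::'a) (norm i + B))"
    using sub by (intro emeasure_mono) auto
  also have "\<dots> < \<infinity>" using emeasure_bounded_finite[of "cball (0::'a) (norm i + B)"] by (simp add: emeasure_completion)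
  finally have fin: "emeasure lebesgue (\<Union> (range F)) \<noteq> \<infinity>" by simp
  have "(\<lambda>j. measure lebesgue (F j)) sums measure lebesgue (\<Union> (range F))"
    by (rule measure_UNION[OF _ disjF fin]) (use mF in auto)
  then have "summable (\<lambda>j::nat. measure lebesgue E)" by (simp add: eqF sums_iff)
  then have "measure lebesgue E = 0" by (simp add: summable_const_iff)
  moreover have "E \<in> lmeasurable" using cE lmeasurable_compact by blast
  ultimately show ?thesis by (simp add: negligible_iff_measure)
qed

text \<open>Two distinct points differ in some coordinate, where two rational levels fit between
  them. The gain is countability: the exceptional set becomes a countable union, useful both for its
  measure and for its measurability.\<close>

lemma nonunique_subpts_eq:
  fixes v :: "'a::euclidean_space \<Rightarrow> real"
  shows "{y. \<exists>x1 x2. x1 \<in> subpts v y \<and> x2 \<in> subpts v y \<and> x1 \<noteq> x2} =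
    (\<Union>i\<in>Basis. \<Union>q. \<Union>r\<in>{q<..}. {y. subpts v y \<inter> {x. i \<bullet> x \<le> of_rat q} \<noteq> {}} \<inter>
       {y. subpts v y \<inter> {x. i \<bullet> x \<ge> of_rat r} \<noteq> {}})" (is "?L = ?R")
proof (intro equalityI subsetI)
  fix y assume "y \<in> ?L"
  then obtain x1 x2 where x: "x1 \<in> subpts v y" "x2 \<in> subpts v y" "x1 \<noteq> x2" by blast
  obtain i where i: "i \<in> Basis" "x1 \<bullet> i \<noteq> x2 \<bullet> i" using x(3) euclidean_eqI by blast
  define a b where "a = (if x1 \<bullet> i < x2 \<bullet> i then x1 else x2)" and "b = (if x1 \<bullet> i < x2 \<bullet> i then x2 else x1)"
  have ab: "a \<in> subpts v y" "b \<in> subpts v y" "i \<bullet> a < i \<bullet> b"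
    using x i by (auto simp: a_def b_def inner_commute)
  obtain q where q: "i \<bullet> a < of_rat q" "of_rat q < i \<bullet> b" using of_rat_dense ab(3) by blast
  obtain r where r: "(of_rat q :: real) < of_rat r" "of_rat r < i \<bullet> b" using of_rat_dense q(2) by blast
  have "q < r" using r(1) by (simp add: of_rat_less)
  moreover have "i \<bullet> a \<le> of_rat q" "i \<bullet> b \<ge> of_rat r" using q r by auto
  ultimately show "y \<in> ?R" using i(1) ab(1,2) by blast
next
  fix y assume "y \<in> ?R"
  then obtain i and q r :: rat and x1 x2 where x: "q < r" "x1 \<in> subpts v y" "i \<bullet> x1 \<le> of_rat q"
    "x2 \<in> subpts v y" "i \<bullet> x2 \<ge> of_rat r" by auto
  moreover have "(of_rat q :: real) < of_rat r" using x(1) by (simp add: of_rat_less)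
  ultimately have "x1 \<noteq> x2" by auto
  then show "y \<in> ?L" using x by blast
qed

text \<open>The exhaustion by balls supplies the compact targets that
  \<open>closed_subpts_hit\<close> asks for.\<close>

lemma subpts_hit_Union:
  "{y. subpts v y \<inter> A \<noteq> {}} = (\<Union>m::nat. {y. subpts v y \<inter> (A \<inter> cball 0 (real m)) \<noteq> {}})"
proof (intro equalityI subsetI)
  fix y assume "y \<in> {y. subpts v y \<inter> A \<noteq> {}}"
  then obtain x where x: "x \<in> subpts v y" "x \<in> A" by auto
  obtain m where "norm x \<le> real m" using real_arch_simple by blast
  then have "x \<in> subpts v y \<inter> (A \<inter> cball 0 (real m))" using x by simp
  then show "y \<in> (\<Union>m::nat. {y. subpts v y \<inter> (A \<inter> cball 0 (real m)) \<noteq> {}})" by blast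
qed auto

text \<open>By monotonicity, moving \<open>y\<close> in direction \<open>i\<close> cannot decrease
  the \<open>i\<close>-coordinate of points in the fibre \<open>subpts v y\<close>. So no line in
  direction \<open>i\<close> contains two values \<open>y\<close> whose fibres reach both below
  \<open>q\<close> and above \<open>r\<close>, and \<open>negligible_disjoint_translates\<close>
  applies to each compact piece.\<close>

lemma negligible_nonunique_subpts:
  fixes v :: "'a::euclidean_space \<Rightarrow> real"
  assumes cv: "convex_on UNIV v"
  shows "negligible {y. \<exists>x1 x2. x1 \<in> subpts v y \<and> x2 \<in> subpts v y \<and> x1 \<noteq> x2}"
proof -
  have nE: "negligible ({y. subpts v y \<inter> {x. i \<bullet> x \<le> of_rat q} \<noteq> {}} \<inter> {y. subpts v y \<inter> {x. i \<bullet> x \<ge> of_rat r} \<noteq> {}})"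
    (is "negligible (?A \<inter> ?B)") if i: "i \<in> Basis" and qr: "q < r" for i :: 'a and q r
  proof -
    define A where "A m = {y. subpts v y \<inter> ({x. i \<bullet> x \<le> of_rat q} \<inter> cball 0 (real m)) \<noteq> {}}" for m
    define B where "B m = {y. subpts v y \<inter> ({x. i \<bullet> x \<ge> of_rat r} \<inter> cball 0 (real m)) \<noteq> {}}" for m
    have cAB: "closed (A m)" "closed (B m)" for m
      unfolding A_def B_def
      by (intro closed_subpts_hit[OF cv] closed_Int_compact closed_halfspace_le closed_halfspace_ge compact_cball)+
    have "negligible (A m \<inter> B k)" for m k
    proof (rule negligible_disjoint_translates)
      show "closed (A m \<inter> B k)" by (intro closed_Int cAB)
      obtain L where L: "\<And>x y. norm x \<le> real m \<Longrightarrow> x \<in> subpts v y \<Longrightarrow> norm y \<le> L"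
        using convex_subgradient_bound[OF cv] by blast
      show "bounded (A m \<inter> B k)"
        unfolding bounded_iff by (rule exI[of _ L]) (use L in \<open>auto simp: A_def\<close>)
      show "i \<noteq> 0" using i by auto
      fix y and t :: real assume y: "y \<in> A m \<inter> B k" and t: "0 < t"
      show "y + t *\<^sub>R i \<notin> A m \<inter> B k"
      proof
        assume "y + t *\<^sub>R i \<in> A m \<inter> B k"
        then obtain x1 x2 where x: "x1 \<in> subpts v (y + t *\<^sub>R i)" "i \<bullet> x1 \<le> of_rat q"
          "x2 \<in> subpts v y" "i \<bullet> x2 \<ge> of_rat r"
          using y by (auto simp: A_def B_def)
        then have "0 \<le> t * (i \<bullet> (x1 - x2))"
          using subpts_monotone[of x2 v y x1 "y + t *\<^sub>R i"] by simp
        then have "i \<bullet> x2 \<le> i \<bullet> x1" using t by (simp add: zero_le_mult_iff inner_diff_right)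
        moreover have "(of_rat q :: real) < of_rat r" using qr by (simp add: of_rat_less)
        ultimately show False using x by linarith
      qed
    qed
    then have "negligible (\<Union>m. \<Union>k. A m \<inter> B k)" by (intro negligible_Union_nat)
    moreover have "?A \<inter> ?B = (\<Union>m. \<Union>k. A m \<inter> B k)"
      unfolding A_def B_def by (subst (1 2) subpts_hit_Union) blast
    ultimately show ?thesis by simp
  qed
  have UN: "negligible (\<Union>j\<in>J. X j)" if "countable J" "\<And>j. j \<in> J \<Longrightarrow> negligible (X j)" for J :: "'j set" and X :: "'j \<Rightarrow> 'a set"
    by (rule negligible_countable_Union[OF countable_image[OF that(1)]]) (use that(2) in auto)
  have UN_rat: "negligible (\<Union>q\<in>J. X q)" if "\<And>q. q \<in> J \<Longrightarrow> negligible (X q)" for J :: "rat set" and X :: "rat \<Rightarrow> 'a set"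
    by (rule negligible_countable_Union[OF countable_image[OF countableI_type]]) (use that in auto)
  show ?thesis
    unfolding nonunique_subpts_eq
    by (rule UN[OF countable_finite[OF finite_Basis]], rule UN_rat, rule UN_rat, rule nE) auto
qed

text \<open>\<^term>\<open>subpts v y\<close> is the subdifferential of the conjugate of \<open>v\<close> at \<open>y\<close>, hence the names below.\<close>

definition gradpts :: "('a::real_inner \<Rightarrow> real) \<Rightarrow> 'a set" where
  "gradpts v = {y. \<exists>!x. x \<in> subpts v y}"

definition dualgrad :: "('a::real_inner \<Rightarrow> real) \<Rightarrow> 'a \<Rightarrow> 'a" where
  "dualgrad v y = (THE x. x \<in> subpts v y)"

lemma dualgrad_mem: "y \<in> gradpts v \<Longrightarrow> dualgrad v y \<in> subpts v y"
  unfolding gradpts_def dualgrad_def using theI'[of "\<lambda>x. x \<in> subpts v y"] by simp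

lemma dualgrad_unique: "y \<in> gradpts v \<Longrightarrow> x \<in> subpts v y \<Longrightarrow> dualgrad v y = x"
  using dualgrad_mem unfolding gradpts_def by auto

lemma gradptsI: "x \<in> subpts v y \<Longrightarrow> (\<And>x'. x' \<in> subpts v y \<Longrightarrow> x' = x) \<Longrightarrow> y \<in> gradpts v"
  unfolding gradpts_def by auto

lemma AE_gradpts:
  fixes v :: "'a::euclidean_space \<Rightarrow> real"
  assumes cv: "convex_on UNIV v"
  shows "AE y in lborel. subpts v y = {} \<or> y \<in> gradpts v"
proof -
  have "AE y in lebesgue. y \<notin> {y. \<exists>x1 x2. x1 \<in> subpts v y \<and> x2 \<in> subpts v y \<and> x1 \<noteq> x2}"
    using negligible_nonunique_subpts[OF cv] by (simp only: negligible_iff_null_sets AE_not_in)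
  then have "AE y in lebesgue. subpts v y = {} \<or> y \<in> gradpts v"
    by eventually_elim (auto simp: gradpts_def)
  then show ?thesis by (simp add: AE_completion_iff)
qed

text \<open>Hitting sets of closed sets are countable unions of closed sets, and on
  \<open>gradpts\<close> the fibre hits \<open>C\<close> exactly if its only point lies in
  \<open>C\<close>. Closed sets generate the Borel sets, so this amounts to the measurability of
  \<open>dualgrad\<close>.\<close>

lemma gradpts_hit:
  fixes v :: "'a::euclidean_space \<Rightarrow> real"
  assumes cv: "convex_on UNIV v" and C: "closed C"
  shows "{y \<in> gradpts v. dualgrad v y \<in> C} \<in> sets borel"
proof -
  have hit: "{y. subpts v y \<inter> A \<noteq> {}} \<in> sets borel" if "closed A" for A
  proof -
    have "closed {y. subpts v y \<inter> (A \<inter> cball 0 (real m)) \<noteq> {}}" for m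
      using that by (intro closed_subpts_hit[OF cv] closed_Int_compact compact_cball)
    then show ?thesis by (subst subpts_hit_Union) (intro sets.countable_UN image_subsetI borel_closed)
  qed
  let ?N = "{y. \<exists>x1 x2. x1 \<in> subpts v y \<and> x2 \<in> subpts v y \<and> x1 \<noteq> x2}"
  have "?N \<in> sets borel"
    unfolding nonunique_subpts_eq
    by (rule sets.countable_UN'[OF countable_finite[OF finite_Basis]], safe)
      (intro sets.countable_UN'[OF countableI_type] sets.countable_UN' image_subsetI sets.Int hit 
        closed_halfspace_le closed_halfspace_ge countableI_type)
  moreover have "gradpts v = {y. subpts v y \<inter> UNIV \<noteq> {}} - ?N" by (auto simp: gradpts_def)
  ultimately have "gradpts v \<in> sets borel" using hit[of UNIV] by auto
  moreover have "{y \<in> gradpts v. dualgrad v y \<in> C} = gradpts v \<inter> {y. subpts v y \<inter> C \<noteq> {}}"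
    using dualgrad_mem dualgrad_unique by blast
  ultimately show ?thesis using hit[OF C] by auto
qed

lemma gradpts_borel [measurable]:
  fixes v :: "'a::euclidean_space \<Rightarrow> real"
  assumes "convex_on UNIV v"
  shows "gradpts v \<in> sets borel"
  using gradpts_hit[OF assms closed_UNIV] by simp

lemma dualgrad_measurable:
  fixes v :: "'a::euclidean_space \<Rightarrow> real"
  assumes cv: "convex_on UNIV v"
  shows "dualgrad v \<in> borel_measurable (restrict_space lborel (gradpts v))"
  unfolding borel_eq_closed
proof (rule measurable_sigma_sets[where A = "Collect closed" and \<Omega> = UNIV])
  fix C :: "'a set" assume "C \<in> Collect closed"
  then have "{y \<in> gradpts v. dualgrad v y \<in> C} \<in> sets borel" using gradpts_hit[OF cv] by auto
  moreover have "dualgrad v -` C \<inter> space (restrict_space lborel (gradpts v)) = {y \<in> gradpts v. dualgrad v y \<in> C}"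
    by (auto simp: space_restrict_space)
  ultimately show "dualgrad v -` C \<inter> space (restrict_space lborel (gradpts v)) \<in> sets (restrict_space lborel (gradpts v))"
    using gradpts_borel[OF cv] by (subst sets_restrict_space_iff) auto
qed auto

subsection \<open>The Monge--Ampere measure on the graph of the subdifferential\<close>

definition MA :: "('a::euclidean_space \<Rightarrow> real) \<Rightarrow> ('a \<times> 'a) measure" where
  "MA v = distr (restrict_space lborel (gradpts v)) borel (\<lambda>y. (dualgrad v y, y))"

text \<open>Integrands are pulled back to the \<open>y\<close> variable. The indicator gives a total
  measurable function and hides the meaningless values of \<open>THE\<close> in
  \<open>dualgrad\<close>.\<close>

definition gradval :: "('a::euclidean_space \<Rightarrow> real) \<Rightarrow> ('a \<times> 'a \<Rightarrow> 'b::real_normed_vector) \<Rightarrow> 'a \<Rightarrow> 'b" where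
  "gradval v f y = indicator (gradpts v) y *\<^sub>R f (dualgrad v y, y)"

lemma gradval_gradpts: "y \<in> gradpts v \<Longrightarrow> gradval v f y = f (dualgrad v y, y)"
  by (simp add: gradval_def)

lemma gradval_empty: "subpts v y = {} \<Longrightarrow> gradval v f y = 0"
  by (auto simp: gradval_def gradpts_def indicator_def)

lemma gradval_singleton: "subpts v y = {x} \<Longrightarrow> gradval v f y = f (x, y)"
  by (auto simp: gradval_def gradpts_def dualgrad_def)

lemma graph_measurable:
  assumes "convex_on UNIV v"
  shows "(\<lambda>y. (dualgrad v y, y)) \<in> borel_measurable (restrict_space lborel (gradpts v))"
  by (intro borel_measurable_Pair dualgrad_measurable[OF assms] measurable_restrict_space1) auto

lemma sets_MA [simp]: "sets (MA v) = sets borel"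
  by (simp add: MA_def)

lemma gradval_measurable:
  fixes f :: "'a::euclidean_space \<times> 'a \<Rightarrow> 'b::euclidean_space"
  assumes cv: "convex_on UNIV v" and f: "f \<in> borel_measurable borel"
  shows "gradval v f \<in> borel_measurable lborel"
proof -
  have "(\<lambda>y. f (dualgrad v y, y)) \<in> borel_measurable (restrict_space lborel (gradpts v))"
    using measurable_compose[OF graph_measurable[OF cv] f] by simp
  then show ?thesis
    unfolding gradval_def using gradpts_borel[OF cv] by (subst (asm) borel_measurable_restrict_space_iff) auto
qed

lemma integral_MA:
  fixes f :: "'a::euclidean_space \<times> 'a \<Rightarrow> 'b::euclidean_space"
  assumes cv: "convex_on UNIV v" and f: "f \<in> borel_measurable borel"
  shows "integral\<^sup>L (MA v) f = integral\<^sup>L lborel (gradval v f)"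
proof -
  have "integral\<^sup>L (MA v) f = (\<integral>y. f (dualgrad v y, y) \<partial>restrict_space lborel (gradpts v))"
    unfolding MA_def by (rule integral_distr[OF graph_measurable[OF cv] f])
  also have "\<dots> = integral\<^sup>L lborel (gradval v f)"
    unfolding gradval_def using gradpts_borel[OF cv] by (subst integral_restrict_space) auto
  finally show ?thesis .
qed

text \<open>The second marginal is Lebesgue measure restricted to \<open>gradpts\<close>, so the
  volume of the projection of \<open>K\<close> bounds the mass of \<open>K\<close>.\<close>

lemma emeasure_MA_compact:
  fixes v :: "'a::euclidean_space \<Rightarrow> real"
  assumes cv: "convex_on UNIV v" and K: "compact K"
  shows "emeasure (MA v) K < \<infinity>"
proof -
  have Kb: "K \<in> sets borel" using K by (simp add: borel_compact)
  have sK: "compact (snd ` K)" using K by (intro compact_continuous_image continuous_on_snd continuous_on_id)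
  have "emeasure (MA v) K = emeasure (restrict_space lborel (gradpts v)) ((\<lambda>y. (dualgrad v y, y)) -` K \<inter> gradpts v)"
    unfolding MA_def by (subst emeasure_distr[OF graph_measurable[OF cv] Kb]) (simp add: space_restrict_space)
  also have "\<dots> = emeasure lborel ((\<lambda>y. (dualgrad v y, y)) -` K \<inter> gradpts v)"
    using gradpts_borel[OF cv] by (subst emeasure_restrict_space) auto
  also have "\<dots> \<le> emeasure lborel (snd ` K)"
    using sK by (intro emeasure_mono) (force intro: borel_compact)+
  also have "\<dots> < \<infinity>" using sK by (intro emeasure_bounded_finite compact_imp_bounded)
  finally show ?thesis .
qed

text \<open>The segment from \<open>x\<close> to \<open>x'\<close> crosses the sphere. If the tilted
  function \<open>v - <y, .>\<close> rises from \<open>x\<close> to the crossing point, convexity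
  makes it rise further beyond it.\<close>

lemma subpts_global:
  fixes v :: "'a::real_inner \<Rightarrow> real"
  assumes cv: "convex_on UNIV v" and e: "0 < e"
    and sph: "\<And>s. dist x s = e \<Longrightarrow> v x - y \<bullet> x < v s - y \<bullet> s"
    and x': "e < dist x x'"
  shows "v x - y \<bullet> x < v x' - y \<bullet> x'"
proof -
  define t where "t = e / dist x x'"
  have "0 < dist x x'" using e x' by linarith
  then have t: "0 < t" "t < 1" using e x' by (simp_all add: t_def divide_less_eq)
  define s where "s = (1 - t) *\<^sub>R x + t *\<^sub>R x'"
  have "s - x = t *\<^sub>R (x' - x)" by (simp add: s_def algebra_simps)
  then have "dist x s = e" using e x' by (auto simp: dist_norm norm_minus_commute[of x] t_def)
  then have "v x - y \<bullet> x < v s - y \<bullet> s" by (rule sph)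
  also have "v s \<le> (1 - t) * v x + t * v x'"
    unfolding s_def using convex_onD[OF cv, of t x x'] t by simp
  also have "(1 - t) * v x + t * v x' - y \<bullet> s = (1 - t) * (v x - y \<bullet> x) + t * (v x' - y \<bullet> x')"
    by (simp add: s_def inner_add_right algebra_simps)
  finally have "t * (v x - y \<bullet> x) < t * (v x' - y \<bullet> x')" by (simp add: algebra_simps)
  then show ?thesis using t by simp
qed

lemma subpts_seq_limit:
  fixes vs :: "nat \<Rightarrow> 'a::euclidean_space \<Rightarrow> real"
  assumes cv: "\<And>k. convex_on UNIV (vs k)" and lim: "\<And>x. (\<lambda>k. vs k x) \<longlonglongrightarrow> v x"
    and X: "X \<longlonglongrightarrow> x" and sub: "\<And>k. X k \<in> subpts (vs k) y"
  shows "x \<in> subpts v y"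
proof (rule subptsI)
  fix x'
  have "(\<lambda>k. vs k (X k) + y \<bullet> (x' - X k)) \<longlonglongrightarrow> v x + y \<bullet> (x' - x)"
    by (intro tendsto_intros convex_seq_continuous_convergence[OF cv lim] X)
  then show "v x + y \<bullet> (x' - x) \<le> v x'"
    using lim[of x'] subptsD[OF sub] by (intro LIMSEQ_le) auto
qed

text \<open>Since \<open>x\<close> is the only minimizer of the tilted function
  \<open>v - <y, .>\<close>, the strict inequality on a small sphere survives for large
  \<open>k\<close>, and the minimum of the tilted \<open>vs k\<close> over the ball is then
  global.\<close>

lemma subpts_seq_nearby:
  fixes vs :: "nat \<Rightarrow> 'a::euclidean_space \<Rightarrow> real"
  assumes cv: "\<And>k. convex_on UNIV (vs k)" and lim: "\<And>x. (\<lambda>k. vs k x) \<longlonglongrightarrow> v x"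
    and sub: "subpts v y = {x}" and e: "0 < e"
  shows "\<forall>\<^sub>F k in sequentially. subpts (vs k) y \<inter> cball x e \<noteq> {}"
proof -
  have "\<forall>\<^sub>F k in sequentially. \<forall>s. dist x s = e \<longrightarrow> vs k x - y \<bullet> x < vs k s - y \<bullet> s"
  \<comment> \<open>Failure for infinitely many \<open>k\<close> yields sphere points that
    accumulate at a second minimizer.\<close>
  proof (rule ccontr)
    assume ne: "\<not> ?thesis"
    obtain r :: "nat \<Rightarrow> nat" where r: "strict_mono r"
      "\<And>n. \<exists>s. dist x s = e \<and> \<not> (vs (r n) x - y \<bullet> x < vs (r n) s - y \<bullet> s)"
      using not_eventually_sequentiallyD[OF ne] by auto
    then obtain S where S: "\<And>n. S n \<in> sphere x e" "\<And>n. vs (r n) (S n) - y \<bullet> S n \<le> vs (r n) x - y \<bullet> x"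
      by (simp add: not_less) metis
    obtain s q where q: "s \<in> sphere x e" "strict_mono q" "(S \<circ> q) \<longlonglongrightarrow> s"
      using compact_sphere[of x e] S(1) unfolding compact_def by blast
    have lim': "(\<lambda>k. vs (r (q k)) x) \<longlonglongrightarrow> v x" for x
      using LIMSEQ_subseq_LIMSEQ[OF lim[of x] strict_mono_o[OF r(1) q(2)]] by (simp add: o_def)
    have "(\<lambda>k. vs (r (q k)) ((S \<circ> q) k)) \<longlonglongrightarrow> v s"
      by (rule convex_seq_continuous_convergence[OF cv lim' q(3)])
    then have "(\<lambda>k. vs (r (q k)) ((S \<circ> q) k) - y \<bullet> (S \<circ> q) k) \<longlonglongrightarrow> v s - y \<bullet> s"
      by (intro tendsto_intros q(3))
    moreover have "(\<lambda>k. vs (r (q k)) x - y \<bullet> x) \<longlonglongrightarrow> v x - y \<bullet> x"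
      by (intro tendsto_intros lim')
    ultimately have le: "v s - y \<bullet> s \<le> v x - y \<bullet> x"
      using S(2) by (intro LIMSEQ_le) auto
    have "s \<in> subpts v y"
    proof (rule subptsI)
      fix x' show "v s + y \<bullet> (x' - s) \<le> v x'"
        using le subptsD[of x v y x'] sub by (simp add: inner_diff_right)
    qed
    then have "s = x" using sub by simp
    then show False using q(1) e by simp
  qed
  then show ?thesis
  proof eventually_elim
    case (elim k)
    have "\<exists>m\<in>cball x e. \<forall>z\<in>cball x e. vs k m - y \<bullet> m \<le> vs k z - y \<bullet> z"
      using e by (intro continuous_attains_inf compact_cball continuous_intros
          continuous_on_subset[OF convex_continuous[OF cv]]) auto
    then obtain m where m: "m \<in> cball x e" "\<And>z. z \<in> cball x e \<Longrightarrow> vs k m - y \<bullet> m \<le> vs k z - y \<bullet> z"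
      by blast
    have "m \<in> subpts (vs k) y"
    proof (rule subptsI)
      fix x'
      have "vs k m - y \<bullet> m \<le> vs k x' - y \<bullet> x'"
      proof (cases "x' \<in> cball x e")
        case True then show ?thesis by (rule m)
      next
        case False
        have "vs k x - y \<bullet> x < vs k x' - y \<bullet> x'"
          by (rule subpts_global[OF cv e]) (use elim False in auto)
        moreover have "vs k m - y \<bullet> m \<le> vs k x - y \<bullet> x" using m(2) e by simp
        ultimately show ?thesis by simp
      qed
      then show "vs k m + y \<bullet> (x' - m) \<le> vs k x'" unfolding inner_diff_right by linarith
    qed
    then show ?case using m(1) by blast
  qed
qed

text \<open>If the limit fibre is empty, approximating fibres may be nonempty, but their points
  eventually leave the compact set \<open>K\<close>, outside of which \<open>f\<close> vanishes. If
  it is a single point, nearby points converge to it.\<close>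

lemma gradval_seq_limit:
  fixes vs :: "nat \<Rightarrow> 'a::euclidean_space \<Rightarrow> real" and f :: "'a \<times> 'a \<Rightarrow> 'b::real_normed_vector"
  assumes cv: "\<And>k. convex_on UNIV (vs k)" and lim: "\<And>x. (\<lambda>k. vs k x) \<longlonglongrightarrow> v x"
    and f: "continuous_on UNIV f" and K: "compact K" "\<And>x y. x \<notin> K \<Longrightarrow> f (x, y) = 0"
    and good: "subpts v y = {} \<or> y \<in> gradpts v" "\<And>k. subpts (vs k) y = {} \<or> y \<in> gradpts (vs k)"
  shows "(\<lambda>k. gradval (vs k) f y) \<longlonglongrightarrow> gradval v f y"
proof (cases "subpts v y = {}")
  case True
  have "\<forall>\<^sub>F k in sequentially. \<not> (y \<in> gradpts (vs k) \<and> dualgrad (vs k) y \<in> K)"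
  proof (rule ccontr)
    assume ne: "\<not> ?thesis"
    obtain r :: "nat \<Rightarrow> nat" where r: "strict_mono r" "\<And>n. y \<in> gradpts (vs (r n)) \<and> dualgrad (vs (r n)) y \<in> K"
      using not_eventually_sequentiallyD[OF ne] by auto
    obtain x q where q: "x \<in> K" "strict_mono q" "((\<lambda>n. dualgrad (vs (r n)) y) \<circ> q) \<longlonglongrightarrow> x"
      using K(1) r(2) unfolding compact_def by metis
    have lim': "(\<lambda>k. vs (r (q k)) x) \<longlonglongrightarrow> v x" for x
      using LIMSEQ_subseq_LIMSEQ[OF lim[of x] strict_mono_o[OF r(1) q(2)]] by (simp add: o_def)
    have "x \<in> subpts v y"
      by (rule subpts_seq_limit[OF cv lim' q(3)]) (use r(2) dualgrad_mem in auto)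
    then show False using True by simp
  qed
  then have "\<forall>\<^sub>F k in sequentially. gradval (vs k) f y = gradval v f y"
    unfolding gradval_empty[OF True]
    by eventually_elim (use K(2) in \<open>auto simp: gradval_def indicator_def\<close>)
  then show ?thesis by (rule tendsto_eventually)
next
  case False
  then have y: "y \<in> gradpts v" using good by simp
  then have sub: "subpts v y = {dualgrad v y}" using dualgrad_mem dualgrad_unique by blast
  have ev: "\<forall>\<^sub>F k in sequentially. y \<in> gradpts (vs k) \<and> dist (dualgrad (vs k) y) (dualgrad v y) \<le> e" if "0 < e" for e
    using subpts_seq_nearby[OF cv lim sub that]
  proof eventually_elim
    case (elim k)
    then obtain x where x: "x \<in> subpts (vs k) y" "dist (dualgrad v y) x \<le> e" by auto
    then have "y \<in> gradpts (vs k)" using good(2)[of k] by auto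
    then show ?case using dualgrad_unique[OF _ x(1)] x(2) by (auto simp: dist_commute)
  qed
  have "(\<lambda>k. dualgrad (vs k) y) \<longlonglongrightarrow> dualgrad v y"
    unfolding tendsto_iff
  proof (intro allI impI)
    fix e :: real assume "0 < e"
    then show "\<forall>\<^sub>F k in sequentially. dist (dualgrad (vs k) y) (dualgrad v y) < e"
      using ev[of "e / 2"] by (auto elim!: eventually_mono)
  qed
  then have "(\<lambda>k. f (dualgrad (vs k) y, y)) \<longlonglongrightarrow> f (dualgrad v y, y)"
    by (intro continuous_on_tendsto_compose[OF f] tendsto_Pair) auto
  moreover have "\<forall>\<^sub>F k in sequentially. gradval (vs k) f y = f (dualgrad (vs k) y, y)"
    using ev[OF zero_less_one] by eventually_elim (simp add: gradval_gradpts)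
  ultimately show ?thesis by (simp add: gradval_gradpts[OF y] tendsto_cong)
qed

text \<open>Compact support in \<open>x\<close> alone gives domination: subgradients over
  \<open>K\<close> are bounded uniformly in \<open>k\<close>, so all integrands vanish outside a
  common ball of \<open>y\<close>. This admits integrands that grow in \<open>y\<close>.\<close>

lemma gradval_seq_integral:
  fixes vs :: "nat \<Rightarrow> 'a::euclidean_space \<Rightarrow> real" and f :: "'a \<times> 'a \<Rightarrow> 'b::euclidean_space"
  assumes cv: "\<And>k. convex_on UNIV (vs k)" "convex_on UNIV v" and lim: "\<And>x. (\<lambda>k. vs k x) \<longlonglongrightarrow> v x"
    and f: "continuous_on UNIV f" and K: "compact K" "\<And>x y. x \<notin> K \<Longrightarrow> f (x, y) = 0"
  shows "integrable lborel (gradval v f)"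
    and "(\<lambda>k. integral\<^sup>L lborel (gradval (vs k) f)) \<longlonglongrightarrow> integral\<^sup>L lborel (gradval v f)"
proof -
  have fb: "f \<in> borel_measurable borel" using f by (rule borel_measurable_continuous_onI)
  obtain R where R: "\<And>x. x \<in> K \<Longrightarrow> norm x \<le> R" using K(1) compact_imp_bounded bounded_iff by metis
  obtain L where L: "\<And>k x y. norm x \<le> R \<Longrightarrow> x \<in> subpts (vs k) y \<Longrightarrow> norm y \<le> L"
    using convex_seq_subgradient_bound[OF cv(1) lim] by blast
  have "compact (f ` (K \<times> cball 0 L))"
    by (intro compact_continuous_image continuous_on_subset[OF f] compact_Times K compact_cball) auto
  then obtain B where B: "\<And>x y. x \<in> K \<Longrightarrow> norm y \<le> L \<Longrightarrow> norm (f (x, y)) \<le> B"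
    using compact_imp_bounded bounded_iff by (metis (no_types, lifting) imageI mem_Sigma_iff mem_cball_0)
  \<comment> \<open>The absolute value keeps \<open>w\<close> nonnegative when the bound for
    \<open>B\<close> is vacuous, as for empty \<open>K\<close>.\<close>
  define w where "w = (\<lambda>y::'a. indicator (cball 0 L) y * \<bar>B\<bar>)"
  have w: "integrable lborel w"
    unfolding w_def by (intro integrable_mult_left integrable_real_indicator emeasure_bounded_finite) auto
  have bd: "AE y in lborel. norm (gradval (vs k) f y) \<le> w y" for k
  proof (rule AE_I2)
    fix y show "norm (gradval (vs k) f y) \<le> w y"
    proof (cases "y \<in> gradpts (vs k) \<and> dualgrad (vs k) y \<in> K")
      case True
      then have "norm y \<le> L" using L R dualgrad_mem by blast
      then show ?thesis using True B[of "dualgrad (vs k) y" y] by (auto simp: gradval_gradpts w_def)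
    next
      case False
      then have "gradval (vs k) f y = 0" using K(2) by (auto simp: gradval_def indicator_def)
      then show ?thesis by (simp add: w_def)
    qed
  qed
  have "AE y in lborel. \<forall>k. subpts (vs k) y = {} \<or> y \<in> gradpts (vs k)"
    unfolding AE_all_countable using AE_gradpts[OF cv(1)] by auto
  then have lm: "AE y in lborel. (\<lambda>k. gradval (vs k) f y) \<longlonglongrightarrow> gradval v f y"
    using AE_gradpts[OF cv(2)]
  proof eventually_elim
    case (elim y)
    then show ?case by (intro gradval_seq_limit[OF cv(1) lim f K]) auto
  qed
  show "integrable lborel (gradval v f)"
    by (rule integrable_dominated_convergence[OF gradval_measurable[OF cv(2) fb] gradval_measurable[OF cv(1) fb] w lm bd])
  show "(\<lambda>k. integral\<^sup>L lborel (gradval (vs k) f)) \<longlonglongrightarrow> integral\<^sup>L lborel (gradval v f)"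
    by (rule integral_dominated_convergence[OF gradval_measurable[OF cv(2) fb] gradval_measurable[OF cv(1) fb] w lm bd])
qed

lemma gradval_integrable:
  fixes f :: "'a::euclidean_space \<times> 'a \<Rightarrow> 'b::euclidean_space"
  assumes "convex_on UNIV v" "continuous_on UNIV f" "compact K" "\<And>x y. x \<notin> K \<Longrightarrow> f (x, y) = 0"
  shows "integrable lborel (gradval v f)"
  using gradval_seq_integral(1)[of "\<lambda>_. v" v f K] assms by auto

subsection \<open>Change of variables for arbitrary finite index types\<close>

text \<open>The library proves Sard's theorem and the change of variables formula only for vectors with
well-ordered index type. A type copy with an arbitrary linear order transports them to every finite type.\<close>

typedef 'a linidx = "UNIV :: 'a set" by simp

definition idxnum :: "'a::finite \<Rightarrow> nat" where
  "idxnum = (SOME f. inj f)"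

lemma inj_idxnum: "inj idxnum"
proof -
  have "\<exists>f::'a \<Rightarrow> nat. inj f"
    using finite_imp_inj_to_nat_seg[of "UNIV :: 'a set"] by auto
  then show ?thesis unfolding idxnum_def by (rule someI_ex)
qed

instance linidx :: (finite) finite
proof
  have "(UNIV :: 'a linidx set) = range Abs_linidx"
    by (metis Abs_linidx_cases surjI)
  then show "finite (UNIV :: 'a linidx set)" by (metis finite finite_imageI)
qed

instantiation linidx :: (finite) wellorder
begin

definition less_eq_linidx :: "'a linidx \<Rightarrow> 'a linidx \<Rightarrow> bool" where
  "less_eq_linidx x y \<longleftrightarrow> idxnum (Rep_linidx x) \<le> idxnum (Rep_linidx y)"

definition less_linidx :: "'a linidx \<Rightarrow> 'a linidx \<Rightarrow> bool" where
  "less_linidx x y \<longleftrightarrow> idxnum (Rep_linidx x) < idxnum (Rep_linidx y)"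

instance
proof
  fix x y :: "'a linidx"
  show "x \<le> y \<Longrightarrow> y \<le> x \<Longrightarrow> x = y"
    using inj_idxnum by (metis Rep_linidx_inject antisym inj_eq less_eq_linidx_def)
next
  fix P :: "'a linidx \<Rightarrow> bool" and a
  assume "\<And>x. (\<And>y. y < x \<Longrightarrow> P y) \<Longrightarrow> P x"
  then show "P a"
    using measure_induct_rule[of "\<lambda>x. idxnum (Rep_linidx x)" P a] unfolding less_linidx_def by blast
qed (auto simp: less_eq_linidx_def less_linidx_def)

end

lemma linidx_inverse [simp]: "Rep_linidx (Abs_linidx i) = i" "Abs_linidx (Rep_linidx j) = j"
  by (simp_all add: Abs_linidx_inverse Rep_linidx_inverse)

lemma bij_Rep_linidx: "bij Rep_linidx"
  by (rule bij_betw_byWitness[where f' = Abs_linidx]) auto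

lemma bij_Abs_linidx: "bij Abs_linidx"
  by (rule bij_betw_byWitness[where f' = Rep_linidx]) auto

definition to_lin :: "'b^'n \<Rightarrow> 'b^('n::finite linidx)" where
  "to_lin x = (\<chi> i. x $ Rep_linidx i)"

definition of_lin :: "'b^('n::finite linidx) \<Rightarrow> 'b^'n" where
  "of_lin x = (\<chi> i. x $ Abs_linidx i)"

lemma to_lin_of_lin [simp]: "to_lin (of_lin x) = x" "of_lin (to_lin y) = y"
  by (simp_all add: to_lin_def of_lin_def)

lemma to_lin_image_iff: "y \<in> to_lin ` S \<longleftrightarrow> of_lin y \<in> S"
  by (metis image_iff to_lin_of_lin)

lemma vimage_to_lin: "of_lin -` S = to_lin ` S"
  by (simp add: set_eq_iff to_lin_image_iff)

lemma linear_to_lin: "linear (to_lin :: real^'n::finite \<Rightarrow> _)"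
  by (rule linearI) (simp_all add: to_lin_def vec_eq_iff)

lemma linear_of_lin: "linear (of_lin :: _ \<Rightarrow> real^'n::finite)"
  by (rule linearI) (simp_all add: of_lin_def vec_eq_iff)

lemma bounded_linear_to_lin: "bounded_linear (to_lin :: real^'n::finite \<Rightarrow> _)"
  using linear_to_lin linear_conv_bounded_linear by blast

lemma bounded_linear_of_lin: "bounded_linear (of_lin :: _ \<Rightarrow> real^'n::finite)"
  using linear_of_lin linear_conv_bounded_linear by blast

lemma of_lin_measurable [measurable]: "of_lin \<in> borel_measurable (borel :: (real^('n::finite linidx)) measure)"
  by (intro borel_measurable_continuous_onI linear_continuous_on bounded_linear_of_lin)

text \<open>Lebesgue measure is determined by its values on boxes, and relabelling coordinates
  permutes the factors of the box volume.\<close>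

lemma lborel_of_lin: "lborel = distr lborel borel (of_lin :: _ \<Rightarrow> real^'n::finite)"
proof (rule lborel_eqI)
  fix l u :: "real^'n" assume le: "\<And>b. b \<in> Basis \<Longrightarrow> l \<bullet> b \<le> u \<bullet> b"
  have le': "l $ i \<le> u $ i" for i using le[of "axis i 1"] by (simp add: inner_axis axis_in_Basis_iff)
  have P: "(\<Prod>b\<in>Basis. x \<bullet> b) = (\<Prod>i\<in>UNIV. x $ i)" for x :: "real^'m::finite"
  proof -
    have "Basis = (\<lambda>i. axis i 1 :: real^'m) ` UNIV" by (auto simp: Basis_vec_def)
    moreover have "inj (\<lambda>i. axis i 1 :: real^'m)" by (auto simp: inj_def axis_eq_axis)
    ultimately show ?thesis using prod.reindex[of "\<lambda>i. axis i 1 :: real^'m" UNIV "\<lambda>b. x \<bullet> b"] by (simp add: inner_axis o_def)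
  qed
  have "of_lin -` box l u = box (to_lin l) (to_lin u)"
    by (auto simp: mem_box_cart of_lin_def to_lin_def) (metis linidx_inverse)+
  then have "emeasure (distr lborel borel of_lin) (box l u) = emeasure lborel (box (to_lin l) (to_lin u))"
    by (simp add: emeasure_distr)
  also have "\<dots> = (\<Prod>b\<in>Basis. (to_lin u - to_lin l) \<bullet> b)"
  proof (rule emeasure_lborel_box)
    fix b :: "real^'n linidx" assume "b \<in> Basis"
    then obtain i where "b = axis i 1" by (auto simp: Basis_vec_def)
    then show "to_lin l \<bullet> b \<le> to_lin u \<bullet> b" using le' by (simp add: inner_axis to_lin_def)
  qed
  also have "(\<Prod>b\<in>Basis. (to_lin u - to_lin l) \<bullet> b) = (\<Prod>b\<in>Basis. (u - l) \<bullet> b)"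
    unfolding P to_lin_def
    using prod.reindex_bij_betw[OF bij_Rep_linidx, of "\<lambda>i. (u - l) $ i"] by simp
  finally show "emeasure (distr lborel borel of_lin) (box l u) = ennreal (\<Prod>b\<in>Basis. (u - l) \<bullet> b)" .
qed simp

text \<open>Conjugation by the relabelling turns a transposition into a transposition, so parity is
  preserved; the comparison of determinants rests on this.\<close>

lemma swapidseq_linidx:
  "swapidseq n p \<Longrightarrow> swapidseq n (Abs_linidx \<circ> p \<circ> Rep_linidx)"
proof (induction rule: swapidseq.induct)
  case id
  have "Abs_linidx \<circ> id \<circ> Rep_linidx = (id :: 'a linidx \<Rightarrow> _)" by (auto simp: fun_eq_iff)
  then show ?case by (metis swapidseq.id)
next
  case (comp_Suc n p a b)
  have "Abs_linidx \<circ> (Transposition.transpose a b \<circ> p) \<circ> Rep_linidx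
      = Transposition.transpose (Abs_linidx a) (Abs_linidx b) \<circ> (Abs_linidx \<circ> p \<circ> Rep_linidx)"
    by (auto simp: fun_eq_iff Transposition.transpose_def) (metis linidx_inverse)+
  moreover have "Abs_linidx a \<noteq> Abs_linidx b" using comp_Suc by (metis linidx_inverse(1))
  ultimately show ?case using swapidseq.comp_Suc[OF comp_Suc.IH] by metis
qed

lemma sign_linidx:
  assumes "permutation p"
  shows "sign (Abs_linidx \<circ> p \<circ> Rep_linidx) = sign p"
proof -
  obtain n where n: "swapidseq n p" using assms by (auto simp: permutation_def)
  show ?thesis
    using evenperm_unique[OF n refl] evenperm_unique[OF swapidseq_linidx[OF n] refl]
    by (simp add: sign_def)
qed

lemma det_linidx:
  fixes M :: "real^'n::finite^'n"
  shows "det (\<chi> i j. M $ Rep_linidx i $ Rep_linidx j) = det M"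
  unfolding det_def
proof (rule sum.reindex_bij_witness[where i = "\<lambda>p. Abs_linidx \<circ> p \<circ> Rep_linidx" and j = "\<lambda>p. Rep_linidx \<circ> p \<circ> Abs_linidx"])
  fix p :: "'n linidx \<Rightarrow> 'n linidx" assume "p \<in> {p. p permutes UNIV}"
  then have p: "bij p" by (simp add: permutes_bij)
  then show q: "Rep_linidx \<circ> p \<circ> Abs_linidx \<in> {p. p permutes UNIV}"
    using bij_Rep_linidx bij_Abs_linidx bij_comp by (auto simp: bij_imp_permutes intro!: bij_imp_permutes bij_comp)
  show eq: "Abs_linidx \<circ> (Rep_linidx \<circ> p \<circ> Abs_linidx) \<circ> Rep_linidx = p" by (simp add: fun_eq_iff)
  have "permutation (Rep_linidx \<circ> p \<circ> Abs_linidx)" using q permutation_permutes by (metis finite mem_Collect_eq)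
  then have "sign p = sign (Rep_linidx \<circ> p \<circ> Abs_linidx)" using sign_linidx eq by metis
  moreover have "(\<Prod>i\<in>UNIV. M $ i $ (Rep_linidx \<circ> p \<circ> Abs_linidx) i) = (\<Prod>i\<in>UNIV. M $ Rep_linidx i $ Rep_linidx (p i))"
    using prod.reindex_bij_betw[OF bij_Rep_linidx, of "\<lambda>i. M $ i $ (Rep_linidx \<circ> p \<circ> Abs_linidx) i"] by simp
  ultimately show "of_int (sign (Rep_linidx \<circ> p \<circ> Abs_linidx)) * (\<Prod>i\<in>UNIV. M $ i $ (Rep_linidx \<circ> p \<circ> Abs_linidx) i) =
    of_int (sign p) * (\<Prod>i\<in>UNIV. (\<chi> i j. M $ Rep_linidx i $ Rep_linidx j) $ i $ p i)" by simp
next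
  fix p :: "'n \<Rightarrow> 'n" assume "p \<in> {p. p permutes UNIV}"
  then have p: "bij p" by (simp add: permutes_bij)
  then show "Abs_linidx \<circ> p \<circ> Rep_linidx \<in> {p. p permutes UNIV}"
    using bij_Rep_linidx bij_Abs_linidx by (auto intro!: bij_imp_permutes bij_comp)
  show "Rep_linidx \<circ> (Abs_linidx \<circ> p \<circ> Rep_linidx) \<circ> Abs_linidx = p" by (simp add: fun_eq_iff)
qed

lemma to_lin_matrix_mult:
  fixes M :: "real^'n::finite^'n"
  shows "to_lin (M *v of_lin h) = (\<chi> i j. M $ Rep_linidx i $ Rep_linidx j) *v h"
  by (simp add: vec_eq_iff to_lin_def of_lin_def matrix_vector_mult_def)
    (intro allI sum.reindex_bij_witness[where i = Rep_linidx and j = Abs_linidx], auto)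

lemma to_lin_conj_derivative:
  fixes g :: "real^'n::finite \<Rightarrow> real^'n"
  assumes "(g has_derivative (\<lambda>h. H *v h)) (at (of_lin x))"
  shows "((\<lambda>x. to_lin (g (of_lin x))) has_derivative
     (\<lambda>h. (\<chi> i j. H $ Rep_linidx i $ Rep_linidx j) *v h)) (at x)"
proof -
  have 1: "(of_lin has_derivative of_lin) (at x)"
    by (rule bounded_linear_imp_has_derivative[OF bounded_linear_of_lin])
  have "((\<lambda>x. to_lin (g (of_lin x))) has_derivative (\<lambda>h. to_lin (H *v of_lin h))) (at x)"
    using has_derivative_compose[OF has_derivative_compose[OF 1 assms] bounded_linear_imp_has_derivative[OF bounded_linear_to_lin]]
    by simp
  then show ?thesis by (simp only: to_lin_matrix_mult)
qed

text \<open>\<open>neg\<close> lets the image of \<open>S\<close> miss a null set, such as critical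
  values. The integrand \<open>h\<close> enters as a separate Borel function since \<open>H\<close>
  carries no measurability assumption and the formula is proved in the Lebesgue completion.\<close>

lemma change_of_variables_wellorder:
  fixes g :: "real^'m::{finite,wellorder} \<Rightarrow> real^'m::_" and f h :: "real^'m::_ \<Rightarrow> real"
  assumes S: "S \<in> sets borel" and der: "\<And>x. x \<in> S \<Longrightarrow> (g has_derivative (\<lambda>h. H x *v h)) (at x)"
    and inj: "inj_on g S" and f: "integrable lborel f" and neg: "negligible {y. f y \<noteq> 0 \<and> y \<notin> g ` S}"
    and h: "h \<in> borel_measurable borel" "\<And>x. h x = (if x \<in> S then \<bar>det (H x)\<bar> * f (g x) else 0)"
  shows "integral\<^sup>L lborel f = integral\<^sup>L lborel h"
proof -
  \<comment> \<open>The transformation formula is about vector-valued integrands; \<open>vec\<close>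
    into \<open>real^1\<close> makes the scalar \<open>f\<close> one of them.\<close>
  let ?F = "\<lambda>y. vec (f y) :: real^1"
  let ?F' = "\<lambda>x. \<bar>det (matrix (\<lambda>h. H x *v h))\<bar> *\<^sub>R ?F (g x)"
  have bl: "bounded_linear (vec :: real \<Rightarrow> real^1)"
    using linear_conv_bounded_linear linear_vec by blast
  have fl: "integrable lebesgue f" using f by (simp add: integrable_completion)
  then have "f absolutely_integrable_on UNIV" by (simp add: set_integrable_def)
  then have "?F absolutely_integrable_on UNIV"
    using absolutely_integrable_linear[OF _ bl] by (simp add: o_def)
  then have F: "?F absolutely_integrable_on g ` S" 
    by (subst absolutely_integrable_spike_set_eq[where T = UNIV])
      (auto intro: negligible_subset[OF neg] simp: vec_eq_iff)
  have "(\<lambda>x. \<bar>det (matrix (\<lambda>h. H x *v h))\<bar> *\<^sub>R ?F (g x)) absolutely_integrable_on S \<and>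
        integral S (\<lambda>x. \<bar>det (matrix (\<lambda>h. H x *v h))\<bar> *\<^sub>R ?F (g x)) = integral (g ` S) ?F"
    using has_absolute_integral_change_of_variables[OF _ _ inj, of "\<lambda>x h. H x *v h" ?F "integral (g ` S) ?F"]
      S der F by (auto intro: has_derivative_at_withinI)
  then have A: "?F' absolutely_integrable_on S" and B: "integral S ?F' = integral (g ` S) ?F" by auto
  have bd: "bounded_linear (\<lambda>x::real^1. x $ 1)" by (rule bounded_linear_vec_nth)
  have c1: "(\<lambda>x. \<bar>det (H x)\<bar> * f (g x)) absolutely_integrable_on S"
    using absolutely_integrable_linear[OF A bd] by (simp add: o_def)
  have "integral S (\<lambda>x. \<bar>det (H x)\<bar> * f (g x)) = integral S ?F' $ 1"
    using integral_linear[OF _ bd, of ?F' S] A by (simp add: o_def absolutely_integrable_on_def)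
  also have "\<dots> = integral (g ` S) ?F $ 1" by (simp only: B)
  also have "\<dots> = integral (g ` S) f"
    using integral_linear[OF _ bd, of ?F "g ` S"] F by (simp add: o_def absolutely_integrable_on_def)
  also have "\<dots> = integral UNIV f"
    by (intro integral_spike_set) (auto intro: negligible_subset[OF neg])
  also have "\<dots> = integral\<^sup>L lborel f" using f by (rule integral_lborel)
  finally have 1: "integral S (\<lambda>x. \<bar>det (H x)\<bar> * f (g x)) = integral\<^sup>L lborel f" .
  have hh: "h = (\<lambda>x. indicator S x *\<^sub>R (\<bar>det (H x)\<bar> * f (g x)))" using h(2) by (auto simp: fun_eq_iff)
  have "integral S (\<lambda>x. \<bar>det (H x)\<bar> * f (g x)) = (LINT x|lebesgue. indicator S x *\<^sub>R (\<bar>det (H x)\<bar> * f (g x)))"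
    using set_lebesgue_integral_eq_integral(2)[OF c1] by (simp add: set_lebesgue_integral_def)
  also have "\<dots> = integral\<^sup>L lebesgue h" by (rule arg_cong[OF hh[symmetric]])
  also have "\<dots> = integral\<^sup>L lborel h" using h(1) by (simp add: integral_completion)
  finally show ?thesis using 1 by simp
qed

lemma change_of_variables_borel:
  fixes g :: "real^'n::finite \<Rightarrow> real^'n" and f h :: "real^'n \<Rightarrow> real"
  assumes S: "S \<in> sets borel" and der: "\<And>x. x \<in> S \<Longrightarrow> (g has_derivative (\<lambda>h. H x *v h)) (at x)"
    and inj: "inj_on g S" and f: "integrable lborel f" and neg: "negligible {y. f y \<noteq> 0 \<and> y \<notin> g ` S}"
    and h: "h \<in> borel_measurable borel" "\<And>x. h x = (if x \<in> S then \<bar>det (H x)\<bar> * f (g x) else 0)"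
  shows "integral\<^sup>L lborel f = integral\<^sup>L lborel h"
proof -
  have tr: "integral\<^sup>L lborel k = integral\<^sup>L lborel (\<lambda>x. k (of_lin x))" if "k \<in> borel_measurable borel" for k :: "real^'n \<Rightarrow> real"
    by (subst lborel_of_lin, subst integral_distr) (use that in auto)
  have fb: "f \<in> borel_measurable borel" using f by auto
  have "integral\<^sup>L lborel (\<lambda>x. f (of_lin x)) = integral\<^sup>L lborel (\<lambda>x. h (of_lin x))"
  proof (rule change_of_variables_wellorder[where S = "of_lin -` S" and g = "\<lambda>x. to_lin (g (of_lin x))"
      and H = "\<lambda>x. \<chi> i j. H (of_lin x) $ Rep_linidx i $ Rep_linidx j"])
    show "of_lin -` S \<in> sets borel" using measurable_sets[OF of_lin_measurable S] by simp
    show "((\<lambda>x. to_lin (g (of_lin x))) has_derivative (*v) (\<chi> i j. H (of_lin x) $ Rep_linidx i $ Rep_linidx j)) (at x)"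
      if "x \<in> of_lin -` S" for x using to_lin_conj_derivative[OF der] that by simp
    show "inj_on (\<lambda>x. to_lin (g (of_lin x))) (of_lin -` S)"
      using inj by (auto simp: inj_on_def) (metis to_lin_of_lin)
    show "integrable lborel (\<lambda>x. f (of_lin x))"
    proof -
      have "integrable (distr lborel borel (of_lin :: _ \<Rightarrow> real^'n)) f" using f by (simp flip: lborel_of_lin)
      then show ?thesis by (subst (asm) integrable_distr_eq) (use fb in auto)
    qed
    have "{y. f (of_lin y) \<noteq> 0 \<and> y \<notin> (\<lambda>x. to_lin (g (of_lin x))) ` (of_lin -` S)} = to_lin ` {y. f y \<noteq> 0 \<and> y \<notin> g ` S}"
    proof -
      have im: "(\<lambda>x. to_lin (g (of_lin x))) ` (of_lin -` S) = to_lin ` g ` S"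
        unfolding vimage_to_lin image_image by simp
      have "{y. f (of_lin y) \<noteq> 0 \<and> y \<notin> to_lin ` g ` S} = of_lin -` {y. f y \<noteq> 0 \<and> y \<notin> g ` S}"
        by (simp add: set_eq_iff to_lin_image_iff)
      then show ?thesis by (simp only: im flip: vimage_to_lin)
    qed
    also have "negligible \<dots>"
      by (rule negligible_differentiable_image_negligible[OF _ neg])
        (auto simp: bij_betw_same_card[OF bij_Rep_linidx] intro: linear_imp_differentiable_on linear_to_lin)
    finally show "negligible {y. f (of_lin y) \<noteq> 0 \<and> y \<notin> (\<lambda>x. to_lin (g (of_lin x))) ` (of_lin -` S)}" .
    show "(\<lambda>x. h (of_lin x)) \<in> borel_measurable borel" using measurable_compose[OF of_lin_measurable h(1)] .
    show "h (of_lin x) = (if x \<in> of_lin -` S then \<bar>det (\<chi> i j. H (of_lin x) $ Rep_linidx i $ Rep_linidx j)\<bar> * f (of_lin (to_lin (g (of_lin x)))) else 0)" for x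
      by (simp add: h(2)[of "of_lin x"] det_linidx)
  qed
  then show ?thesis using tr[OF fb] tr[OF h(1)] by simp
qed

lemma negligible_critical_values:
  fixes g :: "real^'n::finite \<Rightarrow> real^'n"
  assumes der: "\<And>x. x \<in> S \<Longrightarrow> (g has_derivative (\<lambda>h. H x *v h)) (at x)"
    and sing: "\<And>x. x \<in> S \<Longrightarrow> det (H x) = 0"
  shows "negligible (g ` S)"
proof -
  have "negligible ((\<lambda>x. to_lin (g (of_lin x))) ` (of_lin -` S))"
  proof (rule baby_Sard)
    fix x assume x: "x \<in> of_lin -` S"
    let ?M = "\<chi> i j. H (of_lin x) $ Rep_linidx i $ Rep_linidx j"
    show "((\<lambda>x. to_lin (g (of_lin x))) has_derivative (\<lambda>h. ?M *v h)) (at x within of_lin -` S)"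
      using to_lin_conj_derivative[OF der] x by (auto intro: has_derivative_at_withinI)
    show "rank (matrix (\<lambda>h. ?M *v h)) < CARD('n linidx)"
      using sing[of "of_lin x"] x det_linidx[of "H (of_lin x)"] by (simp flip: det_eq_0_rank)
  qed simp
  then have "negligible (of_lin ` ((\<lambda>x. to_lin (g (of_lin x))) ` (of_lin -` S)))"
    by (rule negligible_differentiable_image_negligible[rotated])
      (simp_all add: bij_betw_same_card[OF bij_Rep_linidx] linear_imp_differentiable_on linear_of_lin)
  also have "of_lin ` ((\<lambda>x. to_lin (g (of_lin x))) ` (of_lin -` S)) = g ` S"
    unfolding vimage_to_lin by (simp add: image_image)
  finally show ?thesis .
qed

lemma integral_orthogonal:
  fixes A :: "real^'n::finite^'n" and f :: "real^'n \<Rightarrow> real"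
  assumes A: "orthogonal_matrix A" and f: "integrable lborel f"
  shows "integral\<^sup>L lborel (\<lambda>y. f (A *v y)) = integral\<^sup>L lborel f"
proof -
  have inv: "transpose A *v (A *v x) = x" "A *v (transpose A *v x) = x" for x
    using A by (metis matrix_vector_mul_assoc matrix_vector_mul_lid orthogonal_matrix_def)+
  have sj: "range ((*v) A) = UNIV" by (metis inv(2) surjI)
  have "integral\<^sup>L lborel f = integral\<^sup>L lborel (\<lambda>y. f (A *v y))"
  proof (rule change_of_variables_borel[where S = UNIV and H = "\<lambda>_. A"])
    show "((*v) A has_derivative (*v) A) (at x)" for x
      by (simp add: linear_imp_has_derivative)
    show "inj ((*v) A)" by (metis inv(1) injI)
    show "(\<lambda>y. f (A *v y)) \<in> borel_measurable borel"
      using f by (intro measurable_compose[OF borel_measurable_continuous_onI[of "\<lambda>y. A *v y"]]) 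
        (auto intro: linear_continuous_on matrix_vector_mul_bounded_linear)
  qed (use f det_orthogonal_matrix[OF A] in \<open>auto simp: sj\<close>)
  then show ?thesis by simp
qed

section \<open>Gradients of C^2 convex functions and their Hessian determinants\<close>

lemma subgradient_eq_gradient:
  fixes v :: "'a::real_inner \<Rightarrow> real"
  assumes d: "(v has_derivative (\<lambda>h. g \<bullet> h)) (at x)" and y: "x \<in> subpts v y"
  shows "y = g"
proof -
  have "((\<lambda>z. v z - y \<bullet> z) has_derivative (\<lambda>h. g \<bullet> h - y \<bullet> h)) (at x)"
    by (intro derivative_intros d)
  moreover have "\<forall>z\<in>UNIV. v x - y \<bullet> x \<le> v z - y \<bullet> z"
  proof
    fix z show "v x - y \<bullet> x \<le> v z - y \<bullet> z" 
      using subptsD[OF y, of z] by (simp add: inner_diff_right)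
  qed
  ultimately have "(\<lambda>h. g \<bullet> h - y \<bullet> h) = (\<lambda>h. 0)"
    by (intro differential_zero_maxmin[of x UNIV]) auto
  then have "(g - y) \<bullet> (g - y) = 0" by (metis inner_diff_left)
  then show ?thesis by simp
qed

text \<open>No symmetry of \<open>M\<close> is available, so the determinant is followed along the
  segment from the identity to \<open>M\<close>: before the end the form is positive definite, hence
  the matrix nonsingular, and the sign cannot change from that of
  \<open>det (mat 1) = 1\<close>.\<close>

lemma det_nonneg_if_nonneg_form:
  fixes M :: "real^'n::finite^'n"
  assumes pos: "\<And>h. 0 \<le> h \<bullet> (M *v h)"
  shows "0 \<le> det M"
proof -
  define N where "N t = t *\<^sub>R M + (1 - t) *\<^sub>R mat 1" for t :: real
  have Nv: "N t *v h = t *\<^sub>R (M *v h) + (1 - t) *\<^sub>R h" for t h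
    by (simp add: N_def matrix_vector_mult_add_rdistrib scaleR_matrix_vector_assoc[symmetric])
  have cont: "continuous_on {0..1} (\<lambda>t. det (N t))"
    unfolding N_def det_def by (intro continuous_intros)
  have nz: "det (N t) \<noteq> 0" if t: "0 \<le> t" "t < 1" for t
  proof -
    have "h = 0" if "N t *v h = 0" for h
    proof -
      have "0 = h \<bullet> (N t *v h)" using that by simp
      also have "\<dots> = t * (h \<bullet> (M *v h)) + (1 - t) * (h \<bullet> h)"
        by (simp add: Nv inner_add_right)
      finally have "(1 - t) * (h \<bullet> h) \<le> 0" using pos[of h] t by (smt (verit) mult_nonneg_nonneg)
      then have "h \<bullet> h \<le> 0" using t by (simp add: mult_le_0_iff)
      then show "h = 0" by (metis inner_gt_zero_iff not_le)
    qed
    then have "\<forall>h. N t *v h = 0 \<longrightarrow> h = 0" by blast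
    then show ?thesis
      by (simp only: invertible_det_nz[symmetric] invertible_left_inverse matrix_left_invertible_ker)
  qed
  have one: "det (N 0) = 1" by (simp add: N_def)
  have "0 < det (N t)" if t: "0 \<le> t" "t < 1" for t
  proof (rule ccontr)
    assume "\<not> 0 < det (N t)"
    then have "\<exists>s\<ge>0. s \<le> t \<and> det (N s) = 0"
      using one t by (intro IVT2'[of "\<lambda>t. det (N t)" t 0 0] continuous_on_subset[OF cont]) auto
    then show False using nz t by force
  qed
  then have ge: "0 \<le> det (N (1 - 1 / real (Suc k)))" for k
    by (intro less_imp_le) auto
  have "(\<lambda>k. 1 - 1 / real (Suc k)) \<longlonglongrightarrow> 1 - 0"
    by (intro tendsto_diff tendsto_const LIMSEQ_Suc lim_1_over_n)
  then have lim1: "(\<lambda>k. 1 - 1 / real (Suc k)) \<longlonglongrightarrow> 1" by simp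
  have "(\<lambda>k. det (N (1 - 1 / real (Suc k)))) \<longlonglongrightarrow> det (N 1)"
    by (rule continuous_on_tendsto_compose[OF cont lim1]) (auto simp: divide_simps)
  then have "0 \<le> det (N 1)" using ge LIMSEQ_le_const by blast
  then show ?thesis by (simp add: N_def)
qed

text \<open>For the last claim, the fibre over \<open>g x\<close> is convex. A second point would
  make \<open>g\<close> constant along a segment starting at \<open>x\<close>, and its direction
  would lie in the kernel of \<open>H x\<close>.\<close>

lemma C2_with_facts:
  fixes v :: "'n::finite cvfun"
  assumes cv: "convex_on UNIV v" and C2: "C2_with v g H"
  shows "x \<in> subpts v y \<longleftrightarrow> g x = y" and "0 \<le> h \<bullet> (H x *v h)"
    and "det (H x) \<noteq> 0 \<Longrightarrow> subpts v (g x) = {x}"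
proof -
  have dv: "(v has_derivative (\<lambda>h. g x \<bullet> h)) (at x)" for x using C2 by (simp add: C2_with_def)
  have dg: "(g has_derivative (\<lambda>h. H x *v h)) (at x)" for x using C2 by (simp add: C2_with_def)
  show sub: "x \<in> subpts v y \<longleftrightarrow> g x = y" for x y
    using subgradient_exists[OF cv, of x] subgradient_eq_gradient[OF dv] by metis
  have line: "((\<lambda>t. g (x + t *\<^sub>R h)) has_vector_derivative H x *v h) (at 0 within S)" for x h S
  proof -
    have "((\<lambda>t. x + t *\<^sub>R h) has_derivative (\<lambda>t. t *\<^sub>R h)) (at 0 within S)"
      by (auto intro!: derivative_eq_intros)
    then have "((\<lambda>t. g (x + t *\<^sub>R h)) has_derivative (\<lambda>t. H x *v (t *\<^sub>R h))) (at 0 within S)"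
      using has_derivative_compose[of "\<lambda>t. x + t *\<^sub>R h" _ 0 S g] dg[of x] by simp
    then show ?thesis by (simp add: has_vector_derivative_def matrix_vector_mult_scaleR)
  qed
  \<comment> \<open>A one-sided difference quotient suffices: positivity uses \<open>t > 0\<close>,
    and the segment to a second point leaves \<open>x\<close> in one direction.\<close>
  have lim: "((\<lambda>t. (g (x + t *\<^sub>R h) - g x) /\<^sub>R t) \<longlongrightarrow> H x *v h) (at 0 within {0<..})" for x h
  proof -
    have "((\<lambda>t. (1 / norm (t - 0)) *\<^sub>R (g (x + t *\<^sub>R h) - (g (x + 0 *\<^sub>R h) + (t - 0) *\<^sub>R (H x *v h)))) \<longlongrightarrow> 0)
        (at 0 within {0<..})"
      using line[of x h "{0<..}"] unfolding has_vector_derivative_def has_derivative_within by blast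
    moreover have "\<forall>\<^sub>F t in at_right 0. (1 / norm (t - 0)) *\<^sub>R (g (x + t *\<^sub>R h) - (g (x + 0 *\<^sub>R h) + (t - 0) *\<^sub>R (H x *v h)))
        = (g (x + t *\<^sub>R h) - g x) /\<^sub>R t - H x *v h"
      by (rule eventually_at_rightI[of 0 1]) (auto simp: divide_inverse scaleR_diff_right algebra_simps)
    ultimately have "((\<lambda>t. (g (x + t *\<^sub>R h) - g x) /\<^sub>R t - H x *v h) \<longlongrightarrow> 0) (at_right 0)"
      by (rule Lim_transform_eventually)
    then show ?thesis by (rule LIM_zero_cancel)
  qed
  show "0 \<le> h \<bullet> (H x *v h)"
  proof (rule tendsto_lowerbound)
    show "((\<lambda>t. h \<bullet> ((g (x + t *\<^sub>R h) - g x) /\<^sub>R t)) \<longlongrightarrow> h \<bullet> (H x *v h)) (at_right 0)"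
      by (intro tendsto_intros lim)
    have "0 \<le> h \<bullet> ((g (x + t *\<^sub>R h) - g x) /\<^sub>R t)" if "0 < t" for t
    proof -
      have "0 \<le> (g (x + t *\<^sub>R h) - g x) \<bullet> (x + t *\<^sub>R h - x)"
        using sub by (intro subpts_monotone[of _ v]) auto
      then have "0 \<le> t * (h \<bullet> (g (x + t *\<^sub>R h) - g x))" by (simp add: inner_commute)
      then show ?thesis using that by (simp add: zero_le_mult_iff)
    qed
    then show "\<forall>\<^sub>F t in at_right 0. 0 \<le> h \<bullet> ((g (x + t *\<^sub>R h) - g x) /\<^sub>R t)"
      by (intro eventually_at_rightI[of 0 1]) auto
  qed simp
  show "subpts v (g x) = {x}" if det: "det (H x) \<noteq> 0"
  proof -
    have "x' = x" if x': "x' \<in> subpts v (g x)" for x'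
    proof -
      define h where "h = x' - x"
      have eq: "g (x + t *\<^sub>R h) = g x" if t: "0 < t" "t < 1" for t
      proof -
        have "(1 - t) *\<^sub>R x + t *\<^sub>R x' \<in> subpts v (g x)"
          using convex_subpts[OF cv, of "g x"] x' sub[of x "g x"] t by (intro convexD) auto
        moreover have "(1 - t) *\<^sub>R x + t *\<^sub>R x' = x + t *\<^sub>R h" by (simp add: h_def algebra_simps)
        ultimately show ?thesis using sub by simp
      qed
      have "\<forall>\<^sub>F t in at_right 0. (g (x + t *\<^sub>R h) - g x) /\<^sub>R t = 0"
        by (rule eventually_at_rightI[of 0 1]) (auto simp: eq)
      then have "((\<lambda>t. (g (x + t *\<^sub>R h) - g x) /\<^sub>R t) \<longlongrightarrow> 0) (at_right 0)"
        by (rule tendsto_eventually)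
      then have "H x *v h = 0" using tendsto_unique[OF _ lim[of x h]] by simp
      moreover have "\<forall>h. H x *v h = 0 \<longrightarrow> h = 0"
        using det by (simp only: invertible_det_nz[symmetric] invertible_left_inverse matrix_left_invertible_ker)
      ultimately have "h = 0" by blast
      then show ?thesis by (simp add: h_def)
    qed
    then show ?thesis using sub[of x "g x"] by auto
  qed
qed

text \<open>The substitution is \<open>y = g x\<close> on the points with nonsingular Hessian, where
  \<open>g\<close> is injective. The remaining \<open>y\<close> with nonempty fibre are critical
  values, a null set by Sard, while singular points contribute nothing to the right-hand
  integral.\<close>

lemma integral_gradval_C2:
  fixes v :: "'n::finite cvfun" and \<eta> :: "(real^'n) \<times> (real^'n) \<Rightarrow> real"
  assumes cv: "convex_on UNIV v" and C2: "C2_with v g H" and \<eta>: "continuous_on UNIV \<eta>"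
    and K: "compact K" "\<And>x y. x \<notin> K \<Longrightarrow> \<eta> (x, y) = 0"
  shows "integral\<^sup>L lborel (gradval v \<eta>) = integral\<^sup>L lborel (\<lambda>x. \<eta> (x, g x) * det (H x))"
proof (rule change_of_variables_borel[where S = "{x. det (H x) \<noteq> 0}"])
  note facts = C2_with_facts[OF cv C2]
  have dg: "(g has_derivative (\<lambda>h. H x *v h)) (at x)" for x using C2 by (simp add: C2_with_def)
  have cH: "continuous_on UNIV H" using C2 by (simp add: C2_with_def)
  have cdet: "continuous_on UNIV (\<lambda>x. det (H x))" unfolding det_def by (intro continuous_intros cH)
  have cg: "continuous_on UNIV g" using dg by (meson has_derivative_continuous continuous_at_imp_continuous_on)
  show "{x. det (H x) \<noteq> 0} \<in> sets borel"
    using open_Collect_neq[OF cdet continuous_on_const[of _ 0]] by simp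
  show "(g has_derivative (*v) (H x)) (at x)" for x by (rule dg)
  show "inj_on g {x. det (H x) \<noteq> 0}"
    using facts(3) by (auto simp: inj_on_def) (metis singleton_inject)
  show "integrable lborel (gradval v \<eta>)" by (rule gradval_integrable[OF cv \<eta> K])
  have "negligible (g ` {x. det (H x) = 0})"
    by (rule negligible_critical_values[OF dg]) auto
  moreover have "{y. gradval v \<eta> y \<noteq> 0 \<and> y \<notin> g ` {x. det (H x) \<noteq> 0}} \<subseteq> g ` {x. det (H x) = 0}"
  proof clarify
    fix y assume y: "gradval v \<eta> y \<noteq> 0" "y \<notin> g ` {x. det (H x) \<noteq> 0}"
    then obtain x where "x \<in> subpts v y" using gradval_empty by blast
    then have "g x = y" by (simp add: facts(1))
    then show "y \<in> g ` {x. det (H x) = 0}" using y(2) by blast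
  qed
  ultimately show "negligible {y. gradval v \<eta> y \<noteq> 0 \<and> y \<notin> g ` {x. det (H x) \<noteq> 0}}"
    by (rule negligible_subset)
  show "(\<lambda>x. \<eta> (x, g x) * det (H x)) \<in> borel_measurable borel"
    by (intro borel_measurable_continuous_onI continuous_intros cdet continuous_on_compose2[OF \<eta>] continuous_on_Pair cg) auto
  show "\<eta> (x, g x) * det (H x) = (if x \<in> {x. det (H x) \<noteq> 0} then \<bar>det (H x)\<bar> * gradval v \<eta> (g x) else 0)" for x
  proof (cases "det (H x) = 0")
    case False
    then have "gradval v \<eta> (g x) = \<eta> (x, g x)" using facts(3) gradval_singleton by blast
    moreover have "0 \<le> det (H x)" using facts(2) by (rule det_nonneg_if_nonneg_form)
    ultimately show ?thesis using False by simp
  qed simp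
qed

subsection \<open>Uniqueness of the Hessian measure\<close>

text \<open>Compact sets form a generator on which the measures in question are finite, as the
  uniqueness theorem for measures demands.\<close>

lemma sets_borel_compact: "sets borel = sigma_sets UNIV (Collect (compact :: 'a::euclidean_space set \<Rightarrow> bool))"
proof
  show "sigma_sets UNIV (Collect compact) \<subseteq> sets (borel :: 'a measure)"
    by (rule sets.sigma_sets_subset[of _ borel, simplified]) (auto intro: borel_compact)
  have "C \<in> sigma_sets UNIV (Collect compact)" if "closed C" for C :: "'a set"
  proof -
    have "C = (\<Union>m::nat. C \<inter> cball 0 (real m))"
      by (auto simp: real_arch_simple)
    moreover have "C \<inter> cball 0 (real m) \<in> sigma_sets UNIV (Collect compact)" for m
      using that by (intro sigma_sets.Basic) (auto intro: closed_Int_compact)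
    ultimately show ?thesis by (metis sigma_sets.Union)
  qed
  then show "sets (borel :: 'a measure) \<subseteq> sigma_sets UNIV (Collect compact)"
    unfolding borel_eq_closed by (subst sets_measure_of) (auto intro!: sigma_sets_mono)
qed

lemma integral_approximate_compact:
  fixes M :: "'a::euclidean_space measure"
  assumes sM: "sets M = sets borel" and fin: "\<And>K. compact K \<Longrightarrow> emeasure M K < \<infinity>"
    and K: "compact K" "K \<noteq> {}"
  shows "(\<lambda>j. integral\<^sup>L M (\<lambda>p. max 0 (1 - real j * infdist p K))) \<longlonglongrightarrow> measure M K"
proof -
  note [measurable_cong] = sM
  let ?B = "{x. infdist x K \<le> 1}"
  have cB: "compact ?B" using compact_infdist_le[OF K(2,1)] by simp
  have mb: "?B \<in> sets M" "K \<in> sets M" using cB K(1) sM by (auto intro: borel_compact)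
  \<comment> \<open>The shift to \<open>Suc j\<close> matters: at \<open>j = 0\<close> the tent
    function is the constant 1, which is not integrable over an infinite measure.\<close>
  have "(\<lambda>j. integral\<^sup>L M (\<lambda>p. max 0 (1 - real (Suc j) * infdist p K))) \<longlonglongrightarrow> integral\<^sup>L M (indicator K)"
  proof (rule integral_dominated_convergence[where w = "indicator ?B"])
    show "integrable M (indicator ?B :: 'a \<Rightarrow> real)"
      using fin[OF cB] mb by (intro integrable_real_indicator) auto
    show "(\<lambda>p. max 0 (1 - real (Suc j) * infdist p K)) \<in> borel_measurable M" for j
      unfolding measurable_cong_sets[OF sM refl]
      by (intro borel_measurable_continuous_onI continuous_intros continuous_on_infdist)
    show "AE p in M. norm (max 0 (1 - real (Suc j) * infdist p K)) \<le> indicator ?B p" for j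
    proof (rule AE_I2)
      fix p
      have nn: "0 \<le> real j * infdist p K" "0 \<le> infdist p K" by (auto simp: infdist_nonneg)
      have e: "real (Suc j) * infdist p K = infdist p K + real j * infdist p K" by (simp add: algebra_simps)
      show "norm (max 0 (1 - real (Suc j) * infdist p K)) \<le> indicator ?B p"
      proof (cases "infdist p K \<le> 1")
        case True
        have "0 \<le> max 0 (1 - real (Suc j) * infdist p K)" "max 0 (1 - real (Suc j) * infdist p K) \<le> 1"
          unfolding e using nn by linarith+
        then show ?thesis using True by simp
      next
        case False
        have "1 - (infdist p K + real j * infdist p K) \<le> 0" using nn False by linarith
        then show ?thesis using False unfolding e by (simp add: max_def)
      qed
    qed
    show "AE p in M. (\<lambda>j. max 0 (1 - real (Suc j) * infdist p K)) \<longlonglongrightarrow> indicator K p"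
    proof (rule AE_I2)
      fix p
      show "(\<lambda>j. max 0 (1 - real (Suc j) * infdist p K)) \<longlonglongrightarrow> indicator K p"
      proof (cases "p \<in> K")
        case True then show ?thesis by simp
      next
        case False
        then have pos: "0 < infdist p K"
          using K compact_imp_closed in_closed_iff_infdist_zero infdist_nonneg[of p K] by (metis less_eq_real_def)
        obtain N :: nat where "1 / infdist p K \<le> real N" using real_arch_simple by blast
        then have N: "1 \<le> real N * infdist p K" using pos by (simp add: field_simps)
        have "max 0 (1 - real (Suc j) * infdist p K) = indicator K p" if "N \<le> j" for j
        proof -
          have "real N * infdist p K \<le> real (Suc j) * infdist p K"
            using that pos by (intro mult_right_mono) auto
          then show ?thesis using N False by (simp add: max_def)
        qed
        then show ?thesis by (intro tendsto_eventually) (auto simp: eventually_sequentially)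
      qed
    qed
  qed (use mb in auto)
  then show ?thesis using mb by (simp add: LIMSEQ_imp_Suc)
qed

lemma radon_measure_eqI:
  fixes M N :: "'a::euclidean_space measure"
  assumes sM: "sets M = sets borel" and sN: "sets N = sets borel"
    and fM: "\<And>K. compact K \<Longrightarrow> emeasure M K < \<infinity>" and fN: "\<And>K. compact K \<Longrightarrow> emeasure N K < \<infinity>"
    and eq: "\<And>\<eta>::'a \<Rightarrow> real. continuous_on UNIV \<eta> \<Longrightarrow> compact (closure {p. \<eta> p \<noteq> 0}) \<Longrightarrow>
        integral\<^sup>L M \<eta> = integral\<^sup>L N \<eta>"
  shows "M = N"
proof (rule measure_eqI_generator_eq[where E = "Collect compact" and \<Omega> = UNIV and A = "\<lambda>i. cball 0 (real i)"])
  show "Int_stable (Collect (compact :: 'a set \<Rightarrow> bool))" by (auto simp: Int_stable_def)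
  fix K :: "'a set" assume "K \<in> Collect compact"
  then have K: "compact K" by simp
  show "emeasure M K = emeasure N K"
  proof (cases "K = {}")
    case False
    have "integral\<^sup>L M (\<lambda>p. max 0 (1 - real (Suc j) * infdist p K)) = integral\<^sup>L N (\<lambda>p. max 0 (1 - real (Suc j) * infdist p K))" for j
    proof (rule eq)
      show "continuous_on UNIV (\<lambda>p. max 0 (1 - real (Suc j) * infdist p K))"
        by (intro continuous_intros continuous_on_infdist)
      let ?B = "{x. infdist x K \<le> 1}"
      have cB: "compact ?B" using compact_infdist_le[OF False K] by simp
      have "p \<in> ?B" if "max 0 (1 - real (Suc j) * infdist p K) \<noteq> 0" for p
      proof -
        have nn: "0 \<le> real j * infdist p K" by (auto simp: infdist_nonneg)
        have e: "real (Suc j) * infdist p K = infdist p K + real j * infdist p K" by (simp add: algebra_simps)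
        show ?thesis using that nn unfolding e by (auto simp: max_def split: if_splits)
      qed
      then have "closure {p. max 0 (1 - real (Suc j) * infdist p K) \<noteq> 0} \<subseteq> ?B"
        using cB by (intro closure_minimal compact_imp_closed) auto
      then show "compact (closure {p. max 0 (1 - real (Suc j) * infdist p K) \<noteq> 0})"
        using cB by (meson bounded_subset closed_closure compact_eq_bounded_closed)
    qed
    moreover have "(\<lambda>j. integral\<^sup>L M (\<lambda>p. max 0 (1 - real (Suc j) * infdist p K))) \<longlonglongrightarrow> measure M K"
      using integral_approximate_compact[OF sM fM K False] by (rule LIMSEQ_Suc)
    moreover have "(\<lambda>j. integral\<^sup>L N (\<lambda>p. max 0 (1 - real (Suc j) * infdist p K))) \<longlonglongrightarrow> measure N K"
      using integral_approximate_compact[OF sN fN K False] by (rule LIMSEQ_Suc)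
    ultimately have "measure M K = measure N K" by (metis (no_types, lifting) LIMSEQ_unique ext)
    then show ?thesis using fM[OF K] fN[OF K] by (simp add: emeasure_eq_ennreal_measure)
  qed simp
next
  show "(\<Union>i. cball (0::'a) (real i)) = UNIV"
    by (auto simp: real_arch_simple)
  show "range (\<lambda>i. cball (0::'a) (real i)) \<subseteq> Collect compact" by auto
  show "emeasure M (cball 0 (real i)) \<noteq> \<infinity>" for i using fM[of "cball 0 (real i)"] by simp
qed (auto simp: sM sN sets_borel_compact)

section \<open>Log-sum-exp approximation by C^2 convex functions\<close>

definition lse :: "('i \<Rightarrow> 'a::real_inner) \<Rightarrow> ('i \<Rightarrow> real) \<Rightarrow> 'i set \<Rightarrow> real \<Rightarrow> 'a \<Rightarrow> real" where
  "lse Y c I M x = ln (\<Sum>i\<in>I. exp (M * (Y i \<bullet> x + c i))) / M"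

definition lse_grad :: "('i \<Rightarrow> 'a::real_inner) \<Rightarrow> ('i \<Rightarrow> real) \<Rightarrow> 'i set \<Rightarrow> real \<Rightarrow> 'a \<Rightarrow> 'a" where
  "lse_grad Y c I M x = (\<Sum>i\<in>I. exp (M * (Y i \<bullet> x + c i)) *\<^sub>R Y i) /\<^sub>R (\<Sum>i\<in>I. exp (M * (Y i \<bullet> x + c i)))"

definition outer :: "real^'n \<Rightarrow> real^'n \<Rightarrow> real^'n::finite^'n" where
  "outer a b = (\<chi> i j. a $ i * b $ j)"

lemma outer_mult: "outer a b *v h = (b \<bullet> h) *\<^sub>R a"
  by (simp add: vec_eq_iff outer_def matrix_vector_mult_def inner_vec_def sum_distrib_left sum_distrib_right mult_ac)

text \<open>\<open>lse_grad\<close> is the mean of the vectors \<open>Y i\<close> under weights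
  proportional to the exponentials, and \<open>lse_hess\<close> is \<open>M\<close> times their
  covariance matrix.\<close>

definition lse_hess :: "('i \<Rightarrow> real^'n) \<Rightarrow> ('i \<Rightarrow> real) \<Rightarrow> 'i set \<Rightarrow> real \<Rightarrow> real^'n \<Rightarrow> real^'n::finite^'n" where
  "lse_hess Y c I M x = 
    (M / (\<Sum>i\<in>I. exp (M * (Y i \<bullet> x + c i)))) *\<^sub>R (\<Sum>i\<in>I. exp (M * (Y i \<bullet> x + c i)) *\<^sub>R outer (Y i) (Y i))
    - M *\<^sub>R outer (lse_grad Y c I M x) (lse_grad Y c I M x)"

text \<open>Jensen's inequality for \<open>exp\<close> with the normalized weights at
  \<open>x\<close> gives the subgradient inequality directly, and with it the convexity of
  \<open>lse\<close>.\<close>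

lemma lse_subgradient:
  assumes I: "finite I" "I \<noteq> {}" and M: "0 < M"
  shows "x \<in> subpts (lse Y c I M) (lse_grad Y c I M x)"
proof (rule subptsI)
  fix x'
  define e where "e x i = exp (M * (Y i \<bullet> x + c i))" for x i
  define E where "E x = (\<Sum>i\<in>I. e x i)" for x
  have Ep: "0 < E x" for x unfolding E_def e_def using I by (intro sum_pos) auto
  let ?p = "\<lambda>i. e x i / E x"
  have sp: "(\<Sum>i\<in>I. ?p i) = 1" using Ep[of x] by (simp add: E_def flip: sum_divide_distrib)
  have "exp (\<Sum>i\<in>I. ?p i *\<^sub>R (M * (Y i \<bullet> (x' - x)))) \<le> (\<Sum>i\<in>I. ?p i * exp (M * (Y i \<bullet> (x' - x))))"
    using I sp Ep[of x] by (intro convex_on_sum[OF _ _ exp_convex]) (auto simp: e_def)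
  also have "\<dots> = (\<Sum>i\<in>I. e x' i / E x)"
    by (intro sum.cong) (auto simp: e_def inner_diff_right algebra_simps simp flip: exp_add)
  also have "\<dots> = E x' / E x" by (simp add: E_def sum_divide_distrib)
  finally have "exp (\<Sum>i\<in>I. ?p i *\<^sub>R (M * (Y i \<bullet> (x' - x)))) \<le> E x' / E x" .
  then have "(\<Sum>i\<in>I. ?p i * (M * (Y i \<bullet> (x' - x)))) \<le> ln (E x' / E x)"
    using Ep by (subst ln_ge_iff) auto
  also have "\<dots> = ln (E x') - ln (E x)" using Ep[of x] Ep[of x'] by (simp add: ln_div)
  also have "(\<Sum>i\<in>I. ?p i * (M * (Y i \<bullet> (x' - x)))) = M * (lse_grad Y c I M x \<bullet> (x' - x))"
    by (simp add: lse_grad_def inner_sum_left sum_distrib_left flip: E_def e_def)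
      (intro sum.cong, auto simp: divide_inverse mult_ac)
  finally have "M * (lse_grad Y c I M x \<bullet> (x' - x)) \<le> ln (E x') - ln (E x)" .
  then have "lse_grad Y c I M x \<bullet> (x' - x) \<le> (ln (E x') - ln (E x)) / M"
    using M by (simp add: field_simps)
  then show "lse Y c I M x + lse_grad Y c I M x \<bullet> (x' - x) \<le> lse Y c I M x'"
    by (simp add: lse_def diff_divide_distrib flip: e_def E_def)
qed

lemma lse_C2:
  fixes Y :: "'i \<Rightarrow> real^'n::finite"
  assumes I: "finite I" "I \<noteq> {}" and M: "0 < M"
  shows "C2_with (lse Y c I M) (lse_grad Y c I M) (lse_hess Y c I M)"
  unfolding C2_with_def
proof (intro conjI allI)
  define e where "e x i = exp (M * (Y i \<bullet> x + c i))" for x i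
  define E where "E x = (\<Sum>i\<in>I. e x i)" for x
  define W where "W x = (\<Sum>i\<in>I. e x i *\<^sub>R Y i)" for x
  have Ep: "0 < E x" for x unfolding E_def e_def using I by (intro sum_pos) auto
  have de: "((\<lambda>x. e x i) has_derivative (\<lambda>h. e x i * (M * (Y i \<bullet> h)))) (at x)" for x i
    unfolding e_def by (auto intro!: derivative_eq_intros)
  have dE: "(E has_derivative (\<lambda>h. \<Sum>i\<in>I. e x i * (M * (Y i \<bullet> h)))) (at x)" for x
    unfolding E_def by (intro has_derivative_sum de)
  have dEW: "(\<Sum>i\<in>I. e x i * (M * (Y i \<bullet> h))) = M * (W x \<bullet> h)" for x h
    by (simp add: W_def inner_sum_left sum_distrib_left mult_ac)
  have dW: "(W has_derivative (\<lambda>h. \<Sum>i\<in>I. (e x i * (M * (Y i \<bullet> h))) *\<^sub>R Y i)) (at x)" for x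
    unfolding W_def by (intro has_derivative_sum has_derivative_scaleR_left de)
  have f: "lse Y c I M = (\<lambda>x. ln (E x) / M)" by (simp add: fun_eq_iff lse_def E_def e_def)
  have g: "lse_grad Y c I M = (\<lambda>x. inverse (E x) *\<^sub>R W x)" by (simp add: fun_eq_iff lse_grad_def E_def W_def e_def)
  have H: "lse_hess Y c I M = (\<lambda>x. (M / E x) *\<^sub>R (\<Sum>i\<in>I. e x i *\<^sub>R outer (Y i) (Y i))
      - M *\<^sub>R outer (lse_grad Y c I M x) (lse_grad Y c I M x))"
    by (simp add: fun_eq_iff lse_hess_def E_def e_def)
  show "(lse Y c I M has_derivative (\<lambda>h. lse_grad Y c I M x \<bullet> h)) (at x)" for x
  proof -
    have "((\<lambda>x. ln (E x) / M) has_derivative (\<lambda>h. (inverse (E x) * (\<Sum>i\<in>I. e x i * (M * (Y i \<bullet> h)))) / M)) (at x)"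
      by (rule bounded_linear.has_derivative[OF bounded_linear_divide has_derivative_compose[OF dE 
            has_field_derivative_imp_has_derivative[OF DERIV_ln[OF Ep]]]])
    moreover have "(inverse (E x) * (M * (W x \<bullet> h))) / M = (inverse (E x) *\<^sub>R W x) \<bullet> h" for h
      using M by simp
    ultimately show ?thesis unfolding f g dEW by (simp only:)
  qed
  show "(lse_grad Y c I M has_derivative (\<lambda>h. lse_hess Y c I M x *v h)) (at x)" for x
  proof -
    have "((\<lambda>x. inverse (E x) *\<^sub>R W x) has_derivative
        (\<lambda>h. inverse (E x) *\<^sub>R (\<Sum>i\<in>I. (e x i * (M * (Y i \<bullet> h))) *\<^sub>R Y i) + 
           (- (inverse (E x) * (\<Sum>i\<in>I. e x i * (M * (Y i \<bullet> h))) * inverse (E x))) *\<^sub>R W x)) (at x)"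
      by (rule has_derivative_scaleR[OF Deriv.has_derivative_inverse[OF less_imp_neq[OF Ep, symmetric] dE] dW])
    moreover have "inverse (E x) *\<^sub>R (\<Sum>i\<in>I. (e x i * (M * (Y i \<bullet> h))) *\<^sub>R Y i) + 
           (- (inverse (E x) * (\<Sum>i\<in>I. e x i * (M * (Y i \<bullet> h))) * inverse (E x))) *\<^sub>R W x = lse_hess Y c I M x *v h" for h
    proof -
      have "(\<Sum>i\<in>I. e x i *\<^sub>R outer (Y i) (Y i)) *v h = (\<Sum>i\<in>I. (e x i * (Y i \<bullet> h)) *\<^sub>R Y i)"
      proof -
        have "(\<Sum>i\<in>J. e x i *\<^sub>R outer (Y i) (Y i)) *v h = (\<Sum>i\<in>J. (e x i * (Y i \<bullet> h)) *\<^sub>R Y i)" if "finite J" for J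
          using that by induction (simp_all add: matrix_vector_mult_add_rdistrib outer_mult flip: scaleR_matrix_vector_assoc)
        then show ?thesis using I by simp
      qed
      moreover have "(\<Sum>i\<in>I. (e x i * (M * (Y i \<bullet> h))) *\<^sub>R Y i) = M *\<^sub>R (\<Sum>i\<in>I. (e x i * (Y i \<bullet> h)) *\<^sub>R Y i)"
        by (simp add: scaleR_sum_right mult_ac)
      ultimately show ?thesis
        unfolding H dEW matrix_vector_mult_diff_rdistrib scaleR_matrix_vector_assoc[symmetric] outer_mult g
        by (simp add: divide_inverse mult_ac)
    qed
    ultimately show ?thesis unfolding g by simp
  qed
  have ce: "continuous_on UNIV (\<lambda>x. e x i)" for i unfolding e_def by (intro continuous_intros)
  have cE: "continuous_on UNIV E" unfolding E_def by (intro continuous_intros ce)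
  have cW: "continuous_on UNIV W" unfolding W_def by (intro continuous_intros ce)
  have Enz: "E x \<noteq> 0" for x using Ep[of x] by simp
  have cg: "continuous_on UNIV (lse_grad Y c I M)"
    unfolding g by (intro continuous_intros cE cW) (simp add: Enz)
  show "continuous_on UNIV (lse_hess Y c I M)"
    unfolding H outer_def by (intro continuous_intros cE ce cg) (auto simp: Enz)
qed

text \<open>\<open>v\<close> is the supremum of its tangents at a dense sequence. Smoothing the
  maximum of the first \<open>k + 1\<close> tangents with parameter \<open>k + 1\<close> overshoots
  by at most \<open>ln (k + 1) / (k + 1)\<close>; from below a single tangent at a nearby dense
  point is enough.\<close>

lemma exists_C2_approximation:
  fixes v :: "'n::finite cvfun"
  assumes cv: "convex_on UNIV v"
  obtains f g H where "\<And>k::nat. convex_on UNIV (f k)" "\<And>k. C2_with (f k) (g k) (H k)"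
    "\<And>x. (\<lambda>k. f k x) \<longlonglongrightarrow> v x"
proof -
  obtain D :: "(real^'n) set" where D: "countable D" "\<And>S. open S \<Longrightarrow> S \<noteq> {} \<Longrightarrow> \<exists>d\<in>D. d \<in> S"
    using countable_dense_setE by blast
  have "D \<noteq> {}" using D(2)[of UNIV] by auto
  then obtain X :: "nat \<Rightarrow> real^'n" where X: "range X = D" using D(1) by (metis range_from_nat_into)
  have "\<exists>y. X i \<in> subpts v y" for i using subgradient_exists[OF cv] by metis
  then obtain Y where Y: "\<And>i. X i \<in> subpts v (Y i)" by metis
  define c where "c i = v (X i) - Y i \<bullet> X i" for i
  have le: "Y i \<bullet> x + c i \<le> v x" for i x using subptsD[OF Y, of i x] by (simp add: c_def inner_diff_right)
  define f where "f k = lse Y c {..<Suc k} (real (Suc k))" for k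
  have "(\<lambda>k. f k x) \<longlonglongrightarrow> v x" for x
  proof (rule tendstoI)
    fix e :: real assume e: "0 < e"
    have ub: "f k x \<le> v x + ln (real (Suc k)) / real (Suc k)" for k
    proof -
      have "(\<Sum>i<Suc k. exp (real (Suc k) * (Y i \<bullet> x + c i))) \<le> (\<Sum>i<Suc k. exp (real (Suc k) * v x))"
        by (intro sum_mono) (simp only: exp_le_cancel_iff mult_left_mono[OF le] of_nat_0_le_iff)
      also have "\<dots> = real (Suc k) * exp (real (Suc k) * v x)" by simp
      finally have le: "(\<Sum>i<Suc k. exp (real (Suc k) * (Y i \<bullet> x + c i))) \<le> real (Suc k) * exp (real (Suc k) * v x)" .
      have "0 < (\<Sum>i<Suc k. exp (real (Suc k) * (Y i \<bullet> x + c i)))" by (rule sum_pos) auto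
      then have "ln (\<Sum>i<Suc k. exp (real (Suc k) * (Y i \<bullet> x + c i))) \<le> ln (real (Suc k) * exp (real (Suc k) * v x))"
        using le by (intro ln_mono)
      also have "\<dots> = ln (real (Suc k)) + real (Suc k) * v x" by (subst ln_mult) auto
      finally have "f k x \<le> (ln (real (Suc k)) + real (Suc k) * v x) / real (Suc k)"
        unfolding f_def lse_def by (intro divide_right_mono) auto
      then show ?thesis by (simp add: add_divide_distrib)
    qed
    have lb: "Y i \<bullet> x + c i \<le> f k x" if "i \<le> k" for i k
    proof -
      have "exp (real (Suc k) * (Y i \<bullet> x + c i)) \<le> (\<Sum>i<Suc k. exp (real (Suc k) * (Y i \<bullet> x + c i)))"
        using that by (intro member_le_sum) auto
      then have "ln (exp (real (Suc k) * (Y i \<bullet> x + c i))) \<le> ln (\<Sum>i<Suc k. exp (real (Suc k) * (Y i \<bullet> x + c i)))"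
        by (intro ln_mono exp_gt_zero)
      then have "real (Suc k) * (Y i \<bullet> x + c i) \<le> ln (\<Sum>i<Suc k. exp (real (Suc k) * (Y i \<bullet> x + c i)))"
        by (simp only: ln_exp)
      then show ?thesis unfolding f_def lse_def by (simp add: field_simps)
    qed
    obtain L where L: "\<And>x' y. norm x' \<le> norm x + 1 \<Longrightarrow> x' \<in> subpts v y \<Longrightarrow> norm y \<le> L"
      using convex_subgradient_bound[OF cv] by blast
    have "isCont v x" using convex_continuous[OF cv] by (simp add: continuous_on_eq_continuous_at)
    then obtain d where d: "0 < d" "\<And>x'. dist x' x < d \<Longrightarrow> dist (v x') (v x) < e / 2"
      unfolding continuous_at_eps_delta using e by (metis half_gt_zero)
    \<comment> \<open>\<open>min 1\<close> keeps the dense point where \<open>L\<close> bounds the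
      slopes, \<open>d\<close> controls \<open>v\<close>, and the last bound makes slope times
      distance at most \<open>e / 2\<close>; \<open>\<bar>L\<bar> + 1\<close> avoids division by
      zero.\<close>
    define r where "r = min 1 (min d (e / (2 * (\<bar>L\<bar> + 1))))"
    have r: "0 < r" "r \<le> 1" "r \<le> d" "r \<le> e / (2 * (\<bar>L\<bar> + 1))" using d e by (auto simp: r_def)
    obtain i where i: "X i \<in> ball x r" using D(2)[of "ball x r"] r(1) X by (metis centre_in_ball empty_iff open_ball rangeE)
    have xi: "norm (X i) \<le> norm x + 1" 
      using i r norm_triangle_sub[of "X i" x] by (simp add: dist_norm norm_minus_commute)
    have nY: "norm (Y i) \<le> \<bar>L\<bar> + 1" using L[OF xi Y] by linarith
    have "\<bar>Y i \<bullet> (x - X i)\<bar> \<le> norm (Y i) * norm (x - X i)" by (rule Cauchy_Schwarz_ineq2)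
    also have "\<dots> \<le> (\<bar>L\<bar> + 1) * (e / (2 * (\<bar>L\<bar> + 1)))"
      using nY i r by (intro mult_mono) (auto simp: dist_norm)
    also have "\<dots> = e / 2" by (simp add: field_simps add_nonneg_eq_0_iff) 
    finally have "\<bar>Y i \<bullet> (x - X i)\<bar> \<le> e / 2" .
    moreover have "\<bar>v (X i) - v x\<bar> < e / 2" using d(2)[of "X i"] i r by (simp add: dist_commute dist_real_def abs_minus_commute)
    ultimately have near: "v x - e < Y i \<bullet> x + c i"
      unfolding c_def abs_le_iff abs_less_iff inner_diff_right by linarith
    have "(\<lambda>k. ln (real k) / real k) \<longlonglongrightarrow> 0" using lim_ln_over_n by simp
    then have "\<forall>\<^sub>F k in sequentially. ln (real (Suc k)) / real (Suc k) < e"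
      using order_tendstoD(2)[OF LIMSEQ_Suc] e by blast
    then show "\<forall>\<^sub>F k in sequentially. dist (f k x) (v x) < e"
      using eventually_ge_at_top[of i]
    proof eventually_elim
      case (elim k)
      then show ?case using ub[of k] lb[of i k] near by (simp add: dist_real_def abs_less_iff)
    qed
  qed
  moreover have "convex_on UNIV (f k)" for k
    unfolding f_def by (rule convex_on_subgradientI, rule exI, rule lse_subgradient) auto
  moreover have "C2_with (f k) (lse_grad Y c {..<Suc k} (real (Suc k))) (lse_hess Y c {..<Suc k} (real (Suc k)))" for k
    unfolding f_def by (rule lse_C2) auto
  ultimately show ?thesis
    using that[of f "\<lambda>k. lse_grad Y c {..<Suc k} (real (Suc k))" "\<lambda>k. lse_hess Y c {..<Suc k} (real (Suc k))"]
    by blast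
qed

lemma is_hessian_measure_op_MA:
  "is_hessian_measure_op (\<lambda>v::('n::finite) cvfun. if v \<in> Conv then MA v else null_measure borel)"
  unfolding is_hessian_measure_op_def
proof (intro conjI allI impI ballI)
  fix vs :: "nat \<Rightarrow> 'n cvfun" and v and \<eta> :: "(real^'n) \<times> (real^'n) \<Rightarrow> real"
  assume vs: "\<forall>k. vs k \<in> Conv" and v: "v \<in> Conv" and lim: "pw_conv vs v" and \<eta>: "continuous_on UNIV \<eta>"
    and supp: "compact (closure {p. \<eta> p \<noteq> 0})"
  have cv: "convex_on UNIV (vs k)" "convex_on UNIV v" for k using vs v by (auto simp: Conv_def)
  have K: "compact (fst ` closure {p. \<eta> p \<noteq> 0})"
    using supp by (intro compact_continuous_image continuous_on_fst continuous_on_id)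
  have z: "\<eta> (x, y) = 0" if "x \<notin> fst ` closure {p. \<eta> p \<noteq> 0}" for x y
    using that closure_subset[of "{p. \<eta> p \<noteq> 0}"] by (force simp: image_iff)
  have \<eta>b: "\<eta> \<in> borel_measurable borel" using \<eta> by (rule borel_measurable_continuous_onI)
  have "(\<lambda>k. integral\<^sup>L lborel (gradval (vs k) \<eta>)) \<longlonglongrightarrow> integral\<^sup>L lborel (gradval v \<eta>)"
    by (rule gradval_seq_integral(2)[OF cv _ \<eta> K z]) (use lim in \<open>auto simp: pw_conv_def\<close>)
  then show "(\<lambda>k. integral\<^sup>L (if vs k \<in> Conv then MA (vs k) else null_measure borel) \<eta>)
      \<longlonglongrightarrow> integral\<^sup>L (if v \<in> Conv then MA v else null_measure borel) \<eta>"
    using vs v by (simp add: integral_MA[OF cv(1) \<eta>b] integral_MA[OF cv(2) \<eta>b])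
next
  fix v :: "'n cvfun" and g H and \<eta> :: "(real^'n) \<times> (real^'n) \<Rightarrow> real"
  assume v: "v \<in> Conv" and C2: "C2_with v g H" and \<eta>: "continuous_on UNIV \<eta>"
    and "\<exists>K. compact K \<and> (\<forall>x y. x \<notin> K \<longrightarrow> \<eta> (x, y) = 0)"
  then obtain K where K: "compact K" "\<And>x y. x \<notin> K \<Longrightarrow> \<eta> (x, y) = 0" by blast
  have cv: "convex_on UNIV v" using v by (simp add: Conv_def)
  show "integral\<^sup>L (if v \<in> Conv then MA v else null_measure borel) \<eta> = (\<integral>x. \<eta> (x, g x) * det (H x) \<partial>lborel)"
    using integral_gradval_C2[OF cv C2 \<eta> K] v
    by (simp add: integral_MA[OF cv borel_measurable_continuous_onI[OF \<eta>]])
next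
  fix v :: "'n cvfun" and K :: "((real^'n) \<times> (real^'n)) set" 
  assume "v \<in> Conv" "compact K"
  then show "emeasure (if v \<in> Conv then MA v else null_measure borel) K < \<infinity>"
    using emeasure_MA_compact[of v K] by (simp add: Conv_def)
qed simp_all

lemma hessian_measure_opD:
  fixes Th :: "('n::finite) cvfun \<Rightarrow> _"
  assumes "is_hessian_measure_op Th"
  shows "v \<notin> Conv \<Longrightarrow> Th v = null_measure borel"
    and "v \<in> Conv \<Longrightarrow> sets (Th v) = sets borel"
    and "v \<in> Conv \<Longrightarrow> compact K \<Longrightarrow> emeasure (Th v) K < \<infinity>"
  using assms[unfolded is_hessian_measure_op_def, THEN conjunct1]
    assms[unfolded is_hessian_measure_op_def, THEN conjunct2, THEN conjunct1]
  by auto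

lemma hessian_measure_op_convergence:
  fixes Th :: "('n::finite) cvfun \<Rightarrow> _" and \<eta> :: "(real^'n) \<times> (real^'n) \<Rightarrow> real"
  assumes "is_hessian_measure_op Th" "\<And>k. vs k \<in> Conv" "v \<in> Conv" "pw_conv vs v"
    "continuous_on UNIV \<eta>" "compact (closure {p. \<eta> p \<noteq> 0})"
  shows "(\<lambda>k. integral\<^sup>L (Th (vs k)) \<eta>) \<longlonglongrightarrow> integral\<^sup>L (Th v) \<eta>"
  using assms(1)[unfolded is_hessian_measure_op_def, THEN conjunct2, THEN conjunct2, THEN conjunct1, rule_format,
      OF assms(2-6)] .

lemma hessian_measure_op_C2:
  fixes Th :: "('n::finite) cvfun \<Rightarrow> _" and \<eta> :: "(real^'n) \<times> (real^'n) \<Rightarrow> real"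
  assumes "is_hessian_measure_op Th" "v \<in> Conv" "C2_with v g H"
    "continuous_on UNIV \<eta>" "compact K" "\<And>x y. x \<notin> K \<Longrightarrow> \<eta> (x, y) = 0"
  shows "integral\<^sup>L (Th v) \<eta> = (\<integral>x. \<eta> (x, g x) * det (H x) \<partial>lborel)"
  using assms(1)[unfolded is_hessian_measure_op_def, THEN conjunct2, THEN conjunct2, THEN conjunct2, rule_format,
      OF assms(2-4)] assms(5,6) by blast

text \<open>Both operators coincide on C^2 functions. Weak continuity extends this along the
  approximating sequence, and compactly supported test functions determine a measure that is finite
  on compact sets.\<close>

lemma hessian_measure_op_unique:
  fixes Th :: "('n::finite) cvfun \<Rightarrow> _"
  assumes T1: "is_hessian_measure_op Th" and T2: "is_hessian_measure_op Th'"
  shows "Th = Th'"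
proof
  fix v
  show "Th v = Th' v"
  proof (cases "v \<in> Conv")
    case False
    then show ?thesis using hessian_measure_opD(1)[OF T1] hessian_measure_opD(1)[OF T2] by simp
  next
    case True
    obtain f g H where f: "\<And>k::nat. convex_on UNIV (f k)" "\<And>k. C2_with (f k) (g k) (H k)"
      "\<And>x. (\<lambda>k. f k x) \<longlonglongrightarrow> v x"
      using exists_C2_approximation[of v] True by (auto simp: Conv_def)
    have fc: "f k \<in> Conv" for k using f(1) by (simp add: Conv_def)
    have pw: "pw_conv f v" using f(3) by (simp add: pw_conv_def)
    show ?thesis
    proof (rule radon_measure_eqI)
      show "sets (Th v) = sets borel" "sets (Th' v) = sets borel"
        "\<And>K. compact K \<Longrightarrow> emeasure (Th v) K < \<infinity>" "\<And>K. compact K \<Longrightarrow> emeasure (Th' v) K < \<infinity>"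
        using hessian_measure_opD(2,3)[OF T1 True] hessian_measure_opD(2,3)[OF T2 True] by blast+
      fix \<eta> :: "(real^'n) \<times> (real^'n) \<Rightarrow> real"
      assume \<eta>: "continuous_on UNIV \<eta>" and supp: "compact (closure {p. \<eta> p \<noteq> 0})"
      have K: "compact (fst ` closure {p. \<eta> p \<noteq> 0})"
        using supp by (intro compact_continuous_image continuous_on_fst continuous_on_id)
      have z: "\<eta> (x, y) = 0" if "x \<notin> fst ` closure {p. \<eta> p \<noteq> 0}" for x y
        using that closure_subset[of "{p. \<eta> p \<noteq> 0}"] by (force simp: image_iff)
      have "integral\<^sup>L (Th (f k)) \<eta> = integral\<^sup>L (Th' (f k)) \<eta>" for k
        using hessian_measure_op_C2[OF T1 fc f(2) \<eta> K z] hessian_measure_op_C2[OF T2 fc f(2) \<eta> K z] by simp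
      moreover have "(\<lambda>k. integral\<^sup>L (Th (f k)) \<eta>) \<longlonglongrightarrow> integral\<^sup>L (Th v) \<eta>"
        by (rule hessian_measure_op_convergence[OF T1 fc True pw \<eta> supp])
      moreover have "(\<lambda>k. integral\<^sup>L (Th' (f k)) \<eta>) \<longlonglongrightarrow> integral\<^sup>L (Th' v) \<eta>"
        by (rule hessian_measure_op_convergence[OF T2 fc True pw \<eta> supp])
      ultimately show "integral\<^sup>L (Th v) \<eta> = integral\<^sup>L (Th' v) \<eta>"
        using LIMSEQ_unique by simp
    qed
  qed
qed

text \<open>Existence and uniqueness together resolve the definite description \<open>THE\<close>;
  all further integrals are computed in the \<open>y\<close> variable.\<close>

lemma Theta0_eq_MA:
  fixes v :: "('n::finite) cvfun"
  assumes "convex_on UNIV v"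
  shows "Theta0 v = MA v"
proof -
  have "\<exists>!Th. is_hessian_measure_op (Th :: 'n cvfun \<Rightarrow> _)"
    using is_hessian_measure_op_MA hessian_measure_op_unique by blast
  then have "is_hessian_measure_op (Theta0 :: 'n cvfun \<Rightarrow> _)"
    unfolding Theta0_def by (rule theI')
  then have "Theta0 = (\<lambda>v::'n cvfun. if v \<in> Conv then MA v else null_measure borel)"
    using is_hessian_measure_op_MA hessian_measure_op_unique by blast
  from fun_cong[OF this, of v] show ?thesis using assms by (simp add: Conv_def)
qed

subsection \<open>Invariance properties of integrals over the gradient graph\<close>

lemma subpts_alt: "x \<in> subpts v y \<longleftrightarrow> (\<forall>x'. v x - y \<bullet> x \<le> v x' - y \<bullet> x')"
  by (auto simp: subpts_def inner_diff_right algebra_simps)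

text \<open>Where the segment passes from \<open>v < w\<close> to \<open>w < v\<close>, both
  functions agree with their minimum, and convexity of the minimum puts them below the chord between
  the smaller end values. The comparisons of fibres below use such a point to reach
  contradictions.\<close>

lemma convex_crossing:
  fixes v w :: "'a::euclidean_space \<Rightarrow> real"
  assumes v: "convex_on UNIV v" and w: "convex_on UNIV w" and m: "convex_on UNIV (\<lambda>x. min (v x) (w x))"
    and x1: "v x1 < w x1" and x2: "w x2 < v x2"
  obtains p t where "0 < t" "t < 1" "v p = w p" "v p - y \<bullet> p \<le> (1 - t) * (v x1 - y \<bullet> x1) + t * (w x2 - y \<bullet> x2)"
proof -
  define q where "q t = (1 - t) *\<^sub>R x1 + t *\<^sub>R x2" for t
  have cq: "continuous_on {0..1} q" unfolding q_def by (intro continuous_intros)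
  have "continuous_on {0..1} (\<lambda>t. v (q t) - w (q t))"
    by (intro continuous_intros continuous_on_compose2[OF convex_continuous[OF v] cq]
        continuous_on_compose2[OF convex_continuous[OF w] cq]) auto
  moreover have "v (q 0) - w (q 0) \<le> 0" "0 \<le> v (q 1) - w (q 1)" using x1 x2 by (auto simp: q_def)
  ultimately obtain t where t: "0 \<le> t" "t \<le> 1" "v (q t) - w (q t) = 0"
    using IVT'[of "\<lambda>t. v (q t) - w (q t)" 0 0 1] by auto
  have "t \<noteq> 0" "t \<noteq> 1" using t(3) x1 x2 by (auto simp: q_def)
  then have t': "0 < t" "t < 1" using t by auto
  have "min (v (q t)) (w (q t)) \<le> (1 - t) * min (v x1) (w x1) + t * min (v x2) (w x2)"
    unfolding q_def using convex_onD[OF m, of t x1 x2] t by simp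
  then have "v (q t) \<le> (1 - t) * v x1 + t * w x2" using t(3) x1 x2 by (simp add: min_def)
  then have "v (q t) - y \<bullet> q t \<le> (1 - t) * (v x1 - y \<bullet> x1) + t * (w x2 - y \<bullet> x2)"
    by (simp add: q_def inner_add_right algebra_simps)
  then show ?thesis using that t' t(3) by simp
qed

context
  fixes v w :: "'a::euclidean_space \<Rightarrow> real"
  assumes v: "convex_on UNIV v" and w: "convex_on UNIV w" and m: "convex_on UNIV (\<lambda>x. min (v x) (w x))"
begin

private lemma below_convex_comb: "a * (1 - t) + b * t < c" if "a \<le> c" "b < c" "0 < t" "t < 1" for a b c t :: real
proof -
  have "a * (1 - t) \<le> c * (1 - t)" using that by (intro mult_right_mono) auto
  moreover have "b * t < c * t" using that by simp
  ultimately show ?thesis by (simp add: algebra_simps)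
qed

lemma subpts_min_subset: "subpts (\<lambda>x. min (v x) (w x)) y \<subseteq> subpts v y \<union> subpts w y"
proof
  fix x assume "x \<in> subpts (\<lambda>x. min (v x) (w x)) y"
  then have x: "min (v x) (w x) - y \<bullet> x \<le> min (v x') (w x') - y \<bullet> x'" for x' by (simp add: subpts_alt)
  show "x \<in> subpts v y \<union> subpts w y"
  proof (cases "v x \<le> w x")
    case True
    have "v x - y \<bullet> x \<le> v x' - y \<bullet> x'" for x' using x[of x'] True by (simp add: min_def split: if_splits)
    then show ?thesis by (simp add: subpts_alt)
  next
    case False
    have "w x - y \<bullet> x \<le> w x' - y \<bullet> x'" for x' using x[of x'] False by (simp add: min_def split: if_splits)
    then show ?thesis by (simp add: subpts_alt)
  qed
qed

text \<open>Were both tilted functions somewhere below the minimum \<open>c\<close> of the tilted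
  maximum, a crossing between these two places would put both below \<open>c\<close> at
  once.\<close>

lemma subpts_max_subset: "subpts (\<lambda>x. max (v x) (w x)) y \<subseteq> subpts v y \<union> subpts w y"
proof
  fix x assume "x \<in> subpts (\<lambda>x. max (v x) (w x)) y"
  then have x: "max (v x) (w x) - y \<bullet> x \<le> max (v x') (w x') - y \<bullet> x'" for x' by (simp add: subpts_alt)
  define c where "c = max (v x) (w x) - y \<bullet> x"
  have "(\<forall>x'. c \<le> v x' - y \<bullet> x') \<or> (\<forall>x'. c \<le> w x' - y \<bullet> x')"
  proof (rule ccontr)
    assume "\<not> ?thesis"
    then obtain x1 x2 where l: "v x1 - y \<bullet> x1 < c" "w x2 - y \<bullet> x2 < c" by (auto simp: not_le)
    have "v x1 < w x1" "w x2 < v x2" using l x[of x1] x[of x2] by (auto simp: c_def max_def split: if_splits)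
    then obtain p t where p: "0 < t" "t < 1" "v p = w p" 
      "v p - y \<bullet> p \<le> (1 - t) * (v x1 - y \<bullet> x1) + t * (w x2 - y \<bullet> x2)"
      using convex_crossing[OF v w m] by metis
    have "v p - y \<bullet> p < c" 
      using p(4) below_convex_comb[of "v x1 - y \<bullet> x1" c "w x2 - y \<bullet> x2" t] l p(1,2) by (simp add: mult.commute)
    then show False using x[of p] p(3) by (simp add: c_def)
  qed
  then show "x \<in> subpts v y \<union> subpts w y"
  proof
    assume a: "\<forall>x'. c \<le> v x' - y \<bullet> x'"
    have "v x - y \<bullet> x \<le> c" by (simp add: c_def)
    then show ?thesis using a by (auto simp: subpts_alt intro: order_trans)
  next
    assume a: "\<forall>x'. c \<le> w x' - y \<bullet> x'"
    have "w x - y \<bullet> x \<le> c" by (simp add: c_def)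
    then show ?thesis using a by (auto simp: subpts_alt intro: order_trans)
  qed
qed

text \<open>If \<open>v x < w x\<close>, the point minimizes the tilted minimum: a lower value of
  \<open>w\<close> elsewhere would force a crossing where the tilted \<open>v\<close> is below its
  own minimum.\<close>

lemma subpts_subset_max_min:
  "subpts v y \<subseteq> subpts (\<lambda>x. max (v x) (w x)) y \<union> subpts (\<lambda>x. min (v x) (w x)) y"
proof
  fix x assume "x \<in> subpts v y"
  then have x: "v x - y \<bullet> x \<le> v x' - y \<bullet> x'" for x' by (simp add: subpts_alt)
  show "x \<in> subpts (\<lambda>x. max (v x) (w x)) y \<union> subpts (\<lambda>x. min (v x) (w x)) y"
  proof (cases "w x \<le> v x")
    case True
    have "max (v x) (w x) - y \<bullet> x \<le> max (v x') (w x') - y \<bullet> x'" for x' 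
      using x[of x'] True max.cobounded1[of "v x'" "w x'"] unfolding max_absorb1[OF True] by linarith
    then show ?thesis by (simp add: subpts_alt)
  next
    case False
    have "v x - y \<bullet> x \<le> min (v x1) (w x1) - y \<bullet> x1" for x1
    proof (rule ccontr)
      assume "\<not> ?thesis"
      then have l: "w x1 - y \<bullet> x1 < v x - y \<bullet> x" "w x1 < v x1" using x[of x1] by (auto simp: min_def split: if_splits)
      obtain p t where p: "0 < t" "t < 1" "v p = w p" 
        "v p - y \<bullet> p \<le> (1 - t) * (v x - y \<bullet> x) + t * (w x1 - y \<bullet> x1)"
        using convex_crossing[OF v w m] False l(2) by (metis not_le)
      then have "v p - y \<bullet> p < v x - y \<bullet> x"
        using below_convex_comb[of "v x - y \<bullet> x" "v x - y \<bullet> x" "w x1 - y \<bullet> x1" t] l(1) by (simp add: mult.commute)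
      then show False using x[of p] by simp
    qed
    then have "x \<in> subpts (\<lambda>x. min (v x) (w x)) y" using False by (simp add: subpts_alt)
    then show ?thesis by simp
  qed
qed

text \<open>The critical case is a smaller tilted value of \<open>w\<close> at some
  \<open>x'\<close>: a crossing between \<open>x\<close> and \<open>x'\<close> then undercuts the
  minimum of the tilted maximum.\<close>

lemma subpts_max_min_Int:
  assumes le: "v x \<le> w x"
  shows "x \<in> subpts (\<lambda>x. max (v x) (w x)) y \<inter> subpts (\<lambda>x. min (v x) (w x)) y \<longleftrightarrow> x \<in> subpts v y \<inter> subpts w y"
proof
  assume "x \<in> subpts (\<lambda>x. max (v x) (w x)) y \<inter> subpts (\<lambda>x. min (v x) (w x)) y"
  then have M: "\<And>x'. w x - y \<bullet> x \<le> max (v x') (w x') - y \<bullet> x'" 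
    and mm: "\<And>x'. v x - y \<bullet> x \<le> min (v x') (w x') - y \<bullet> x'" using le by (auto simp: subpts_alt)
  have 1: "v x - y \<bullet> x \<le> v x' - y \<bullet> x'" and 2: "v x - y \<bullet> x \<le> w x' - y \<bullet> x'" for x'
    using mm[of x'] by (auto simp: min_def split: if_splits)
  have "w x - y \<bullet> x \<le> w x' - y \<bullet> x'" for x'
  proof (rule ccontr)
    assume n: "\<not> ?thesis"
    then have l: "w x' - y \<bullet> x' < w x - y \<bullet> x" by simp
    have "v x \<noteq> w x" using n 2[of x'] by auto
    then have lt: "v x < w x" using le by simp
    have "w x' < v x'" using M[of x'] l by (auto simp: max_def split: if_splits)
    then obtain p t where p: "0 < t" "t < 1" "v p = w p" 
      "v p - y \<bullet> p \<le> (1 - t) * (v x - y \<bullet> x) + t * (w x' - y \<bullet> x')"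
      using convex_crossing[OF v w m lt] by metis
    have "v p - y \<bullet> p < w x - y \<bullet> x"
      using p below_convex_comb[of "v x - y \<bullet> x" "w x - y \<bullet> x" "w x' - y \<bullet> x'" t] l lt by (simp add: mult.commute)
    then show False using M[of p] p(3) by simp
  qed
  then show "x \<in> subpts v y \<inter> subpts w y" using 1 by (simp add: subpts_alt)
next
  assume "x \<in> subpts v y \<inter> subpts w y"
  then have x: "v x - y \<bullet> x \<le> v x' - y \<bullet> x'" "w x - y \<bullet> x \<le> w x' - y \<bullet> x'" for x' by (auto simp: subpts_alt)
  have "w x - y \<bullet> x \<le> max (v x') (w x') - y \<bullet> x'" for x' using x(2)[of x'] max.cobounded2[of "w x'" "v x'"] by linarith
  moreover have "v x - y \<bullet> x \<le> min (v x') (w x') - y \<bullet> x'" for x' using x[of x'] le by (auto simp: min_def)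
  ultimately show "x \<in> subpts (\<lambda>x. max (v x) (w x)) y \<inter> subpts (\<lambda>x. min (v x) (w x)) y"
    using le by (simp add: subpts_alt)
qed

end

text \<open>The valuation property before integration: with equal unions and intersections, sums
  over fibres are additive by inclusion-exclusion.\<close>

lemma subpts_max_min:
  fixes v w :: "'a::euclidean_space \<Rightarrow> real"
  assumes v: "convex_on UNIV v" and w: "convex_on UNIV w" and m: "convex_on UNIV (\<lambda>x. min (v x) (w x))"
  shows "subpts (\<lambda>x. max (v x) (w x)) y \<union> subpts (\<lambda>x. min (v x) (w x)) y = subpts v y \<union> subpts w y"
    and "subpts (\<lambda>x. max (v x) (w x)) y \<inter> subpts (\<lambda>x. min (v x) (w x)) y = subpts v y \<inter> subpts w y"
proof -
  have m': "convex_on UNIV (\<lambda>x. min (w x) (v x))" using m by (simp add: min.commute)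
  show "subpts (\<lambda>x. max (v x) (w x)) y \<union> subpts (\<lambda>x. min (v x) (w x)) y = subpts v y \<union> subpts w y"
    using subpts_min_subset[OF v w m, of y] subpts_max_subset[OF v w m, of y]
      subpts_subset_max_min[OF v w m, of y] subpts_subset_max_min[OF w v m', of y]
    by (simp add: min.commute max.commute) blast
  have "x \<in> subpts (\<lambda>x. max (v x) (w x)) y \<inter> subpts (\<lambda>x. min (v x) (w x)) y \<longleftrightarrow> x \<in> subpts v y \<inter> subpts w y" for x
  proof (cases "v x \<le> w x")
    case True then show ?thesis by (rule subpts_max_min_Int[OF v w m])
  next
    case False
    then have "w x \<le> v x" by simp
    from subpts_max_min_Int[OF w v m' this] show ?thesis by (simp add: min.commute max.commute Int_commute)
  qed
  then show "subpts (\<lambda>x. max (v x) (w x)) y \<inter> subpts (\<lambda>x. min (v x) (w x)) y = subpts v y \<inter> subpts w y" by blast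
qed

text \<open>Writing the value as a sum over a fibre with at most one point makes inclusion-exclusion
  applicable.\<close>

lemma gradval_sum:
  assumes "subpts v y = {} \<or> y \<in> gradpts v"
  shows "finite (subpts v y)" "gradval v f y = (\<Sum>x\<in>subpts v y. f (x, y))"
proof -
  have "finite (subpts v y) \<and> gradval v f y = (\<Sum>x\<in>subpts v y. f (x, y))"
  proof (cases "subpts v y = {}")
    case False
    then obtain x where "subpts v y = {x}" using assms by (auto simp: gradpts_def)
    then show ?thesis by (simp add: gradval_singleton)
  qed (simp add: gradval_empty)
  then show "finite (subpts v y)" "gradval v f y = (\<Sum>x\<in>subpts v y. f (x, y))" by auto
qed

lemma integral_gradval_valuation:
  fixes v w :: "'a::euclidean_space \<Rightarrow> real" and f :: "'a \<times> 'a \<Rightarrow> 'b::euclidean_space"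
  assumes v: "convex_on UNIV v" and w: "convex_on UNIV w" and M: "convex_on UNIV (\<lambda>x. max (v x) (w x))"
    and m: "convex_on UNIV (\<lambda>x. min (v x) (w x))"
    and f: "continuous_on UNIV f" and K: "compact K" "\<And>x y. x \<notin> K \<Longrightarrow> f (x, y) = 0"
  shows "integral\<^sup>L lborel (gradval (\<lambda>x. max (v x) (w x)) f) + integral\<^sup>L lborel (gradval (\<lambda>x. min (v x) (w x)) f)
    = integral\<^sup>L lborel (gradval v f) + integral\<^sup>L lborel (gradval w f)"
proof -
  let ?M = "\<lambda>x. max (v x) (w x)" and ?m = "\<lambda>x. min (v x) (w x)"
  note int = gradval_integrable[OF _ f K]
  have fb: "f \<in> borel_measurable borel" using f by (rule borel_measurable_continuous_onI)
  have "AE y in lborel. gradval ?M f y + gradval ?m f y = gradval v f y + gradval w f y"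
    using AE_gradpts[OF v] AE_gradpts[OF w] AE_gradpts[OF M] AE_gradpts[OF m]
  proof eventually_elim
    case (elim y)
    note fin = elim[THEN gradval_sum(1)] and g = elim[THEN gradval_sum(2), of f]
    have "gradval ?M f y + gradval ?m f y = (\<Sum>x\<in>subpts ?M y \<union> subpts ?m y. f (x, y)) + (\<Sum>x\<in>subpts ?M y \<inter> subpts ?m y. f (x, y))"
      unfolding g(3,4) by (rule sum.union_inter[symmetric]) (use fin in auto)
    also have "\<dots> = gradval v f y + gradval w f y"
      unfolding g(1,2) subpts_max_min[OF v w m] by (rule sum.union_inter) (use fin in auto)
    finally show ?case .
  qed
  then have "integral\<^sup>L lborel (\<lambda>y. gradval ?M f y + gradval ?m f y) = integral\<^sup>L lborel (\<lambda>y. gradval v f y + gradval w f y)"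
    by (intro integral_cong_AE borel_measurable_add gradval_measurable v w M m fb) auto
  then show ?thesis by (simp add: int[OF v] int[OF w] int[OF M] int[OF m])
qed

text \<open>Common pattern of the symmetries below: a bijection of fibres that respects the
  integrand preserves uniqueness of the point and the value there.\<close>

lemma gradval_via_subpts:
  assumes "subpts v' y' = {} \<longleftrightarrow> subpts v y = {}" and "\<And>x. x \<in> subpts v y \<longleftrightarrow> F x \<in> subpts v' y'" and "bij F"
    and "\<And>x. f' (F x, y') = f (x, y)"
  shows "gradval v' f' y' = gradval v f y"
proof -
  have eq: "subpts v' y' = F ` subpts v y"
    using assms(2,3) by (auto simp: image_iff bij_def surj_def) metis
  have inj: "inj F" using assms(3) by (rule bij_is_inj)
  show ?thesis
  proof (cases "y \<in> gradpts v")
    case True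
    then obtain x where x: "subpts v y = {x}" by (auto simp: gradpts_def)
    then have "subpts v' y' = {F x}" by (simp add: eq)
    with x show ?thesis using assms(4) by (simp add: gradval_singleton)
  next
    case False
    have "y' \<notin> gradpts v'"
    proof
      assume "y' \<in> gradpts v'"
      then obtain x' where "subpts v' y' = {x'}" by (auto simp: gradpts_def)
      then have x': "F ` subpts v y = {x'}" by (simp only: eq)
      then obtain x where x: "x \<in> subpts v y" "F x = x'" by blast
      have "F ` subpts v y = F ` {x}" using x' x(2) by simp
      then have "subpts v y = {x}" using inj by (simp only: inj_image_eq_iff)
      then show False using False by (simp add: gradpts_def)
    qed
    then show ?thesis using False by (simp add: gradval_def)
  qed
qed

lemma integral_gradval_add_linear:
  fixes v :: "'a::euclidean_space \<Rightarrow> real" and f :: "'a \<times> 'a \<Rightarrow> 'b::euclidean_space"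
  assumes v: "convex_on UNIV v" and f: "f \<in> borel_measurable borel" "(\<lambda>(x, y). f (x, y + a)) \<in> borel_measurable borel"
  shows "integral\<^sup>L lborel (gradval (\<lambda>t. v t + a \<bullet> t) f) = integral\<^sup>L lborel (gradval v (\<lambda>(x, y). f (x, y + a)))"
proof -
  let ?v = "\<lambda>t. v t + a \<bullet> t"
  have cv: "convex_on UNIV ?v"
  proof (rule convex_on_subgradientI)
    fix x obtain y where "x \<in> subpts v y" using subgradient_exists[OF v] .
    then have "x \<in> subpts ?v (y + a)" by (auto simp: subpts_def inner_diff_right inner_add_left algebra_simps)
    then show "\<exists>y. x \<in> subpts ?v y" ..
  qed
  have "gradval ?v f (a + y) = gradval v (\<lambda>(x, y). f (x, y + a)) y" for y
    by (rule gradval_via_subpts[where F = "\<lambda>x. x"])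
      (auto simp: subpts_def inner_diff_right inner_add_left algebra_simps bij_betw_id[unfolded id_def])
  moreover have "integral\<^sup>L lborel (gradval ?v f) = integral\<^sup>L lborel (\<lambda>y. gradval ?v f (a + y))"
    by (subst lborel_distr_plus[of a, symmetric], subst integral_distr)
      (use gradval_measurable[OF cv f(1)] in auto)
  ultimately show ?thesis by simp
qed

lemma gradval_add_const: "gradval (\<lambda>t. v t + c) f = gradval v f"
  by (rule ext, rule gradval_via_subpts[where F = "\<lambda>x. x"])
    (auto simp: subpts_def bij_betw_id[unfolded id_def])

lemma convex_on_scale: "convex_on UNIV (\<lambda>t. r * v t)" if "convex_on UNIV v" "0 \<le> (r::real)"
  using that by (rule convex_on_cmul[rotated])

text \<open>Subgradients scale with \<open>r\<close>; the Jacobian \<open>r ^ DIM('a)\<close> of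
  this dilation is the source of the degree of homogeneity.\<close>

lemma integral_gradval_scale:
  fixes v :: "'a::euclidean_space \<Rightarrow> real" and f :: "'a \<times> 'a \<Rightarrow> 'b::euclidean_space"
  assumes v: "convex_on UNIV v" and f: "f \<in> borel_measurable borel" and r: "0 < r"
  shows "integral\<^sup>L lborel (gradval (\<lambda>t. r * v t) f) = r ^ DIM('a) *\<^sub>R integral\<^sup>L lborel (gradval v (\<lambda>(x, y). f (x, r *\<^sub>R y)))"
proof -
  let ?v = "\<lambda>t. r * v t"
  have cv: "convex_on UNIV ?v" using v r by (intro convex_on_scale) auto
  have g: "gradval ?v f (r *\<^sub>R y) = gradval v (\<lambda>(x, y). f (x, r *\<^sub>R y)) y" for y
  proof (rule gradval_via_subpts[where F = "\<lambda>x. x"])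
    have "x \<in> subpts ?v (r *\<^sub>R y) \<longleftrightarrow> x \<in> subpts v y" for x
    proof -
      have "r * v x + (r *\<^sub>R y) \<bullet> (x' - x) \<le> r * v x' \<longleftrightarrow> v x + y \<bullet> (x' - x) \<le> v x'" for x'
        using r mult_le_cancel_left_pos[of r "v x + y \<bullet> (x' - x)" "v x'"] by (simp add: distrib_left)
      then show ?thesis by (simp add: subpts_def)
    qed
    then show "subpts ?v (r *\<^sub>R y) = {} \<longleftrightarrow> subpts v y = {}" "\<And>x. x \<in> subpts v y \<longleftrightarrow> x \<in> subpts ?v (r *\<^sub>R y)" by auto
  qed (auto simp: bij_betw_id[unfolded id_def])
  have mb: "gradval ?v f \<in> borel_measurable borel" using gradval_measurable[OF cv f] by simp
  have "integral\<^sup>L lborel (gradval ?v f) = r ^ DIM('a) *\<^sub>R integral\<^sup>L lborel (\<lambda>y. gradval ?v f (r *\<^sub>R y))"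
    using r mb
    by (subst lborel_affine[of r 0]) (simp_all add: integral_density integral_distr)
  then show ?thesis by (simp add: g)
qed

lemma integral_gradval_orthogonal:
  fixes v :: "'n::finite cvfun" and A :: "real^'n^'n" and f :: "(real^'n) \<times> (real^'n) \<Rightarrow> real"
  assumes v: "convex_on UNIV v" and A: "orthogonal_matrix A"
    and f: "continuous_on UNIV f" and K: "compact K" "\<And>x y. x \<notin> K \<Longrightarrow> f (x, y) = 0"
  shows "convex_on UNIV (\<lambda>t. v (transpose A *v t))"
    "integral\<^sup>L lborel (gradval (\<lambda>t. v (transpose A *v t)) f) = integral\<^sup>L lborel (gradval v (\<lambda>(x, y). f (A *v x, A *v y)))"
proof -
  let ?v = "\<lambda>t. v (transpose A *v t)"
  have inv: "transpose A *v (A *v x) = x" "A *v (transpose A *v x) = x" for x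
    using A by (metis matrix_vector_mul_assoc matrix_vector_mul_lid orthogonal_matrix_def)+
  have sub: "A *v x \<in> subpts ?v (A *v y) \<longleftrightarrow> x \<in> subpts v y" for x y
  proof -
    have i: "(A *v y) \<bullet> (A *v z) = y \<bullet> z" for y z
      by (metis dot_lmul_matrix inv(1) vector_transpose_matrix)
    have "A *v x \<in> subpts ?v (A *v y) \<longleftrightarrow> (\<forall>x'. ?v (A *v x) + (A *v y) \<bullet> (x' - A *v x) \<le> ?v x')" by (simp add: subpts_def)
    also have "\<dots> \<longleftrightarrow> (\<forall>z. ?v (A *v x) + (A *v y) \<bullet> (A *v z - A *v x) \<le> ?v (A *v z))" by (metis inv(2))
    also have "\<dots> \<longleftrightarrow> x \<in> subpts v y" 
      by (simp only: inv subpts_def i mem_Collect_eq flip: matrix_vector_mult_diff_distrib)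
    finally show ?thesis .
  qed
  show cv: "convex_on UNIV ?v"
  proof (rule convex_on_subgradientI)
    fix x obtain y where "transpose A *v x \<in> subpts v y" using subgradient_exists[OF v] .
    then have "x \<in> subpts ?v (A *v y)" using sub[of "transpose A *v x" y] inv(2) by simp
    then show "\<exists>y. x \<in> subpts ?v y" ..
  qed
  have g: "gradval ?v f (A *v y) = gradval v (\<lambda>(x, y). f (A *v x, A *v y)) y" for y
  proof (rule gradval_via_subpts[where F = "\<lambda>x. A *v x"])
    show "bij ((*v) A)" by (rule bij_betw_byWitness[where f' = "\<lambda>x. transpose A *v x"]) (auto simp: inv simp del: transpose_matrix_vector)
    show "\<And>x. x \<in> subpts v y \<longleftrightarrow> A *v x \<in> subpts ?v (A *v y)" using sub by simp
    then show "subpts ?v (A *v y) = {} \<longleftrightarrow> subpts v y = {}" by (metis empty_iff inv(2) equals0I)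
  qed auto
  have "integral\<^sup>L lborel (\<lambda>y. gradval ?v f (A *v y)) = integral\<^sup>L lborel (gradval ?v f)"
    by (rule integral_orthogonal[OF A gradval_integrable[OF cv f K]])
  then show "integral\<^sup>L lborel (gradval ?v f) = integral\<^sup>L lborel (gradval v (\<lambda>(x, y). f (A *v x, A *v y)))"
    by (simp only: g)
qed

subsection \<open>Conjugates of functions restricted to convex bodies\<close>

text \<open>The Legendre conjugate of \<open>u\<close> plus the convex indicator of
  \<open>D\<close>. For \<open>u = (\<bullet>) p\<close> it is the support function of
  \<open>D\<close> translated by \<open>p\<close>.\<close>

definition dconj :: "'a::euclidean_space set \<Rightarrow> ('a \<Rightarrow> real) \<Rightarrow> 'a \<Rightarrow> real" where
  "dconj D u x = (SUP y\<in>D. y \<bullet> x - u y)"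

lemma dconj_eqI:
  assumes "y \<in> D" "\<And>z. z \<in> D \<Longrightarrow> z \<bullet> x - u z \<le> y \<bullet> x - u y"
  shows "dconj D u x = y \<bullet> x - u y"
  unfolding dconj_def by (rule cSup_eq_maximum) (use assms in auto)

lemma dconj_attained:
  assumes "compact D" "D \<noteq> {}" "continuous_on UNIV u"
  obtains y where "y \<in> D" "dconj D u x = y \<bullet> x - u y" "\<And>z. z \<in> D \<Longrightarrow> z \<bullet> x - u z \<le> y \<bullet> x - u y"
proof -
  have "continuous_on D (\<lambda>y. y \<bullet> x - u y)"
    by (intro continuous_intros continuous_on_subset[OF assms(3)]) auto
  then obtain y where "y \<in> D" "\<forall>z\<in>D. z \<bullet> x - u z \<le> y \<bullet> x - u y"
    using continuous_attains_sup[OF assms(1,2)] by blast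
  then show ?thesis using that dconj_eqI by blast
qed

lemma dconj_ge:
  assumes "compact D" "continuous_on UNIV u" "y \<in> D"
  shows "y \<bullet> x - u y \<le> dconj D u x"
proof -
  have "D \<noteq> {}" using assms by auto
  then show ?thesis using dconj_attained[OF assms(1) _ assms(2)] assms(3) by metis
qed

lemma dconj_subgradient:
  assumes "compact D" "D \<noteq> {}" "continuous_on UNIV u"
  obtains y where "y \<in> D" "x \<in> subpts (dconj D u) y"
proof -
  obtain y where y: "y \<in> D" "dconj D u x = y \<bullet> x - u y" using dconj_attained[OF assms] by metis
  have "x \<in> subpts (dconj D u) y"
  proof (rule subptsI)
    fix x' show "dconj D u x + y \<bullet> (x' - x) \<le> dconj D u x'"
      using dconj_ge[OF assms(1,3) y(1), of x'] y(2) by (simp add: inner_diff_right)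
  qed
  then show ?thesis using that y by blast
qed

lemma dconj_convex:
  assumes "compact D" "D \<noteq> {}" "continuous_on UNIV u"
  shows "convex_on UNIV (dconj D u)"
  by (rule convex_on_subgradientI) (meson dconj_subgradient[OF assms])

lemma dconj_diff_le:
  assumes D: "compact D" "D \<noteq> {}" and u: "continuous_on UNIV u" "continuous_on UNIV w"
    and e: "\<And>z. z \<in> D \<Longrightarrow> \<bar>u z - w z\<bar> \<le> e"
  shows "\<bar>dconj D u x - dconj D w x\<bar> \<le> e"
proof -
  obtain y where y: "y \<in> D" "dconj D u x = y \<bullet> x - u y" using dconj_attained[OF D u(1)] by metis
  obtain z where z: "z \<in> D" "dconj D w x = z \<bullet> x - w z" using dconj_attained[OF D u(2)] by metis
  show ?thesis
    using dconj_ge[OF D(1) u(2) y(1), of x] dconj_ge[OF D(1) u(1) z(1), of x] e[OF y(1)] e[OF z(1)] y(2) z(2)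
    by linarith
qed

lemma dconj_Un:
  assumes "compact D1" "D1 \<noteq> {}" "compact D2" "D2 \<noteq> {}" "continuous_on UNIV u"
  shows "dconj (D1 \<union> D2) u x = max (dconj D1 u x) (dconj D2 u x)"
proof -
  obtain y where y: "y \<in> D1" "dconj D1 u x = y \<bullet> x - u y" "\<And>z. z \<in> D1 \<Longrightarrow> z \<bullet> x - u z \<le> y \<bullet> x - u y"
    using dconj_attained[OF assms(1,2,5)] by metis
  obtain z where z: "z \<in> D2" "dconj D2 u x = z \<bullet> x - u z" "\<And>y. y \<in> D2 \<Longrightarrow> y \<bullet> x - u y \<le> z \<bullet> x - u z"
    using dconj_attained[OF assms(3,4,5)] by metis
  show ?thesis
  proof (cases "dconj D1 u x \<le> dconj D2 u x")
    case True
    have "dconj (D1 \<union> D2) u x = z \<bullet> x - u z"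
      by (rule dconj_eqI) (use True y z in force)+
    then show ?thesis using True z(2) by simp
  next
    case False
    have "dconj (D1 \<union> D2) u x = y \<bullet> x - u y"
      by (rule dconj_eqI) (use False y z in force)+
    then show ?thesis using False y(2) by simp
  qed
qed

text \<open>The function maximized in \<^term>\<open>dconj\<close> is concave, so its maximum over one side of the
hyperplane is attained on the hyperplane unless the global maximum lies on that side.\<close>

lemma dconj_slice:
  fixes D :: "'a::euclidean_space set"
  assumes D: "compact D" "convex D" and u: "convex_on UNIV u"
    and ne: "D \<inter> {y. a \<bullet> y \<le> c} \<noteq> {}" "D \<inter> {y. a \<bullet> y \<ge> c} \<noteq> {}"
  shows "D \<inter> {y. a \<bullet> y = c} \<noteq> {}"
    and "dconj (D \<inter> {y. a \<bullet> y = c}) u x = min (dconj (D \<inter> {y. a \<bullet> y \<le> c}) u x) (dconj (D \<inter> {y. a \<bullet> y \<ge> c}) u x)"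
proof -
  have cu: "continuous_on UNIV u" using convex_continuous[OF u] .
  have cross: "\<exists>t. 0 \<le> t \<and> t \<le> 1 \<and> (1 - t) *\<^sub>R p + t *\<^sub>R q \<in> D \<inter> {y. a \<bullet> y = c}"
    if "p \<in> D" "a \<bullet> p \<le> c" "q \<in> D" "a \<bullet> q \<ge> c" for p q
  proof (cases "a \<bullet> p = c")
    case True then show ?thesis using that by (intro exI[of _ 0]) auto
  next
    case False
    then have pq: "a \<bullet> p < a \<bullet> q" using that by linarith
    define t where "t = (c - a \<bullet> p) / (a \<bullet> q - a \<bullet> p)"
    have t: "0 \<le> t" "t \<le> 1" using that pq by (auto simp: t_def divide_simps)
    have "t * (a \<bullet> q - a \<bullet> p) = c - a \<bullet> p" using pq by (simp add: t_def)
    then have "a \<bullet> ((1 - t) *\<^sub>R p + t *\<^sub>R q) = c" by (simp add: inner_add_right algebra_simps)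
    moreover have "(1 - t) *\<^sub>R p + t *\<^sub>R q \<in> D" using D(2) that t by (intro convexD) auto
    ultimately show ?thesis using t by blast
  qed
  show ne0: "D \<inter> {y. a \<bullet> y = c} \<noteq> {}"
  proof -
    obtain p q where "p \<in> D" "a \<bullet> p \<le> c" "q \<in> D" "a \<bullet> q \<ge> c" using ne by auto
    from cross[OF this] show ?thesis by blast
  qed
  have cD: "compact (D \<inter> {y. a \<bullet> y \<le> c})" "compact (D \<inter> {y. a \<bullet> y \<ge> c})" "compact (D \<inter> {y. a \<bullet> y = c})"
    by (intro compact_Int_closed D(1) closed_halfspace_le closed_halfspace_ge closed_hyperplane)+
  obtain p where p: "p \<in> D" "a \<bullet> p \<le> c" "dconj (D \<inter> {y. a \<bullet> y \<le> c}) u x = p \<bullet> x - u p"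
    using dconj_attained[OF cD(1) ne(1) cu] by (metis IntE mem_Collect_eq)
  obtain q where q: "q \<in> D" "a \<bullet> q \<ge> c" "dconj (D \<inter> {y. a \<bullet> y \<ge> c}) u x = q \<bullet> x - u q"
    using dconj_attained[OF cD(2) ne(2) cu] by (metis IntE mem_Collect_eq)
  obtain r where r: "r \<in> D" "a \<bullet> r = c" "dconj (D \<inter> {y. a \<bullet> y = c}) u x = r \<bullet> x - u r"
    using dconj_attained[OF cD(3) ne0 cu] by (metis IntE mem_Collect_eq)
  obtain t where t: "0 \<le> t" "t \<le> 1" "(1 - t) *\<^sub>R p + t *\<^sub>R q \<in> D \<inter> {y. a \<bullet> y = c}"
    using cross[OF p(1,2) q(1,2)] by blast
  let ?z = "(1 - t) *\<^sub>R p + t *\<^sub>R q"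
  have "u ?z \<le> (1 - t) * u p + t * u q" using convex_onD[OF u, of t p q] t by simp
  then have "(1 - t) * (p \<bullet> x - u p) + t * (q \<bullet> x - u q) \<le> ?z \<bullet> x - u ?z"
    by (simp add: inner_add_left algebra_simps)
  also have "\<dots> \<le> r \<bullet> x - u r" using dconj_ge[OF cD(3) cu t(3), of x] r(3) by simp
  finally have *: "(1 - t) * (p \<bullet> x - u p) + t * (q \<bullet> x - u q) \<le> r \<bullet> x - u r" .
  have "(1 - t) * min (p \<bullet> x - u p) (q \<bullet> x - u q) + t * min (p \<bullet> x - u p) (q \<bullet> x - u q)
      \<le> (1 - t) * (p \<bullet> x - u p) + t * (q \<bullet> x - u q)"
    using t by (intro add_mono mult_left_mono) auto
  then have "min (p \<bullet> x - u p) (q \<bullet> x - u q) \<le> (1 - t) * (p \<bullet> x - u p) + t * (q \<bullet> x - u q)"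
    by (simp add: left_diff_distrib)
  moreover have "r \<bullet> x - u r \<le> p \<bullet> x - u p" "r \<bullet> x - u r \<le> q \<bullet> x - u q"
    using dconj_ge[OF cD(1) cu, of r x] dconj_ge[OF cD(2) cu, of r x] r p q by auto
  ultimately show "dconj (D \<inter> {y. a \<bullet> y = c}) u x = min (dconj (D \<inter> {y. a \<bullet> y \<le> c}) u x) (dconj (D \<inter> {y. a \<bullet> y \<ge> c}) u x)"
    using * p(3) q(3) r(3) by linarith
qed

text \<open>A homothetic copy of \<open>B\<close> produces a factor \<open>t\<close> and an affine
  summand. Homogeneity and affine invariance absorb both, which leaves \<open>u\<close> replaced by
  its difference quotient at scale \<open>t\<close>.\<close>

lemma dconj_affine_image:
  assumes B: "compact B" "B \<noteq> {}" and u: "continuous_on UNIV u" and t: "0 < t"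
  shows "dconj ((\<lambda>z. c + t *\<^sub>R z) ` B) u x = t * dconj B (\<lambda>z. (u (c + t *\<^sub>R z) - u c) / t) x + c \<bullet> x + (- u c)"
proof -
  have cu: "continuous_on UNIV (\<lambda>z. (u (c + t *\<^sub>R z) - u c) / t)"
    using t by (intro continuous_intros continuous_on_compose2[OF u]) auto
  obtain z where z: "z \<in> B" "dconj B (\<lambda>z. (u (c + t *\<^sub>R z) - u c) / t) x = z \<bullet> x - (u (c + t *\<^sub>R z) - u c) / t"
    "\<And>z'. z' \<in> B \<Longrightarrow> z' \<bullet> x - (u (c + t *\<^sub>R z') - u c) / t \<le> z \<bullet> x - (u (c + t *\<^sub>R z) - u c) / t"
    using dconj_attained[OF B cu] by metis
  have td: "t * (a - b / t) = t * a - b" for a b using t by (simp add: right_diff_distrib)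
  have "dconj ((\<lambda>z. c + t *\<^sub>R z) ` B) u x = (c + t *\<^sub>R z) \<bullet> x - u (c + t *\<^sub>R z)"
  proof (rule dconj_eqI)
    fix y assume "y \<in> (\<lambda>z. c + t *\<^sub>R z) ` B"
    then obtain z' where z': "z' \<in> B" "y = c + t *\<^sub>R z'" by auto
    have "t * (z' \<bullet> x - (u (c + t *\<^sub>R z') - u c) / t) \<le> t * (z \<bullet> x - (u (c + t *\<^sub>R z) - u c) / t)"
      using z(3)[OF z'(1)] t by (intro mult_left_mono) auto
    then show "y \<bullet> x - u y \<le> (c + t *\<^sub>R z) \<bullet> x - u (c + t *\<^sub>R z)"
      unfolding td z'(2) by (simp add: inner_add_left)
  qed (use z(1) in auto)
  then show ?thesis unfolding z(2) td by (simp add: inner_add_left)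
qed

text \<open>The two-sided estimate expresses convexity and a quadratic remainder at once. The
  remainder makes difference quotients at scale \<open>t\<close> linear up to order
  \<open>t\<close>, uniformly on bounded sets.\<close>

definition quad_smooth :: "('a::real_inner \<Rightarrow> real) \<Rightarrow> ('a \<Rightarrow> 'a) \<Rightarrow> real \<Rightarrow> bool" where
  "quad_smooth u g C \<longleftrightarrow> continuous_on UNIV g \<and>
     (\<forall>y z. 0 \<le> u z - u y - g y \<bullet> (z - y) \<and> u z - u y - g y \<bullet> (z - y) \<le> C * (norm (z - y))\<^sup>2)"

lemma quad_smooth_linear: "quad_smooth (\<lambda>z. p \<bullet> z) (\<lambda>_. p) 0"
  by (simp add: quad_smooth_def inner_diff_right)

lemma quad_smooth_convex: "quad_smooth u g C \<Longrightarrow> convex_on UNIV u"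
  by (rule convex_on_subgradientI, rule exI, rule subptsI) (auto simp: quad_smooth_def algebra_simps)

text \<open>This scalar framework is shared by \<open>z0\<close>, by the coordinates of
  \<open>z\<close> minus its Hessian integral, and by valuations composed with a shear.\<close>

locale homogeneous_valuation =
  fixes Z :: "('a::euclidean_space \<Rightarrow> real) \<Rightarrow> real" and s :: real
  assumes continuous: "\<And>vs v. (\<And>k::nat. convex_on UNIV (vs k)) \<Longrightarrow> convex_on UNIV v \<Longrightarrow>
      (\<And>x. (\<lambda>k. vs k x) \<longlonglongrightarrow> v x) \<Longrightarrow> (\<lambda>k. Z (vs k)) \<longlonglongrightarrow> Z v"
    and valuation: "\<And>v w. convex_on UNIV v \<Longrightarrow> convex_on UNIV w \<Longrightarrow> 
      convex_on UNIV (\<lambda>x. max (v x) (w x)) \<Longrightarrow> convex_on UNIV (\<lambda>x. min (v x) (w x)) \<Longrightarrow>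
      Z (\<lambda>x. max (v x) (w x)) + Z (\<lambda>x. min (v x) (w x)) = Z v + Z w"
    and affine_invariant: "\<And>v a c. convex_on UNIV v \<Longrightarrow> Z (\<lambda>x. v x + a \<bullet> x + c) = Z v"
    and homogeneous: "\<And>v r. convex_on UNIV v \<Longrightarrow> 0 < r \<Longrightarrow> Z (\<lambda>x. r * v x) = r powr s * Z v"
begin

lemma cut:
  assumes D: "compact D" "convex D" and u: "convex_on UNIV u"
    and ne: "D \<inter> {y. a \<bullet> y \<le> c} \<noteq> {}" "D \<inter> {y. a \<bullet> y \<ge> c} \<noteq> {}"
  shows "Z (dconj D u) + Z (dconj (D \<inter> {y. a \<bullet> y = c}) u)
    = Z (dconj (D \<inter> {y. a \<bullet> y \<le> c}) u) + Z (dconj (D \<inter> {y. a \<bullet> y \<ge> c}) u)"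
proof -
  have cu: "continuous_on UNIV u" using convex_continuous[OF u] .
  have cD: "compact (D \<inter> {y. a \<bullet> y \<le> c})" "compact (D \<inter> {y. a \<bullet> y \<ge> c})" "compact (D \<inter> {y. a \<bullet> y = c})"
    by (intro compact_Int_closed D(1) closed_halfspace_le closed_halfspace_ge closed_hyperplane)+
  have un: "D \<inter> {y. a \<bullet> y \<le> c} \<union> D \<inter> {y. a \<bullet> y \<ge> c} = D" by auto
  let ?v = "dconj (D \<inter> {y. a \<bullet> y \<le> c}) u" and ?w = "dconj (D \<inter> {y. a \<bullet> y \<ge> c}) u"
  have M: "dconj D u = (\<lambda>x. max (?v x) (?w x))"
    using dconj_Un[OF cD(1) ne(1) cD(2) ne(2) cu] un by (simp add: fun_eq_iff)
  have m: "dconj (D \<inter> {y. a \<bullet> y = c}) u = (\<lambda>x. min (?v x) (?w x))"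
    using dconj_slice(2)[OF D u ne] by (simp add: fun_eq_iff)
  have D0: "D \<noteq> {}" using ne by auto
  show ?thesis
    using valuation[OF dconj_convex[OF cD(1) ne(1) cu] dconj_convex[OF cD(2) ne(2) cu]]
      dconj_convex[OF D(1) D0 cu] dconj_convex[OF cD(3) dconj_slice(1)[OF D u ne] cu]
    unfolding M m by blast
qed

lemma affine_image:
  assumes "compact B" "B \<noteq> {}" "continuous_on UNIV u" "0 < t"
  shows "Z (dconj ((\<lambda>z. c + t *\<^sub>R z) ` B) u) = t powr s * Z (dconj B (\<lambda>z. (u (c + t *\<^sub>R z) - u c) / t))"
proof -
  have cu: "continuous_on UNIV (\<lambda>z. (u (c + t *\<^sub>R z) - u c) / t)"
    using assms by (intro continuous_intros continuous_on_compose2[OF assms(3)]) auto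
  note cv = dconj_convex[OF assms(1,2) cu]
  have "Z (dconj ((\<lambda>z. c + t *\<^sub>R z) ` B) u) = Z (\<lambda>x. t * dconj B (\<lambda>z. (u (c + t *\<^sub>R z) - u c) / t) x + c \<bullet> x + (- u c))"
    by (rule arg_cong[of _ _ Z]) (simp add: fun_eq_iff dconj_affine_image[OF assms])
  also have "\<dots> = Z (\<lambda>x. t * dconj B (\<lambda>z. (u (c + t *\<^sub>R z) - u c) / t) x)"
    using assms(4) by (intro affine_invariant convex_on_scale cv) auto
  also have "\<dots> = t powr s * Z (dconj B (\<lambda>z. (u (c + t *\<^sub>R z) - u c) / t))"
    by (rule homogeneous[OF cv assms(4)])
  finally show ?thesis .
qed

text \<open>The error has two parts: the quadratic remainder contributes order \<open>t k\<close>,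
  and the moving base point contributes the variation of the continuous gradient
  \<open>g\<close>.\<close>

lemma blowup_limit:
  assumes B: "compact B" "B \<noteq> {}" and u: "quad_smooth u g C" and t: "\<And>k::nat. 0 < t k" "t \<longlonglongrightarrow> 0"
    and c: "c \<longlonglongrightarrow> c0"
  shows "(\<lambda>k. Z (dconj B (\<lambda>z. (u (c k + t k *\<^sub>R z) - u (c k)) / t k))) \<longlonglongrightarrow> Z (dconj B (\<lambda>z. g c0 \<bullet> z))"
proof (rule continuous)
  have cu: "continuous_on UNIV u" using convex_continuous[OF quad_smooth_convex[OF u]] .
  have cuk: "continuous_on UNIV (\<lambda>z. (u (c k + t k *\<^sub>R z) - u (c k)) / t k)" for k
    using t(1)[of k] by (intro continuous_intros continuous_on_compose2[OF cu]) auto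
  show "convex_on UNIV (dconj B (\<lambda>z. (u (c k + t k *\<^sub>R z) - u (c k)) / t k))" for k by (rule dconj_convex[OF B cuk])
  have c0: "continuous_on UNIV (\<lambda>z. g c0 \<bullet> z)" by (intro continuous_intros)
  show "convex_on UNIV (dconj B (\<lambda>z. g c0 \<bullet> z))" by (rule dconj_convex[OF B c0])
  obtain R where R: "0 < R" "\<And>z. z \<in> B \<Longrightarrow> norm z \<le> R" using B(1) compact_imp_bounded bounded_pos by metis
  have gc: "(\<lambda>k. g (c k)) \<longlonglongrightarrow> g c0"
    using u c by (intro continuous_on_tendsto_compose[of UNIV g]) (auto simp: quad_smooth_def)
  fix x
  have "(\<lambda>k. dconj B (\<lambda>z. (u (c k + t k *\<^sub>R z) - u (c k)) / t k) x - dconj B (\<lambda>z. g c0 \<bullet> z) x) \<longlonglongrightarrow> 0"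
  proof (rule Lim_null_comparison)
    show "(\<lambda>k. \<bar>C\<bar> * t k * R\<^sup>2 + norm (g (c k) - g c0) * R) \<longlonglongrightarrow> 0"
      using tendsto_add[OF tendsto_mult_left_zero[OF tendsto_mult_right_zero[OF t(2), of "\<bar>C\<bar>"], of "R\<^sup>2"]
        tendsto_mult_left_zero[OF tendsto_norm_zero[OF LIM_zero[OF gc]], of R]] by simp
    have "\<bar>(u (c k + t k *\<^sub>R z) - u (c k)) / t k - g c0 \<bullet> z\<bar> \<le> \<bar>C\<bar> * t k * R\<^sup>2 + norm (g (c k) - g c0) * R" if z: "z \<in> B" for k z
    proof -
      let ?d = "u (c k + t k *\<^sub>R z) - u (c k) - g (c k) \<bullet> (t k *\<^sub>R z)"
      have d: "0 \<le> ?d" "?d \<le> C * (norm (t k *\<^sub>R z))\<^sup>2"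
        using u[unfolded quad_smooth_def, THEN conjunct2, rule_format, of "c k + t k *\<^sub>R z" "c k"] by simp_all
      have "?d \<le> \<bar>C\<bar> * (t k)\<^sup>2 * R\<^sup>2"
      proof -
        have "C * (norm (t k *\<^sub>R z))\<^sup>2 \<le> \<bar>C\<bar> * (norm (t k *\<^sub>R z))\<^sup>2" by (intro mult_right_mono) auto
        also have "\<dots> = \<bar>C\<bar> * (t k)\<^sup>2 * (norm z)\<^sup>2" by (simp add: power_mult_distrib)
        also have "\<dots> \<le> \<bar>C\<bar> * (t k)\<^sup>2 * R\<^sup>2" using R(2)[OF z] by (intro mult_left_mono power_mono) auto
        finally show ?thesis using d by linarith
      qed
      then have "?d / t k \<le> \<bar>C\<bar> * t k * R\<^sup>2" using t(1)[of k] by (simp add: field_simps power2_eq_square)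
      moreover have "0 \<le> ?d / t k" using d t(1)[of k] by simp
      moreover have "(u (c k + t k *\<^sub>R z) - u (c k)) / t k - g c0 \<bullet> z = ?d / t k + (g (c k) - g c0) \<bullet> z"
        using t(1)[of k] by (simp add: field_simps inner_diff_left)
      moreover have "\<bar>(g (c k) - g c0) \<bullet> z\<bar> \<le> norm (g (c k) - g c0) * R"
        using Cauchy_Schwarz_ineq2[of "g (c k) - g c0" z] R(2)[OF z] mult_left_mono[of "norm z" R "norm (g (c k) - g c0)"] by fastforce
      ultimately show ?thesis by linarith
    qed
    then show "\<forall>\<^sub>F k in sequentially. norm (dconj B (\<lambda>z. (u (c k + t k *\<^sub>R z) - u (c k)) / t k) x - dconj B (\<lambda>z. g c0 \<bullet> z) x)
        \<le> \<bar>C\<bar> * t k * R\<^sup>2 + norm (g (c k) - g c0) * R"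
      by (auto intro!: always_eventually dconj_diff_le[OF B cuk c0])
  qed
  then show "(\<lambda>k. dconj B (\<lambda>z. (u (c k + t k *\<^sub>R z) - u (c k)) / t k) x) \<longlonglongrightarrow> dconj B (\<lambda>z. g c0 \<bullet> z) x"
    by (rule LIM_zero_cancel)
qed

end

section \<open>Bisection of boxes\<close>

definition sides :: "'a::euclidean_space \<Rightarrow> 'a set" where
  "sides d = {b \<in> Basis. d \<bullet> b \<noteq> 0}"

text \<open>The sides are halved one after another; \<open>J\<close> records the directions already
  treated.\<close>

definition half_sides :: "'a::euclidean_space set \<Rightarrow> 'a \<Rightarrow> 'a" where
  "half_sides J d = (\<Sum>b\<in>Basis. (if b \<in> J then d \<bullet> b / 2 else d \<bullet> b) *\<^sub>R b)"

lemma half_sides_inner [simp]: "b \<in> Basis \<Longrightarrow> half_sides J d \<bullet> b = (if b \<in> J then d \<bullet> b / 2 else d \<bullet> b)"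
  by (simp add: half_sides_def)

lemma finite_sides [simp]: "finite (sides d)"
  by (simp add: sides_def)

lemma sides_half_sides [simp]: "sides (half_sides J d) = sides d"
  by (auto simp: sides_def split: if_splits)

lemma half_sides_all: "half_sides (sides d) d = (1/2) *\<^sub>R d"
  by (rule euclidean_eqI) (auto simp: sides_def)

lemma half_sides_empty: "half_sides {} d = d"
  by (rule euclidean_eqI) auto

lemma half_sides_insert:
  assumes "b \<in> Basis" "b \<notin> J"
  shows "half_sides (insert b J) d = half_sides J d - (half_sides J d \<bullet> b / 2) *\<^sub>R b"
  by (rule euclidean_eqI) (use assms in \<open>auto simp: inner_diff_left inner_Basis\<close>)

context homogeneous_valuation
begin

text \<open>A box is a corner plus a side vector. Both halves share \<open>d'\<close>, and the slice
  between them, with sides \<open>d0\<close>, starts at the corner of the upper half; it has lost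
  the direction \<open>b\<close>.\<close>

lemma split_box:
  fixes c d b u
  defines "d' \<equiv> d - (d \<bullet> b / 2) *\<^sub>R b" and "d0 \<equiv> d - (d \<bullet> b) *\<^sub>R b" and "c' \<equiv> c + (d \<bullet> b / 2) *\<^sub>R b"
  assumes b: "b \<in> Basis" and d: "\<And>i. i \<in> Basis \<Longrightarrow> 0 \<le> d \<bullet> i" and u: "convex_on UNIV u"
  shows "Z (dconj (cbox c (c + d)) u) + Z (dconj (cbox c' (c' + d0)) u)
    = Z (dconj (cbox c (c + d')) u) + Z (dconj (cbox c' (c' + d')) u)"
proof -
  let ?m = "c \<bullet> b + d \<bullet> b / 2"
  have db: "0 \<le> d \<bullet> b" using d b by simp
  have bs: "(\<forall>i\<in>Basis. P i) \<longleftrightarrow> P b \<and> (\<forall>i\<in>Basis - {b}. P i)" for P using b by auto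
  have ib: "d' \<bullet> b = d \<bullet> b / 2" "d0 \<bullet> b = 0" "c' \<bullet> b = c \<bullet> b + d \<bullet> b / 2"
    using b by (simp_all add: d'_def d0_def c'_def inner_diff_left inner_add_left)
  have bc: "b \<bullet> y = y \<bullet> b" for y by (rule inner_commute)
  have ii: "d' \<bullet> i = d \<bullet> i" "d0 \<bullet> i = d \<bullet> i" "c' \<bullet> i = c \<bullet> i" if "i \<in> Basis - {b}" for i
    using b that by (auto simp: d'_def d0_def c'_def inner_diff_left inner_add_left inner_Basis)
  have e1: "cbox c (c + d) \<inter> {y. b \<bullet> y \<le> ?m} = cbox c (c + d')"
    unfolding set_eq_iff Int_iff mem_Collect_eq mem_box bs bc ib inner_add_left
    by (intro allI) (use db in \<open>auto simp: ii\<close>)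
  have e2: "cbox c (c + d) \<inter> {y. b \<bullet> y \<ge> ?m} = cbox c' (c' + d')"
    unfolding set_eq_iff Int_iff mem_Collect_eq mem_box bs bc ib inner_add_left
    by (intro allI) (use db in \<open>auto simp: ii\<close>)
  have e0: "cbox c (c + d) \<inter> {y. b \<bullet> y = ?m} = cbox c' (c' + d0)"
    unfolding set_eq_iff Int_iff mem_Collect_eq mem_box bs bc ib inner_add_left
    by (intro allI) (use db in \<open>auto simp: ii\<close>)
  have d': "0 \<le> d' \<bullet> i" if "i \<in> Basis" for i
    using d[OF that] b that by (auto simp: d'_def inner_diff_left inner_Basis)
  have "cbox c (c + d') \<noteq> {}" "cbox c' (c' + d') \<noteq> {}"
    using d' by (auto simp: box_ne_empty inner_add_left)
  then show ?thesis
    using cut[OF compact_cbox convex_box(1) u, of c "c + d" b ?m] unfolding e0 e1 e2 by simp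
qed

text \<open>The slices vanish by \<open>lower\<close>, so a value is the sum over two halves and one
  of them carries at least half of it in absolute value. The coordinate bounds keep the chosen piece
  inside the original box, where corners can accumulate.\<close>

lemma halve_box:
  assumes u: "convex_on UNIV u" and d: "\<And>i. i \<in> Basis \<Longrightarrow> 0 \<le> d \<bullet> i"
    and lower: "\<And>c d'. (\<And>i. i \<in> Basis \<Longrightarrow> 0 \<le> d' \<bullet> i) \<Longrightarrow> card (sides d') < card (sides d) \<Longrightarrow> Z (dconj (cbox c (c + d')) u) = 0"
    and J: "J \<subseteq> sides d"
  shows "\<exists>c'. (\<forall>i\<in>Basis. c \<bullet> i \<le> c' \<bullet> i \<and> c' \<bullet> i + half_sides J d \<bullet> i \<le> c \<bullet> i + d \<bullet> i) \<and>
     \<bar>Z (dconj (cbox c (c + d)) u)\<bar> \<le> 2 ^ card J * \<bar>Z (dconj (cbox c' (c' + half_sides J d)) u)\<bar>"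
proof -
  have "finite J" using J finite_subset finite_sides by blast
  then show ?thesis using J
  proof (induction J)
    case empty
    show ?case by (rule exI[of _ c]) (simp add: half_sides_empty)
  next
    case (insert b J)
    then obtain c' where c': "\<forall>i\<in>Basis. c \<bullet> i \<le> c' \<bullet> i \<and> c' \<bullet> i + half_sides J d \<bullet> i \<le> c \<bullet> i + d \<bullet> i"
      "\<bar>Z (dconj (cbox c (c + d)) u)\<bar> \<le> 2 ^ card J * \<bar>Z (dconj (cbox c' (c' + half_sides J d)) u)\<bar>" by blast
    define e where "e = half_sides J d"
    have b: "b \<in> Basis" "b \<in> sides d" "b \<notin> J" using insert by (auto simp: sides_def)
    have e: "0 \<le> e \<bullet> i" if "i \<in> Basis" for i using d[OF that] that by (simp add: e_def)
    have se: "sides e = sides d" by (simp add: e_def)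
    let ?d' = "e - (e \<bullet> b / 2) *\<^sub>R b" and ?d0 = "e - (e \<bullet> b) *\<^sub>R b" and ?c2 = "c' + (e \<bullet> b / 2) *\<^sub>R b"
    have hs: "half_sides (insert b J) d = ?d'" unfolding e_def by (rule half_sides_insert[OF b(1,3)])
    have "sides ?d0 = sides e - {b}"
      using b(1) by (auto simp: sides_def inner_diff_left inner_Basis split: if_splits)
    then have "sides ?d0 = sides d - {b}" by (simp only: se)
    then have "card (sides ?d0) < card (sides d)"
      using card_Diff1_less[OF finite_sides b(2)] by simp
    moreover have "0 \<le> ?d0 \<bullet> i" if "i \<in> Basis" for i
      using e[OF that] b(1) that by (auto simp: inner_diff_left inner_Basis)
    ultimately have "Z (dconj (cbox ?c2 (?c2 + ?d0)) u) = 0" by (intro lower)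
    then have sum: "Z (dconj (cbox c' (c' + e)) u) = Z (dconj (cbox c' (c' + ?d')) u) + Z (dconj (cbox ?c2 (?c2 + ?d')) u)"
      using split_box[OF b(1) e u, of c'] by simp
    have eb: "0 \<le> e \<bullet> b" using e b by simp
    have in1: "\<forall>i\<in>Basis. c \<bullet> i \<le> c' \<bullet> i \<and> c' \<bullet> i + ?d' \<bullet> i \<le> c \<bullet> i + d \<bullet> i"
    proof
      fix i :: 'a assume i: "i \<in> Basis"
      show "c \<bullet> i \<le> c' \<bullet> i \<and> c' \<bullet> i + ?d' \<bullet> i \<le> c \<bullet> i + d \<bullet> i"
        using c'(1)[rule_format, OF i] eb b(1) i unfolding e_def[symmetric] by (auto simp: inner_diff_left inner_Basis)
    qed
    have in2: "\<forall>i\<in>Basis. c \<bullet> i \<le> ?c2 \<bullet> i \<and> ?c2 \<bullet> i + ?d' \<bullet> i \<le> c \<bullet> i + d \<bullet> i"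
    proof
      fix i :: 'a assume i: "i \<in> Basis"
      show "c \<bullet> i \<le> ?c2 \<bullet> i \<and> ?c2 \<bullet> i + ?d' \<bullet> i \<le> c \<bullet> i + d \<bullet> i"
        using c'(1)[rule_format, OF i] eb b(1) i unfolding e_def[symmetric] by (auto simp: inner_diff_left inner_add_left inner_Basis)
    qed
    have c2: "\<bar>Z (dconj (cbox c (c + d)) u)\<bar> \<le> 2 ^ card J * \<bar>Z (dconj (cbox c' (c' + e)) u)\<bar>"
      using c'(2) by (simp add: e_def)
    have cardJ: "(2::real) ^ card (insert b J) = 2 * 2 ^ card J" using insert by simp
    show ?case
    proof (cases "\<bar>Z (dconj (cbox ?c2 (?c2 + ?d')) u)\<bar> \<le> \<bar>Z (dconj (cbox c' (c' + ?d')) u)\<bar>")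
      case True
      have "2 ^ card J * \<bar>Z (dconj (cbox c' (c' + e)) u)\<bar> \<le> 2 ^ card J * (2 * \<bar>Z (dconj (cbox c' (c' + ?d')) u)\<bar>)"
        using sum True by (intro mult_left_mono) auto
      then have "\<bar>Z (dconj (cbox c (c + d)) u)\<bar> \<le> 2 * 2 ^ card J * \<bar>Z (dconj (cbox c' (c' + ?d')) u)\<bar>"
        using c2 by linarith
      then show ?thesis using in1 unfolding hs cardJ by blast
    next
      case False
      have "2 ^ card J * \<bar>Z (dconj (cbox c' (c' + e)) u)\<bar> \<le> 2 ^ card J * (2 * \<bar>Z (dconj (cbox ?c2 (?c2 + ?d')) u)\<bar>)"
        using sum False by (intro mult_left_mono) auto
      then have "\<bar>Z (dconj (cbox c (c + d)) u)\<bar> \<le> 2 * 2 ^ card J * \<bar>Z (dconj (cbox ?c2 (?c2 + ?d')) u)\<bar>"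
        using c2 by linarith
      then show ?thesis using in2 unfolding hs cardJ by blast
    qed
  qed
qed

lemma halve_box_iterate:
  assumes u: "convex_on UNIV u" and d: "\<And>i. i \<in> Basis \<Longrightarrow> 0 \<le> d \<bullet> i"
    and lower: "\<And>c d'. (\<And>i. i \<in> Basis \<Longrightarrow> 0 \<le> d' \<bullet> i) \<Longrightarrow> card (sides d') < card (sides d) \<Longrightarrow> Z (dconj (cbox c (c + d')) u) = 0"
  shows "\<exists>c'. (\<forall>i\<in>Basis. c \<bullet> i \<le> c' \<bullet> i \<and> c' \<bullet> i + ((1/2)^k *\<^sub>R d) \<bullet> i \<le> c \<bullet> i + d \<bullet> i) \<and>
     \<bar>Z (dconj (cbox c (c + d)) u)\<bar> \<le> 2 ^ (card (sides d) * k) * \<bar>Z (dconj (cbox c' (c' + (1/2)^k *\<^sub>R d)) u)\<bar>"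
proof (induction k)
  case 0
  show ?case by (rule exI[of _ c]) simp
next
  case (Suc k)
  then obtain c' where c': "\<forall>i\<in>Basis. c \<bullet> i \<le> c' \<bullet> i \<and> c' \<bullet> i + ((1/2)^k *\<^sub>R d) \<bullet> i \<le> c \<bullet> i + d \<bullet> i"
     "\<bar>Z (dconj (cbox c (c + d)) u)\<bar> \<le> 2 ^ (card (sides d) * k) * \<bar>Z (dconj (cbox c' (c' + (1/2)^k *\<^sub>R d)) u)\<bar>" by blast
  let ?e = "(1/2)^k *\<^sub>R d"
  have se: "sides ?e = sides d" by (auto simp: sides_def)
  have e: "0 \<le> ?e \<bullet> i" if "i \<in> Basis" for i using d[OF that] by simp
  have half: "half_sides (sides d) ?e = (1/2)^Suc k *\<^sub>R d" using half_sides_all[of ?e] unfolding se by simp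
  obtain c2 where c2: "\<forall>i\<in>Basis. c' \<bullet> i \<le> c2 \<bullet> i \<and> c2 \<bullet> i + half_sides (sides d) ?e \<bullet> i \<le> c' \<bullet> i + ?e \<bullet> i"
     "\<bar>Z (dconj (cbox c' (c' + ?e)) u)\<bar> \<le> 2 ^ card (sides d) * \<bar>Z (dconj (cbox c2 (c2 + half_sides (sides d) ?e)) u)\<bar>"
    using halve_box[OF u e, of "sides d" c'] lower se by auto
  have "\<bar>Z (dconj (cbox c (c + d)) u)\<bar> \<le> 2 ^ (card (sides d) * k) * (2 ^ card (sides d) * \<bar>Z (dconj (cbox c2 (c2 + half_sides (sides d) ?e)) u)\<bar>)"
    using c'(2) c2(2) by (meson mult_left_mono order_trans zero_le_numeral zero_le_power)
  also have "\<dots> = 2 ^ (card (sides d) * Suc k) * \<bar>Z (dconj (cbox c2 (c2 + half_sides (sides d) ?e)) u)\<bar>"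
    by (simp add: power_add)
  finally show ?case using c'(1) c2(1) unfolding half by (intro exI[of _ c2]) force
qed

text \<open>After \<open>k\<close> rounds the factors combine to
  \<open>(2 powr (m - s)) ^ k\<close>, with \<open>m\<close> the number of nontrivial sides, times
  the value on a rescaled box, which converges along a subsequence. If \<open>m = s\<close> the
  factor is 1 and the limit itself has to be zero, which \<open>eq\<close> provides.\<close>

lemma vanishes_on_box_aux:
  assumes u: "quad_smooth u g C" and d: "\<And>i. i \<in> Basis \<Longrightarrow> 0 \<le> d \<bullet> i"
    and lower: "\<And>c d'. (\<And>i. i \<in> Basis \<Longrightarrow> 0 \<le> d' \<bullet> i) \<Longrightarrow> card (sides d') < card (sides d) \<Longrightarrow> Z (dconj (cbox c (c + d')) u) = 0"
    and s: "real (card (sides d)) \<le> s" and eq: "real (card (sides d)) = s \<Longrightarrow> \<forall>p. Z (dconj (cbox 0 d) (\<lambda>z. p \<bullet> z)) = 0"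
  shows "Z (dconj (cbox c (c + d)) u) = 0"
proof -
  let ?m = "card (sides d)" and ?t = "\<lambda>k::nat. (1/2::real)^k"
  have cu: "convex_on UNIV u" by (rule quad_smooth_convex[OF u])
  obtain c' where c': "\<And>k i. i \<in> Basis \<Longrightarrow> c \<bullet> i \<le> c' k \<bullet> i \<and> c' k \<bullet> i + (?t k *\<^sub>R d) \<bullet> i \<le> c \<bullet> i + d \<bullet> i"
    "\<And>k. \<bar>Z (dconj (cbox c (c + d)) u)\<bar> \<le> 2 ^ (?m * k) * \<bar>Z (dconj (cbox (c' k) (c' k + ?t k *\<^sub>R d)) u)\<bar>"
    using halve_box_iterate[OF cu d lower] by metis
  have "c' k \<in> cbox c (c + d)" for k
  proof -
    have "c \<bullet> i \<le> c' k \<bullet> i \<and> c' k \<bullet> i \<le> c \<bullet> i + d \<bullet> i" if i: "i \<in> Basis" for i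
    proof -
      have "0 \<le> (?t k *\<^sub>R d) \<bullet> i" using d[OF i] by simp
      then show ?thesis using c'(1)[OF i, of k] by linarith
    qed
    then show ?thesis by (simp add: mem_box inner_add_left)
  qed
  then obtain c0 r where r: "strict_mono (r :: nat \<Rightarrow> nat)" "(c' \<circ> r) \<longlonglongrightarrow> c0"
    using compact_cbox[of c "c + d"] unfolding compact_def by metis
  let ?B = "cbox 0 d"
  have B: "compact ?B" "?B \<noteq> {}" using d by (auto simp: box_ne_empty)
  define W where "W k = Z (dconj ?B (\<lambda>z. (u (c' k + ?t k *\<^sub>R z) - u (c' k)) / ?t k))" for k
  have resc: "Z (dconj (cbox (c' k) (c' k + ?t k *\<^sub>R d)) u) = (?t k) powr s * W k" for k
  proof -
    have "cbox (c' k) (c' k + ?t k *\<^sub>R d) = (\<lambda>z. c' k + ?t k *\<^sub>R z) ` cbox 0 d"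
      using image_affinity_cbox[of "?t k" "c' k" 0 d] B(2) by (simp add: add.commute)
    then show ?thesis using affine_image[OF B convex_continuous[OF cu], of "?t k" "c' k"] by (simp add: W_def)
  qed
  have bound: "\<bar>Z (dconj (cbox c (c + d)) u)\<bar> \<le> (2 powr (real ?m - s)) ^ k * \<bar>W k\<bar>" for k
  proof -
    have "2 ^ (?m * k) * (((1/2::real)^k) powr s) = (2 powr (real ?m - s)) ^ k"
    proof -
      have "((1/2::real)^k) powr s = 2 powr (- (real k * s))"
      proof -
        have "(1/2::real)^k = 2 powr (- real k)" by (simp add: power_one_over powr_minus_divide powr_realpow)
        then show ?thesis by (simp add: powr_powr)
      qed
      moreover have "(2::real) ^ (?m * k) = 2 powr (real ?m * real k)" by (simp flip: powr_realpow)
      moreover have "(2 powr (real ?m - s)) ^ k = 2 powr ((real ?m - s) * real k)"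
        by (simp add: powr_realpow[symmetric] powr_powr)
      ultimately show ?thesis by (simp add: powr_add[symmetric] algebra_simps)
    qed
    then show ?thesis using c'(2)[of k] unfolding resc by (simp add: abs_mult mult.assoc[symmetric])
  qed
  have "(\<lambda>k. Z (dconj ?B (\<lambda>z. (u ((c' \<circ> r) k + ?t (r k) *\<^sub>R z) - u ((c' \<circ> r) k)) / ?t (r k)))) \<longlonglongrightarrow> Z (dconj ?B (\<lambda>z. g c0 \<bullet> z))"
  proof (rule blowup_limit[OF B u])
    have "(\<lambda>k. ?t k) \<longlonglongrightarrow> 0" by (intro LIMSEQ_power_zero) simp
    from LIMSEQ_subseq_LIMSEQ[OF this r(1)] show "(\<lambda>k. ?t (r k)) \<longlonglongrightarrow> 0" by (simp add: o_def)
  qed (use r in \<open>auto simp: o_def\<close>)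
  then have Wl: "(\<lambda>k. \<bar>W (r k)\<bar>) \<longlonglongrightarrow> \<bar>Z (dconj ?B (\<lambda>z. g c0 \<bullet> z))\<bar>"
    by (intro tendsto_rabs) (simp add: W_def)
  have "(\<lambda>k. (2 powr (real ?m - s)) ^ r k * \<bar>W (r k)\<bar>) \<longlonglongrightarrow> 0"
  proof (cases "real ?m = s")
    case True
    then show ?thesis using Wl eq by simp
  next
    case False
    then have "2 powr (real ?m - s) < 1" using s by (simp add: powr_less_one)
    then have "(\<lambda>k. (2 powr (real ?m - s)) ^ k) \<longlonglongrightarrow> 0" by (intro LIMSEQ_power_zero) simp
    from tendsto_mult[OF LIMSEQ_subseq_LIMSEQ[OF this r(1)] Wl] show ?thesis by (simp add: o_def)
  qed
  then have "\<bar>Z (dconj (cbox c (c + d)) u)\<bar> \<le> 0"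
    by (rule LIMSEQ_le_const) (use bound in auto)
  then show ?thesis by simp
qed

text \<open>Strong induction on the number of nontrivial sides supplies \<open>lower\<close>, and
  the strict inequality rules out the limit case. A single point is the case of no sides.\<close>

lemma vanishes_on_low_dim_box:
  assumes u: "quad_smooth u g C" and d: "\<And>i. i \<in> Basis \<Longrightarrow> 0 \<le> d \<bullet> i" and s: "real (card (sides d)) < s"
  shows "Z (dconj (cbox c (c + d)) u) = 0"
  using d s
proof (induction "card (sides d)" arbitrary: c d rule: less_induct)
  case less
  show ?case
    by (rule vanishes_on_box_aux[OF u less.prems(1)]) (use less in auto)
qed

text \<open>Every slice has fewer than \<open>DIM('a)\<close> nontrivial sides, so
  \<open>vanishes_on_low_dim_box\<close> covers it. Homogeneity carries the assumption on the unit
  cube to side length \<open>r\<close>.\<close>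

lemma vanishes_on_cube:
  assumes u: "quad_smooth u g C" and s: "real DIM('a) \<le> s" and r: "0 < r"
    and eq: "real DIM('a) = s \<Longrightarrow> \<forall>p. Z (dconj (cbox 0 One) (\<lambda>z. p \<bullet> z)) = 0"
  shows "Z (dconj (cbox c (c + r *\<^sub>R One)) u) = 0"
proof (rule vanishes_on_box_aux[OF u])
  have sd: "sides (r *\<^sub>R One :: 'a) = Basis" using r by (auto simp: sides_def)
  show "0 \<le> (r *\<^sub>R One) \<bullet> i" if "i \<in> Basis" for i :: 'a using that r by simp
  show "real (card (sides (r *\<^sub>R One :: 'a))) \<le> s" using s by (simp add: sd)
  show "Z (dconj (cbox c (c + d')) u) = 0" 
    if "\<And>i. i \<in> Basis \<Longrightarrow> 0 \<le> d' \<bullet> i" "card (sides d') < card (sides (r *\<^sub>R One :: 'a))" for c d'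
    using that s by (intro vanishes_on_low_dim_box[OF u]) (auto simp: sd)
  assume "real (card (sides (r *\<^sub>R One :: 'a))) = s"
  then have eq': "Z (dconj (cbox 0 One) (\<lambda>z. p \<bullet> z)) = 0" for p using eq by (simp add: sd)
  show "\<forall>p. Z (dconj (cbox 0 (r *\<^sub>R One)) (\<lambda>z. p \<bullet> z)) = 0"
  proof
    fix p :: 'a
    have ne: "cbox 0 One \<noteq> ({} :: 'a set)" by (simp add: box_ne_empty)
    have "cbox 0 (r *\<^sub>R One) = (\<lambda>z::'a. 0 + r *\<^sub>R z) ` cbox 0 One"
      using image_affinity_cbox[of r 0 0 "One :: 'a"] ne r by simp
    then have "Z (dconj (cbox 0 (r *\<^sub>R One)) (\<lambda>z. p \<bullet> z)) = r powr s * Z (dconj (cbox 0 One) (\<lambda>z. (p \<bullet> (0 + r *\<^sub>R z) - p \<bullet> 0) / r))"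
      using affine_image[OF compact_cbox ne _ r, of "\<lambda>z. p \<bullet> z" 0] by (simp add: continuous_on_inner)
    also have "\<dots> = 0" using eq'[of p] r by simp
    finally show "Z (dconj (cbox 0 (r *\<^sub>R One)) (\<lambda>z. p \<bullet> z)) = 0" .
  qed
qed

end

section \<open>Strongly convex functions as limits of conjugates over cubes\<close>

lemma strongly_convex_subgradient:
  fixes v :: "'a::euclidean_space \<Rightarrow> real"
  assumes v: "convex_on UNIV v" and x: "x \<in> subpts (\<lambda>x. v x + e * (norm x)\<^sup>2) y"
  shows "v x + e * (norm x)\<^sup>2 + y \<bullet> (x' - x) + e * (norm (x' - x))\<^sup>2 \<le> v x' + e * (norm x')\<^sup>2"
proof -
  let ?w = "\<lambda>x. v x + e * (norm x)\<^sup>2"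
  let ?h = "x' - x"
  \<comment> \<open>The identity for \<open>(norm ?z)\<^sup>2\<close> yields a gain of order
    \<open>t * (1 - t)\<close>; dividing by \<open>t\<close> and letting \<open>t\<close> tend to 0
    keeps the full constant \<open>e\<close>.\<close>
  have step: "y \<bullet> ?h \<le> ?w x' - ?w x - e * (1 - t) * (norm ?h)\<^sup>2" if t: "0 < t" "t < 1" for t
  proof -
    let ?z = "(1 - t) *\<^sub>R x + t *\<^sub>R x'"
    have "?w x + y \<bullet> (?z - x) \<le> ?w ?z" by (rule subptsD[OF x])
    moreover have "?z - x = t *\<^sub>R ?h" by (simp add: algebra_simps)
    moreover have "v ?z \<le> (1 - t) * v x + t * v x'" using convex_onD[OF v, of t x x'] t by simp
    moreover have "(norm ?z)\<^sup>2 = (1 - t) * (norm x)\<^sup>2 + t * (norm x')\<^sup>2 - t * (1 - t) * (norm ?h)\<^sup>2"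
      unfolding power2_norm_eq_inner
      by (simp add: inner_add_left inner_add_right inner_diff_left inner_diff_right inner_commute power2_eq_square algebra_simps)
    ultimately have "v x + e * (norm x)\<^sup>2 + t * (y \<bullet> ?h) \<le> (1 - t) * v x + t * v x'
        + e * ((1 - t) * (norm x)\<^sup>2 + t * (norm x')\<^sup>2 - t * (1 - t) * (norm ?h)\<^sup>2)"
      by simp
    then have "t * (y \<bullet> ?h) \<le> t * (?w x' - ?w x - e * (1 - t) * (norm ?h)\<^sup>2)"
      by (simp add: algebra_simps)
    then show ?thesis using t by simp
  qed
  \<comment> \<open>\<open>t = 1 / (k + 2)\<close> stays strictly below 1 for every
    \<open>k\<close>.\<close>
  have "(\<lambda>k. ?w x' - ?w x - e * (1 - 1 / real (Suc (Suc k))) * (norm ?h)\<^sup>2) \<longlonglongrightarrow> ?w x' - ?w x - e * (1 - 0) * (norm ?h)\<^sup>2"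
    by (intro tendsto_intros LIMSEQ_Suc[OF LIMSEQ_Suc[OF lim_1_over_n]])
  then have "y \<bullet> ?h \<le> ?w x' - ?w x - e * (1 - 0) * (norm ?h)\<^sup>2"
    by (rule LIMSEQ_le_const) (use step in \<open>auto intro!: exI[of _ 0]\<close>)
  then show ?thesis by simp
qed

lemma convex_add_square:
  fixes v :: "'a::euclidean_space \<Rightarrow> real"
  assumes "convex_on UNIV v" "0 \<le> e"
  shows "convex_on UNIV (\<lambda>x. v x + e * (norm x)\<^sup>2)"
proof -
  have "convex_on UNIV (\<lambda>x::'a. (norm x)\<^sup>2)"
  proof (rule convex_on_subgradientI)
    fix x :: 'a
    have "x \<in> subpts (\<lambda>x. (norm x)\<^sup>2) (2 *\<^sub>R x)"
    proof (rule subptsI)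
      fix x'
      have "0 \<le> (x' - x) \<bullet> (x' - x)" by simp
      then show "(norm x)\<^sup>2 + (2 *\<^sub>R x) \<bullet> (x' - x) \<le> (norm x')\<^sup>2"
        by (simp add: power2_norm_eq_inner inner_diff_left inner_diff_right inner_commute)
    qed
    then show "\<exists>y. x \<in> subpts (\<lambda>x. (norm x)\<^sup>2) y" ..
  qed
  then show ?thesis using assms by (intro convex_on_add convex_on_cmul)
qed

text \<open>\<open>T\<close> is the gradient of the conjugate of \<open>w\<close>. Strong convexity
  gives coercivity, hence minimizers, makes them unique, and bounds the Lipschitz constant of
  \<open>T\<close> by \<open>1 / (2 * e)\<close>; the remainder of the conjugate is at most
  \<open>(z - y) \<bullet> (T z - T y)\<close>.\<close>

lemma strongly_convex_conjugate:
  fixes v :: "'a::euclidean_space \<Rightarrow> real"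
  assumes v: "convex_on UNIV v" and e: "0 < e"
  defines "w \<equiv> \<lambda>x. v x + e * (norm x)\<^sup>2"
  obtains T where "\<And>x y. x \<in> subpts w y \<longleftrightarrow> T y = x" "quad_smooth (\<lambda>y. y \<bullet> T y - w (T y)) T (1 / (2 * e))"
proof -
  have w: "convex_on UNIV w" unfolding w_def using v e by (intro convex_add_square) auto
  have strong: "w x + y \<bullet> (x' - x) + e * (norm (x' - x))\<^sup>2 \<le> w x'" if "x \<in> subpts w y" for x y x'
    using strongly_convex_subgradient[OF v that[unfolded w_def]] by (simp add: w_def)
  have "\<exists>x. x \<in> subpts w y" for y
  proof -
    obtain p where p: "0 \<in> subpts v p" using subgradient_exists[OF v] .
    \<comment> \<open>Beyond radius \<open>R\<close> the quadratic term outweighs the slope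
      \<open>y - p\<close>, so a minimizer over this ball is global.\<close>
    define R where "R = norm (y - p) / e"
    have R: "0 \<le> R" using e by (simp add: R_def)
    have "continuous_on (cball 0 R) (\<lambda>x. w x - y \<bullet> x)"
      by (intro continuous_intros continuous_on_subset[OF convex_continuous[OF w]]) auto
    then obtain x where x: "x \<in> cball 0 R" "\<And>z. z \<in> cball 0 R \<Longrightarrow> w x - y \<bullet> x \<le> w z - y \<bullet> z"
      using continuous_attains_inf[of "cball 0 R" "\<lambda>x. w x - y \<bullet> x"] R by auto
    have "w x - y \<bullet> x \<le> w z - y \<bullet> z" for z
    proof (cases "norm z \<le> R")
      case True then show ?thesis using x(2) by simp
    next
      case False
      have "w x - y \<bullet> x \<le> v 0" using x(2)[of 0] R by (simp add: w_def)
      also have "v 0 \<le> v 0 + norm z * (e * norm z - norm (y - p))"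
      proof -
        have "norm (y - p) \<le> e * norm z"
          using False e by (simp add: R_def not_le pos_divide_less_eq mult.commute)
        then have "0 \<le> norm z * (e * norm z - norm (y - p))" by (intro mult_nonneg_nonneg) auto
        then show ?thesis by simp
      qed
      also have "\<dots> \<le> v 0 + (p - y) \<bullet> z + e * (norm z)\<^sup>2"
        using norm_cauchy_schwarz[of "y - p" z] by (simp add: inner_diff_left power2_eq_square algebra_simps)
      also have "\<dots> \<le> w z - y \<bullet> z" using subptsD[OF p, of z] by (simp add: w_def inner_diff_left)
      finally show ?thesis .
    qed
    then have "x \<in> subpts w y" by (simp add: subpts_alt)
    then show ?thesis ..
  qed
  then obtain T where T: "\<And>y. T y \<in> subpts w y" by metis
  have uniq: "x = x'" if "x \<in> subpts w y" "x' \<in> subpts w y" for x x' y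
  proof -
    have n: "norm (x' - x) = norm (x - x')" by (rule norm_minus_commute)
    have "2 * (e * (norm (x - x'))\<^sup>2) \<le> 0"
      using strong[OF that(1), of x'] strong[OF that(2), of x] unfolding n by (simp add: inner_diff_right)
    then show ?thesis using e by (simp add: mult_le_0_iff)
  qed
  have lip: "2 * e * (norm (T z - T y))\<^sup>2 \<le> (z - y) \<bullet> (T z - T y)" for y z
  proof -
    have n: "norm (T y - T z) = norm (T z - T y)" by (rule norm_minus_commute)
    show ?thesis using strong[OF T[of y], of "T z"] strong[OF T[of z], of "T y"]
      unfolding n by (simp add: inner_diff_left inner_diff_right algebra_simps)
  qed
  have lip': "norm (T z - T y) \<le> norm (z - y) / (2 * e)" for y z
  proof (cases "T z = T y")
    case False
    have "2 * e * (norm (T z - T y))\<^sup>2 \<le> norm (z - y) * norm (T z - T y)"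
      using lip[of z y] norm_cauchy_schwarz[of "z - y" "T z - T y"] by linarith
    then have "norm (T z - T y) * (2 * e * norm (T z - T y)) \<le> norm (T z - T y) * norm (z - y)"
      by (simp add: power2_eq_square algebra_simps)
    then have "2 * e * norm (T z - T y) \<le> norm (z - y)" using False by simp
    then show ?thesis using e by (simp add: field_simps)
  qed (use e in simp)
  have "continuous_on UNIV T"
    unfolding continuous_on_iff
  proof (intro ballI allI impI)
    fix y :: 'a and d :: real assume "0 < d"
    have "dist (T z) (T y) < d" if "dist z y < d * (2 * e)" for z
    proof -
      have "norm (z - y) / (2 * e) < d" using that e by (simp add: dist_norm pos_divide_less_eq)
      then show ?thesis using lip'[of z y] by (simp add: dist_norm)
    qed
    then show "\<exists>\<delta>>0. \<forall>z\<in>UNIV. dist z y < \<delta> \<longrightarrow> dist (T z) (T y) < d"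
      using \<open>0 < d\<close> e by (intro exI[of _ "d * (2 * e)"]) auto
  qed
  moreover have "0 \<le> z \<bullet> T z - w (T z) - (y \<bullet> T y - w (T y)) - T y \<bullet> (z - y) \<and>
      z \<bullet> T z - w (T z) - (y \<bullet> T y - w (T y)) - T y \<bullet> (z - y) \<le> 1 / (2 * e) * (norm (z - y))\<^sup>2" for y z
  proof -
    let ?d = "z \<bullet> T z - w (T z) - (y \<bullet> T y - w (T y)) - T y \<bullet> (z - y)"
    have "0 \<le> ?d" using subptsD[OF T[of z], of "T y"] by (simp add: inner_diff_right inner_commute)
    have "?d \<le> (z - y) \<bullet> (T z - T y)"
      using subptsD[OF T[of y], of "T z"] by (simp add: inner_diff_right inner_diff_left inner_commute)
    also have "\<dots> \<le> norm (z - y) * norm (T z - T y)" by (rule norm_cauchy_schwarz)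
    also have "\<dots> \<le> norm (z - y) * (norm (z - y) / (2 * e))" by (intro mult_left_mono lip') auto
    finally show ?thesis using \<open>0 \<le> ?d\<close> by (simp add: power2_eq_square)
  qed
  ultimately have "quad_smooth (\<lambda>y. y \<bullet> T y - w (T y)) T (1 / (2 * e))" by (simp add: quad_smooth_def)
  moreover have "x \<in> subpts w y \<longleftrightarrow> T y = x" for x y using T uniq by blast
  ultimately show ?thesis using that by blast
qed

lemma mem_centered_cube:
  assumes "norm y \<le> R"
  shows "y \<in> cbox ((- R) *\<^sub>R One) ((- R) *\<^sub>R One + (2 * R) *\<^sub>R One :: 'a::euclidean_space)"
proof -
  have "- R \<le> y \<bullet> i \<and> y \<bullet> i \<le> R" if "i \<in> Basis" for i
    using Basis_le_norm[OF that, of y] assms by linarith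
  then show ?thesis by (simp add: mem_box inner_add_left inner_diff_left)
qed

context homogeneous_valuation
begin

text \<open>The conjugate over a cube coincides with the strongly convex function at
  \<open>x\<close> once the cube contains a subgradient there. Two limits follow: growing cubes,
  then a vanishing quadratic term.\<close>

theorem vanishes:
  assumes s: "real DIM('a) \<le> s" and eq: "real DIM('a) = s \<Longrightarrow> \<forall>p. Z (dconj (cbox 0 One) (\<lambda>z. p \<bullet> z)) = 0"
    and v: "convex_on UNIV v"
  shows "Z v = 0"
proof -
  define w where "w k x = v x + 1 / real (Suc k) * (norm x)\<^sup>2" for k x
  have w: "convex_on UNIV (w k)" for k unfolding w_def using v by (intro convex_add_square) auto
  have Zw: "Z (w k) = 0" for k
  proof -
    obtain T where T: "\<And>x y. x \<in> subpts (w k) y \<longleftrightarrow> T y = x"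
      "quad_smooth (\<lambda>y. y \<bullet> T y - w k (T y)) T (1 / (2 * (1 / real (Suc k))))"
      using strongly_convex_conjugate[OF v, of "1 / real (Suc k)"] unfolding w_def by auto
    define u where "u y = y \<bullet> T y - w k (T y)" for y
    define D where "D j = cbox ((- real (Suc j)) *\<^sub>R One) ((- real (Suc j)) *\<^sub>R One + (2 * real (Suc j)) *\<^sub>R One :: 'a)" for j
    have u: "quad_smooth u T (1 / (2 * (1 / real (Suc k))))" using T(2) by (simp add: u_def[abs_def])
    have ZD: "Z (dconj (D j) u) = 0" for j
      unfolding D_def by (rule vanishes_on_cube[OF u s _ eq]) auto
    have ne: "D j \<noteq> {}" for j using mem_centered_cube[of "0::'a" "real (Suc j)"] by (auto simp: D_def)
    have cu: "continuous_on UNIV u" using convex_continuous[OF quad_smooth_convex[OF u]] .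
    have cv: "convex_on UNIV (dconj (D j) u)" for j
      by (rule dconj_convex[OF _ ne cu]) (simp add: D_def)
    have "(\<lambda>j. Z (dconj (D j) u)) \<longlonglongrightarrow> Z (w k)"
    proof (rule continuous[OF cv w])
      fix x
      obtain y where y: "x \<in> subpts (w k) y" using subgradient_exists[OF w] .
      have "dconj (D j) u x = w k x" if j: "norm y \<le> real (Suc j)" for j
      proof -
        have "dconj (D j) u x = y \<bullet> x - u y"
        proof (rule dconj_eqI)
          show "y \<in> D j" unfolding D_def by (rule mem_centered_cube[OF j])
          fix z
          have "z \<bullet> x - u z \<le> w k x"
            using subptsD[of "T z" "w k" z x] T(1)[of "T z" z] by (simp add: u_def inner_diff_right)
          also have "w k x = y \<bullet> x - u y" using T(1)[of x y] y by (simp add: u_def)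
          finally show "z \<bullet> x - u z \<le> y \<bullet> x - u y" .
        qed
        then show ?thesis using T(1)[of x y] y by (simp add: u_def)
      qed
      moreover obtain J :: nat where "norm y \<le> real J" using real_arch_simple by blast
      ultimately have "\<forall>j\<ge>J. dconj (D j) u x = w k x" by simp
      then show "(\<lambda>j. dconj (D j) u x) \<longlonglongrightarrow> w k x"
        by (intro tendsto_eventually) (auto simp: eventually_sequentially)
    qed
    then show ?thesis using ZD by (simp add: LIMSEQ_const_iff)
  qed
  have "(\<lambda>k. Z (w k)) \<longlonglongrightarrow> Z v"
  proof (rule continuous[OF w v])
    fix x
    have "(\<lambda>k. v x + 1 / real (Suc k) * (norm x)\<^sup>2) \<longlonglongrightarrow> v x + 0 * (norm x)\<^sup>2"
      by (intro tendsto_intros LIMSEQ_Suc[OF lim_1_over_n])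
    then show "(\<lambda>k. w k x) \<longlonglongrightarrow> v x" by (simp add: w_def)
  qed
  then show ?thesis using Zw by (simp add: LIMSEQ_const_iff)
qed

end

subsection \<open>Continuity and compact support of the cube_density\<close>

text \<open>This is the matrix \<open>I + b \<tau>^T\<close>, with adjoint
  \<open>shear \<tau> b\<close>. For \<tau> orthogonal to \<open>b\<close> it preserves volume, and
  its inverse subtracts the same multiple of \<open>b\<close>.\<close>

definition shear :: "'a::euclidean_space \<Rightarrow> 'a \<Rightarrow> 'a \<Rightarrow> 'a" where
  "shear b \<tau> z = z + (\<tau> \<bullet> z) *\<^sub>R b"

lemma shear_adjoint: "shear b \<tau> z \<bullet> x = z \<bullet> shear \<tau> b x"
  by (simp add: shear_def inner_add_left inner_add_right inner_commute)

lemma shear_image_iff: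
  assumes "\<tau> \<bullet> b = 0"
  shows "y \<in> shear b \<tau> ` S \<longleftrightarrow> y - (\<tau> \<bullet> y) *\<^sub>R b \<in> S"
proof -
  have "shear b \<tau> (y - (\<tau> \<bullet> y) *\<^sub>R b) = y" by (simp add: shear_def inner_diff_right assms)
  moreover have "shear b \<tau> z - (\<tau> \<bullet> shear b \<tau> z) *\<^sub>R b = z" for z by (simp add: shear_def inner_add_right assms)
  ultimately show ?thesis by (metis (no_types, lifting) image_iff)
qed

lemma linear_shear: "linear (shear b \<tau>)"
  by (rule linearI) (simp_all add: shear_def inner_add_right algebra_simps)

text \<open>Passing to the adjoint moves the shear from the body to the argument and to the center
  \<open>p\<close>.\<close>

lemma dconj_shear:
  assumes "compact B" "B \<noteq> {}"
  shows "dconj (shear b \<tau> ` B) (\<lambda>z. p \<bullet> z) x = dconj B (\<lambda>z. shear \<tau> b p \<bullet> z) (shear \<tau> b x)"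
proof -
  have c: "continuous_on UNIV (\<lambda>z. shear \<tau> b p \<bullet> z)" by (intro continuous_intros)
  obtain y where y: "y \<in> B" "dconj B (\<lambda>z. shear \<tau> b p \<bullet> z) (shear \<tau> b x) = y \<bullet> shear \<tau> b x - shear \<tau> b p \<bullet> y"
    "\<And>z. z \<in> B \<Longrightarrow> z \<bullet> shear \<tau> b x - shear \<tau> b p \<bullet> z \<le> y \<bullet> shear \<tau> b x - shear \<tau> b p \<bullet> y"
    using dconj_attained[OF assms c] by metis
  have "dconj (shear b \<tau> ` B) (\<lambda>z. p \<bullet> z) x = shear b \<tau> y \<bullet> x - p \<bullet> shear b \<tau> y"
    by (rule dconj_eqI) (use y in \<open>auto simp: shear_adjoint inner_commute[of p] inner_commute[of "shear \<tau> b p"]\<close>)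
  then show ?thesis unfolding y(2) by (simp add: shear_adjoint inner_commute[of p] inner_commute[of "shear \<tau> b p"])
qed

lemma convex_on_shear:
  fixes v :: "'a::euclidean_space \<Rightarrow> real"
  assumes "convex_on UNIV v"
  shows "convex_on UNIV (\<lambda>x. v (shear \<tau> b x))"
proof (rule convex_on_subgradientI)
  fix x
  obtain y where y: "shear \<tau> b x \<in> subpts v y" using subgradient_exists[OF assms] .
  have "x \<in> subpts (\<lambda>x. v (shear \<tau> b x)) (shear b \<tau> y)"
  proof (rule subptsI)
    fix x' show "v (shear \<tau> b x) + shear b \<tau> y \<bullet> (x' - x) \<le> v (shear \<tau> b x')"
      using subptsD[OF y, of "shear \<tau> b x'"] by (simp add: shear_adjoint linear_diff[OF linear_shear])
  qed
  then show "\<exists>y. x \<in> subpts (\<lambda>x. v (shear \<tau> b x)) y" ..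
qed

lemma exists_large_coordinate:
  fixes p :: "'a::euclidean_space"
  obtains b where "b \<in> Basis" "norm p \<le> real DIM('a) * \<bar>p \<bullet> b\<bar>"
proof -
  let ?M = "Max ((\<lambda>b. \<bar>p \<bullet> b\<bar>) ` Basis)"
  have "?M \<in> (\<lambda>b. \<bar>p \<bullet> b\<bar>) ` Basis" by (rule Max_in) auto
  then obtain b where b: "?M = \<bar>p \<bullet> b\<bar>" "b \<in> Basis" by (rule imageE)
  have le: "\<bar>p \<bullet> i\<bar> \<le> \<bar>p \<bullet> b\<bar>" if "i \<in> Basis" for i
    unfolding b(1)[symmetric] using that by (intro Max_ge) auto
  have "norm p \<le> (\<Sum>i\<in>Basis. \<bar>p \<bullet> i\<bar>)" by (rule norm_le_l1)
  also have "\<dots> \<le> (\<Sum>i\<in>(Basis::'a set). \<bar>p \<bullet> b\<bar>)" by (intro sum_mono le)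
  finally show ?thesis using that b(2) by simp
qed

context homogeneous_valuation
begin

text \<open>Slices along the shearing hyperplane are sheared boxes. Absorbing the shear into the
  valuation makes the results on boxes apply to them.\<close>

lemma homogeneous_valuation_shear: "homogeneous_valuation (\<lambda>v. Z (\<lambda>x. v (shear \<tau> b x))) s"
proof
  fix vs :: "nat \<Rightarrow> 'a \<Rightarrow> real" and v
  assume "\<And>k. convex_on UNIV (vs k)" "convex_on UNIV v" "\<And>x. (\<lambda>k. vs k x) \<longlonglongrightarrow> v x"
  then show "(\<lambda>k. Z (\<lambda>x. vs k (shear \<tau> b x))) \<longlonglongrightarrow> Z (\<lambda>x. v (shear \<tau> b x))"
    by (intro continuous convex_on_shear)
next
  fix v w :: "'a \<Rightarrow> real"
  assume "convex_on UNIV v" "convex_on UNIV w" "convex_on UNIV (\<lambda>x. max (v x) (w x))" "convex_on UNIV (\<lambda>x. min (v x) (w x))"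
  from this[THEN convex_on_shear[of _ \<tau> b]]
  show "Z (\<lambda>x. max (v (shear \<tau> b x)) (w (shear \<tau> b x))) + Z (\<lambda>x. min (v (shear \<tau> b x)) (w (shear \<tau> b x)))
    = Z (\<lambda>x. v (shear \<tau> b x)) + Z (\<lambda>x. w (shear \<tau> b x))" by (rule valuation)
next
  fix v :: "'a \<Rightarrow> real" and a c
  assume "convex_on UNIV v"
  from affine_invariant[OF convex_on_shear[OF this, of \<tau> b], of "shear b \<tau> a" c]
  show "Z (\<lambda>x. v (shear \<tau> b x) + a \<bullet> shear \<tau> b x + c) = Z (\<lambda>x. v (shear \<tau> b x))" by (simp add: shear_adjoint)
next
  fix v :: "'a \<Rightarrow> real" and r :: real
  assume "convex_on UNIV v" "0 < r"
  then show "Z (\<lambda>x. r * v (shear \<tau> b x)) = r powr s * Z (\<lambda>x. v (shear \<tau> b x))"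
    by (intro homogeneous convex_on_shear)
qed

definition cube_density :: "'a \<Rightarrow> real" where
  "cube_density p = Z (dconj (cbox 0 One) (\<lambda>z. p \<bullet> z))"

lemma unit_cube: "compact (cbox 0 One :: 'a set)" "convex (cbox 0 One :: 'a set)" "cbox 0 One \<noteq> ({} :: 'a set)"
  by (simp_all add: box_ne_empty convex_box)

lemma density_continuous: "continuous_on UNIV cube_density"
  unfolding continuous_on_sequentially
proof (intro allI ballI impI)
  fix X :: "nat \<Rightarrow> 'a" and p assume *: "(\<forall>n. X n \<in> UNIV) \<and> X \<longlonglongrightarrow> p"
  let ?Q = "cbox 0 One :: 'a set"
  have c: "continuous_on UNIV (\<lambda>z. p \<bullet> z)" for p :: 'a by (intro continuous_intros)
  obtain R where R: "0 < R" "\<And>z. z \<in> ?Q \<Longrightarrow> norm z \<le> R" using unit_cube(1) compact_imp_bounded bounded_pos by metis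
  have "(\<lambda>k. Z (dconj ?Q (\<lambda>z. X k \<bullet> z))) \<longlonglongrightarrow> Z (dconj ?Q (\<lambda>z. p \<bullet> z))"
  proof (rule continuous[OF dconj_convex[OF unit_cube(1,3) c] dconj_convex[OF unit_cube(1,3) c]])
    fix x
    have "(\<lambda>k. dconj ?Q (\<lambda>z. X k \<bullet> z) x - dconj ?Q (\<lambda>z. p \<bullet> z) x) \<longlonglongrightarrow> 0"
    proof (rule Lim_null_comparison)
      show "(\<lambda>k. norm (X k - p) * R) \<longlonglongrightarrow> 0"
        using tendsto_mult_left_zero[OF tendsto_norm_zero[OF LIM_zero]] * by blast
      have "\<bar>X k \<bullet> z - p \<bullet> z\<bar> \<le> norm (X k - p) * R" if "z \<in> ?Q" for k z
        using Cauchy_Schwarz_ineq2[of "X k - p" z] mult_left_mono[OF R(2)[OF that], of "norm (X k - p)"]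
        by (simp add: inner_diff_left)
      then show "\<forall>\<^sub>F k in sequentially. norm (dconj ?Q (\<lambda>z. X k \<bullet> z) x - dconj ?Q (\<lambda>z. p \<bullet> z) x) \<le> norm (X k - p) * R"
        by (auto intro!: always_eventually dconj_diff_le[OF unit_cube(1,3) c c])
    qed
    then show "(\<lambda>k. dconj ?Q (\<lambda>z. X k \<bullet> z) x) \<longlonglongrightarrow> dconj ?Q (\<lambda>z. p \<bullet> z) x" by (rule LIM_zero_cancel)
  qed
  then show "(cube_density \<circ> X) \<longlonglongrightarrow> cube_density p" by (simp add: cube_density_def o_def)
qed

lemma low_dim_side:
  assumes s: "s = real DIM('a)" and b: "b \<in> Basis"
  shows "Z (dconj (cbox c (c + (One - b))) (\<lambda>z. p \<bullet> z)) = 0"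
proof (rule vanishes_on_low_dim_box[OF quad_smooth_linear])
  have "sides (One - b) \<subseteq> Basis - {b}" using b by (auto simp: sides_def inner_diff_left)
  then have "card (sides (One - b)) \<le> card (Basis - {b})" by (intro card_mono) auto
  also have "\<dots> < DIM('a)" using b by (intro card_Diff1_less) auto
  finally show "real (card (sides (One - b))) < s" by (simp add: s)
  show "0 \<le> (One - b) \<bullet> i" if "i \<in> Basis" for i
    using that b by (auto simp: inner_diff_left inner_Basis)
qed

text \<open>The cube and its shear are cut into congruent pieces: the part of the sheared cube above
height 1 is a translate of the part of the cube below the shearing hyperplane.\<close>

lemma shear_invariant:
  assumes s: "s = real DIM('a)" and b: "b \<in> Basis" and \<tau>b: "\<tau> \<bullet> b = 0"
    and \<tau>: "\<And>i. i \<in> Basis \<Longrightarrow> 0 \<le> \<tau> \<bullet> i" "\<And>i. i \<in> Basis \<Longrightarrow> \<tau> \<bullet> i \<le> 1 / real DIM('a)"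
  shows "Z (dconj (shear b \<tau> ` cbox 0 One) (\<lambda>z. p \<bullet> z)) = cube_density p"
proof -
  let ?Q = "cbox 0 One :: 'a set" and ?u = "\<lambda>z. p \<bullet> z"
  let ?P = "shear b \<tau> ` ?Q"
  let ?a = "b - \<tau>"
  have bb: "b \<bullet> b = 1" using b by simp
  have cvu: "convex_on UNIV ?u" by (rule quad_smooth_convex[OF quad_smooth_linear])
  have cu: "continuous_on UNIV ?u" by (intro continuous_intros)
  have Q: "z \<in> ?Q \<longleftrightarrow> (\<forall>i\<in>Basis. 0 \<le> z \<bullet> i \<and> z \<bullet> i \<le> 1)" for z by (simp add: mem_box)
  \<comment> \<open>The bound \<open>1 / real DIM('a)\<close> on the coordinates of \<tau> serves
    here: the shear lifts points of the cube by at most 1, so one cut at height 1 and one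
    translation by \<open>b\<close> return the overhang to the cube.\<close>
  have \<tau>z: "0 \<le> \<tau> \<bullet> z \<and> \<tau> \<bullet> z \<le> 1" if z: "\<And>i. i \<in> Basis \<Longrightarrow> i \<noteq> b \<Longrightarrow> 0 \<le> z \<bullet> i \<and> z \<bullet> i \<le> 1" for z
  proof -
    have e: "\<tau> \<bullet> z = (\<Sum>i\<in>Basis. (\<tau> \<bullet> i) * (z \<bullet> i))" by (rule euclidean_inner)
    have "0 \<le> (\<tau> \<bullet> i) * (z \<bullet> i) \<and> (\<tau> \<bullet> i) * (z \<bullet> i) \<le> 1 / real DIM('a)" if i: "i \<in> Basis" for i
    proof (cases "i = b")
      case False
      then show ?thesis using z[OF i] \<tau>[OF i] mult_mono[of "\<tau> \<bullet> i" "1 / real DIM('a)" "z \<bullet> i" 1] by auto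
    qed (simp add: \<tau>b)
    then have "0 \<le> \<tau> \<bullet> z" "\<tau> \<bullet> z \<le> (\<Sum>i\<in>(Basis::'a set). 1 / real DIM('a))"
      unfolding e by (blast intro: sum_nonneg sum_mono)+
    then show ?thesis by simp
  qed
  have P: "y \<in> ?P \<longleftrightarrow> (\<forall>i\<in>Basis. i \<noteq> b \<longrightarrow> 0 \<le> y \<bullet> i \<and> y \<bullet> i \<le> 1) \<and> 0 \<le> ?a \<bullet> y \<and> ?a \<bullet> y \<le> 1" for y
  proof -
    have "y \<in> ?P \<longleftrightarrow> y - (\<tau> \<bullet> y) *\<^sub>R b \<in> ?Q" by (rule shear_image_iff[OF \<tau>b])
    also have "\<dots> \<longleftrightarrow> (\<forall>i\<in>Basis. i \<noteq> b \<longrightarrow> 0 \<le> y \<bullet> i \<and> y \<bullet> i \<le> 1) \<and> 0 \<le> ?a \<bullet> y \<and> ?a \<bullet> y \<le> 1"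
    proof -
      have "(\<forall>i\<in>Basis. R i) \<longleftrightarrow> (\<forall>i\<in>Basis. i \<noteq> b \<longrightarrow> R i) \<and> R b" for R using b by auto
      note this[of "\<lambda>i. 0 \<le> (y - (\<tau> \<bullet> y) *\<^sub>R b) \<bullet> i \<and> (y - (\<tau> \<bullet> y) *\<^sub>R b) \<bullet> i \<le> 1"]
      moreover have "(y - (\<tau> \<bullet> y) *\<^sub>R b) \<bullet> i = y \<bullet> i" if "i \<in> Basis" "i \<noteq> b" for i
        using that b by (simp add: inner_diff_left inner_not_same_Basis)
      moreover have "(y - (\<tau> \<bullet> y) *\<^sub>R b) \<bullet> b = ?a \<bullet> y" by (simp add: inner_diff_left bb inner_commute[of y])
      ultimately show ?thesis unfolding Q by auto
    qed
    finally show ?thesis .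
  qed
  have Qb: "z \<in> ?Q \<longleftrightarrow> (\<forall>i\<in>Basis. i \<noteq> b \<longrightarrow> 0 \<le> z \<bullet> i \<and> z \<bullet> i \<le> 1) \<and> 0 \<le> b \<bullet> z \<and> b \<bullet> z \<le> 1" for z
    unfolding Q using b by (auto simp: inner_commute)
  have ay: "?a \<bullet> y = b \<bullet> y - \<tau> \<bullet> y" for y by (simp add: inner_diff_left)
  have A: "?P \<inter> {y. b \<bullet> y \<le> 1} = ?Q \<inter> {y. ?a \<bullet> y \<ge> 0}"
  proof (rule set_eqI)
    fix y show "y \<in> ?P \<inter> {y. b \<bullet> y \<le> 1} \<longleftrightarrow> y \<in> ?Q \<inter> {y. ?a \<bullet> y \<ge> 0}"
      unfolding Int_iff mem_Collect_eq P Qb ay using \<tau>z[of y] by auto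
  qed
  have Bz: "b + z \<in> ?P \<inter> {y. b \<bullet> y \<ge> 1} \<longleftrightarrow> z \<in> ?Q \<inter> {y. ?a \<bullet> y \<le> 0}" for z
  proof -
    have 1: "(b + z) \<bullet> i = z \<bullet> i" if "i \<in> Basis" "i \<noteq> b" for i using that b by (simp add: inner_add_left inner_not_same_Basis)
    have 2: "b \<bullet> (b + z) = 1 + b \<bullet> z" "\<tau> \<bullet> (b + z) = \<tau> \<bullet> z" by (simp_all add: inner_add_right bb \<tau>b)
    have "(\<forall>i\<in>Basis. i \<noteq> b \<longrightarrow> 0 \<le> (b + z) \<bullet> i \<and> (b + z) \<bullet> i \<le> 1) \<longleftrightarrow> (\<forall>i\<in>Basis. i \<noteq> b \<longrightarrow> 0 \<le> z \<bullet> i \<and> z \<bullet> i \<le> 1)" using 1 by auto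
    then show ?thesis unfolding Int_iff mem_Collect_eq P Qb ay 2 using \<tau>z[of z] by auto
  qed
  have B: "?P \<inter> {y. b \<bullet> y \<ge> 1} = (\<lambda>z. b + 1 *\<^sub>R z) ` (?Q \<inter> {y. ?a \<bullet> y \<le> 0})"
  proof (rule set_eqI)
    fix y
    have "y \<in> (\<lambda>z. b + 1 *\<^sub>R z) ` X \<longleftrightarrow> y - b \<in> X" for X
      by (auto simp: image_iff intro!: bexI[of _ "y - b"])
    moreover have "b + (y - b) = y" by simp
    ultimately show "y \<in> ?P \<inter> {y. b \<bullet> y \<ge> 1} \<longleftrightarrow> y \<in> (\<lambda>z. b + 1 *\<^sub>R z) ` (?Q \<inter> {y. ?a \<bullet> y \<le> 0})"
      using Bz[of "y - b"] by (simp only:)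
  qed
  have oneb: "(One - b) \<bullet> i = (if i = b then 0 else 1)" if "i \<in> Basis" for i
    using that b by (auto simp: inner_diff_left inner_Basis)
  have C: "?P \<inter> {y. b \<bullet> y = 1} = cbox b (b + (One - b))"
  proof (rule set_eqI)
    fix y
    have "y \<in> cbox b (b + (One - b)) \<longleftrightarrow> (\<forall>i\<in>Basis. b \<bullet> i \<le> y \<bullet> i \<and> y \<bullet> i \<le> 1)" by (simp add: mem_box)
    also have "\<dots> \<longleftrightarrow> (\<forall>i\<in>Basis. i \<noteq> b \<longrightarrow> 0 \<le> y \<bullet> i \<and> y \<bullet> i \<le> 1) \<and> y \<bullet> b = 1"
      using b bb by (auto simp: inner_Basis)
    also have "\<dots> \<longleftrightarrow> y \<in> ?P \<inter> {y. b \<bullet> y = 1}"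
      unfolding Int_iff mem_Collect_eq P ay using \<tau>z[of y] by (auto simp: inner_commute[of b])
    finally show "y \<in> ?P \<inter> {y. b \<bullet> y = 1} \<longleftrightarrow> y \<in> cbox b (b + (One - b))" by simp
  qed
  have D: "?Q \<inter> {y. ?a \<bullet> y = 0} = shear b \<tau> ` cbox 0 (0 + (One - b))"
  proof (rule set_eqI)
    fix y
    have Q0: "z \<in> cbox 0 (0 + (One - b)) \<longleftrightarrow> (\<forall>i\<in>Basis. i \<noteq> b \<longrightarrow> 0 \<le> z \<bullet> i \<and> z \<bullet> i \<le> 1) \<and> z \<bullet> b = 0" for z
      using b oneb by (auto simp: mem_box)
    have "y \<in> shear b \<tau> ` cbox 0 (0 + (One - b)) \<longleftrightarrow> y - (\<tau> \<bullet> y) *\<^sub>R b \<in> cbox 0 (0 + (One - b))"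
      by (rule shear_image_iff[OF \<tau>b])
    also have "\<dots> \<longleftrightarrow> (\<forall>i\<in>Basis. i \<noteq> b \<longrightarrow> 0 \<le> y \<bullet> i \<and> y \<bullet> i \<le> 1) \<and> b \<bullet> y - \<tau> \<bullet> y = 0"
    proof -
      have "(y - (\<tau> \<bullet> y) *\<^sub>R b) \<bullet> i = y \<bullet> i" if "i \<in> Basis" "i \<noteq> b" for i
        using that b by (simp add: inner_diff_left inner_not_same_Basis)
      moreover have "(y - (\<tau> \<bullet> y) *\<^sub>R b) \<bullet> b = b \<bullet> y - \<tau> \<bullet> y" by (simp add: inner_diff_left bb inner_commute[of y])
      ultimately show ?thesis unfolding Q0 by auto
    qed
    also have "\<dots> \<longleftrightarrow> y \<in> ?Q \<inter> {y. ?a \<bullet> y = 0}"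
      unfolding Int_iff mem_Collect_eq Qb ay using \<tau>z[of y] by auto
    finally show "y \<in> ?Q \<inter> {y. ?a \<bullet> y = 0} \<longleftrightarrow> y \<in> shear b \<tau> ` cbox 0 (0 + (One - b))" by simp
  qed
  have P2: "compact ?P" "convex ?P"
    using unit_cube linear_shear
    by (auto intro!: compact_continuous_image linear_continuous_on convex_linear_image simp: linear_conv_bounded_linear)
  have zQ: "0 \<in> ?Q" "b \<in> ?Q" using b by (auto simp: Q inner_Basis)
  have zP: "0 \<in> ?P" "b \<in> ?P" using b by (auto simp: P inner_Basis ay bb \<tau>b)
  have neQ: "?Q \<inter> {y. ?a \<bullet> y \<le> 0} \<noteq> {}" "?Q \<inter> {y. ?a \<bullet> y \<ge> 0} \<noteq> {}" 
    using zQ by (auto intro!: exI[of _ 0] simp: ex_in_conv[symmetric])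
  have neP: "?P \<inter> {y. b \<bullet> y \<le> 1} \<noteq> {}" "?P \<inter> {y. b \<bullet> y \<ge> 1} \<noteq> {}"
  proof -
    have "0 \<in> ?P \<inter> {y. b \<bullet> y \<le> 1}" "b \<in> ?P \<inter> {y. b \<bullet> y \<ge> 1}" using zP bb by (simp_all only: Int_iff mem_Collect_eq inner_zero_right) auto
    then show "?P \<inter> {y. b \<bullet> y \<le> 1} \<noteq> {}" "?P \<inter> {y. b \<bullet> y \<ge> 1} \<noteq> {}" by blast+
  qed
  have Z0: "Z (dconj (?P \<inter> {y. b \<bullet> y = 1}) ?u) = 0" unfolding C by (rule low_dim_side[OF s b])
  interpret S: homogeneous_valuation "\<lambda>v. Z (\<lambda>x. v (shear \<tau> b x))" s by (rule homogeneous_valuation_shear)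
  have neb: "cbox 0 (0 + (One - b)) \<noteq> {}"
    using oneb by (auto simp: box_ne_empty)
  \<comment> \<open>The slice of the cube by \<open>?a \<bullet> y = 0\<close> is in general not
    parallel to the axes; it is the sheared bottom facet.\<close>
  have Z1: "Z (dconj (?Q \<inter> {y. ?a \<bullet> y = 0}) ?u) = 0"
  proof -
    have "dconj (?Q \<inter> {y. ?a \<bullet> y = 0}) ?u = (\<lambda>x. dconj (cbox 0 (0 + (One - b))) (\<lambda>z. shear \<tau> b p \<bullet> z) (shear \<tau> b x))"
      unfolding D by (rule ext, rule dconj_shear[OF compact_cbox neb])
    then show ?thesis using S.low_dim_side[OF s b, of 0 "shear \<tau> b p"] by simp
  qed
  have cQ1: "compact (?Q \<inter> {y. ?a \<bullet> y \<le> 0})" by (intro compact_Int_closed closed_halfspace_le compact_cbox)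
  have tr: "Z (dconj (?P \<inter> {y. b \<bullet> y \<ge> 1}) ?u) = Z (dconj (?Q \<inter> {y. ?a \<bullet> y \<le> 0}) ?u)"
    unfolding B using affine_image[OF cQ1 neQ(1) cu, of 1 b] by (simp add: inner_add_right)
  show ?thesis
    using cut[OF P2 cvu neP] cut[OF unit_cube(1,2) cvu neQ] Z0 Z1 tr unfolding A cube_density_def by simp
qed

text \<open>For \<^term>\<open>p\<close> far out, a suitable shear moves all coordinates of \<^term>\<open>p\<close> far from 0. Near the
origin the support function centered at \<^term>\<open>p\<close> is then affine, since only one vertex is active.\<close>

lemma density_escape:
  assumes s: "s = real DIM('a)"
  obtains \<psi> where "convex_on UNIV \<psi>" "Z \<psi> = cube_density p" "\<And>x. norm x \<le> norm p / (4 * (real DIM('a))\<^sup>2) \<Longrightarrow> \<psi> x = 0"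
proof -
  let ?n = "real DIM('a)" and ?Q = "cbox 0 One :: 'a set"
  have n: "1 \<le> ?n" using DIM_positive[where 'a = 'a] by (simp add: Suc_le_eq)
  obtain b where b: "b \<in> Basis" "norm p \<le> ?n * \<bar>p \<bullet> b\<bar>" using exists_large_coordinate .
  define M where "M = \<bar>p \<bullet> b\<bar>"
  have M: "0 \<le> M" "norm p \<le> ?n * M" using b by (auto simp: M_def)
  \<comment> \<open>Coordinates of \<open>p\<close> above \<open>M / (2 * ?n)\<close> in size are
    left alone. Each smaller one receives \<open>(p \<bullet> b) / ?n\<close>, of size
    \<open>M / ?n\<close>, so at least \<open>M / (2 * ?n)\<close> remains.\<close>
  define \<tau> where "\<tau> = (\<Sum>i\<in>Basis. (if i = b \<or> M / (2 * ?n) < \<bar>p \<bullet> i\<bar> then 0 else 1 / ?n) *\<^sub>R i)"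
  have \<tau>i: "\<tau> \<bullet> i = (if i = b \<or> M / (2 * ?n) < \<bar>p \<bullet> i\<bar> then 0 else 1 / ?n)" if "i \<in> Basis" for i
    using that by (simp add: \<tau>_def)
  define q where "q = shear \<tau> b p"
  have shi: "shear \<tau> b x \<bullet> i = x \<bullet> i + (x \<bullet> b) * (\<tau> \<bullet> i)" for x i
    by (simp add: shear_def inner_add_left inner_commute[of b])
  have q: "M / (2 * ?n) \<le> \<bar>q \<bullet> i\<bar>" if i: "i \<in> Basis" for i
  proof -
    have half: "M / (2 * ?n) \<le> M" 
    proof -
      have "1 \<le> 2 * ?n" using n by linarith
      then have "M * 1 \<le> M * (2 * ?n)" using M(1) by (rule mult_left_mono)
      then show ?thesis using n by (simp add: pos_divide_le_eq)
    qed
    consider "i = b" | "i \<noteq> b" "M / (2 * ?n) < \<bar>p \<bullet> i\<bar>" | "i \<noteq> b" "\<bar>p \<bullet> i\<bar> \<le> M / (2 * ?n)" by linarith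
    then show ?thesis
    proof cases
      case 1 then show ?thesis using half i \<tau>i[OF i] by (simp add: q_def shi M_def)
    next
      case 2 then show ?thesis using \<tau>i[OF i] by (simp add: q_def shi)
    next
      case 3
      then have "q \<bullet> i = p \<bullet> i + (p \<bullet> b) / ?n" using \<tau>i[OF i] by (simp add: q_def shi)
      moreover have "\<bar>(p \<bullet> b) / ?n\<bar> = M / (2 * ?n) + M / (2 * ?n)" by (simp add: M_def abs_divide)
      ultimately show ?thesis using 3(2) by linarith
    qed
  qed
  \<comment> \<open>The vertex at which \<open>(shear \<tau> b x - q) \<bullet> z\<close> is maximal
    when \<open>x\<close> is small compared with \<open>q\<close>.\<close>
  define z where "z = (\<Sum>i\<in>Basis. (if q \<bullet> i < 0 then 1 else 0) *\<^sub>R i :: 'a)"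
  have zi: "z \<bullet> i = (if q \<bullet> i < 0 then 1 else 0)" if "i \<in> Basis" for i using that by (simp add: z_def)
  have zQ: "z \<in> ?Q" using zi by (simp add: mem_box)
  have cq: "continuous_on UNIV (\<lambda>z. q \<bullet> z)" "continuous_on UNIV (\<lambda>z. p \<bullet> z)" by (intro continuous_intros)+
  define \<phi> where "\<phi> = dconj (shear b \<tau> ` ?Q) (\<lambda>z. p \<bullet> z)"
  have \<phi>: "\<phi> x = dconj ?Q (\<lambda>z. q \<bullet> z) (shear \<tau> b x)" for x
    unfolding \<phi>_def q_def by (rule dconj_shear[OF unit_cube(1,3)])
  have c\<phi>: "convex_on UNIV \<phi>"
    unfolding \<phi>[abs_def] by (rule convex_on_shear[OF dconj_convex[OF unit_cube(1,3) cq(1)]])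
  \<comment> \<open>Origin of the radius: \<open>norm p\<close> is at most \<open>?n * M\<close>, so
    \<open>norm x\<close> is at most \<open>M / (4 * ?n)\<close>; sheared coordinates are at most
    twice that, within the lower bound \<open>M / (2 * ?n)\<close> for the coordinates of
    \<open>q\<close>.\<close>
  have loc: "\<phi> x = shear b \<tau> z \<bullet> x - q \<bullet> z" if x: "norm x \<le> norm p / (4 * ?n\<^sup>2)" for x
  proof -
    have "norm x \<le> M / (4 * ?n)"
    proof -
      have "norm p / (4 * ?n\<^sup>2) \<le> (?n * M) / (4 * ?n\<^sup>2)" using M n by (intro divide_right_mono) auto
      also have "\<dots> = M / (4 * ?n)" using n by (simp add: power2_eq_square)
      finally show ?thesis using x by linarith
    qed
    have sx: "\<bar>shear \<tau> b x \<bullet> i\<bar> \<le> M / (2 * ?n)" if i: "i \<in> Basis" for i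
    proof -
      have "\<bar>\<tau> \<bullet> i\<bar> \<le> 1" using \<tau>i[OF i] n by simp
      then have "\<bar>(x \<bullet> b) * (\<tau> \<bullet> i)\<bar> \<le> norm x * 1"
        unfolding abs_mult using Basis_le_norm[OF b(1), of x] by (intro mult_mono) auto
      then have "\<bar>shear \<tau> b x \<bullet> i\<bar> \<le> norm x + norm x"
        unfolding shi using Basis_le_norm[OF i, of x] by linarith
      moreover have "M / (2 * ?n) = M / (4 * ?n) + M / (4 * ?n)" by simp
      ultimately show ?thesis using \<open>norm x \<le> M / (4 * ?n)\<close> by linarith
    qed
    have "dconj ?Q (\<lambda>z. q \<bullet> z) (shear \<tau> b x) = z \<bullet> shear \<tau> b x - q \<bullet> z"
    proof (rule dconj_eqI[OF zQ])
      fix z' assume z': "z' \<in> ?Q"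
      have "(\<Sum>i\<in>Basis. (z' \<bullet> i) * ((shear \<tau> b x - q) \<bullet> i)) \<le> (\<Sum>i\<in>Basis. (z \<bullet> i) * ((shear \<tau> b x - q) \<bullet> i))"
      proof (rule sum_mono)
        fix i :: 'a assume i: "i \<in> Basis"
        have z'i: "0 \<le> z' \<bullet> i" "z' \<bullet> i \<le> 1" using z' i by (auto simp: mem_box)
        show "(z' \<bullet> i) * ((shear \<tau> b x - q) \<bullet> i) \<le> (z \<bullet> i) * ((shear \<tau> b x - q) \<bullet> i)"
        proof (cases "q \<bullet> i < 0")
          case True
          then have "0 \<le> (shear \<tau> b x - q) \<bullet> i" using q[OF i] sx[OF i] by (simp add: inner_diff_left)
          then show ?thesis using True zi[OF i] z'i mult_right_mono[of "z' \<bullet> i" 1] by simp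
        next
          case False
          then have "(shear \<tau> b x - q) \<bullet> i \<le> 0" using q[OF i] sx[OF i] by (simp add: inner_diff_left)
          then show ?thesis using False zi[OF i] z'i by (simp add: mult_nonneg_nonpos)
        qed
      qed
      then have "z' \<bullet> (shear \<tau> b x - q) \<le> z \<bullet> (shear \<tau> b x - q)" by (simp only: euclidean_inner[symmetric])
      then show "z' \<bullet> shear \<tau> b x - q \<bullet> z' \<le> z \<bullet> shear \<tau> b x - q \<bullet> z"
        by (simp add: inner_diff_right inner_commute)
    qed
    then show ?thesis unfolding \<phi> by (simp add: shear_adjoint)
  qed
  define \<psi> where "\<psi> x = \<phi> x + (- shear b \<tau> z) \<bullet> x + q \<bullet> z" for x
  have "convex_on UNIV \<psi>"
  proof (rule convex_on_subgradientI)
    fix x obtain y where "x \<in> subpts \<phi> y" using subgradient_exists[OF c\<phi>] .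
    then have "x \<in> subpts \<psi> (y - shear b \<tau> z)"
      by (auto simp: subpts_def \<psi>_def inner_diff_right inner_diff_left algebra_simps)
    then show "\<exists>y. x \<in> subpts \<psi> y" ..
  qed
  moreover have "Z \<psi> = cube_density p"
  proof -
    have "Z \<psi> = Z \<phi>" unfolding \<psi>_def[abs_def] by (rule affine_invariant[OF c\<phi>])
    also have "\<dots> = cube_density p" unfolding \<phi>_def
      by (rule shear_invariant[OF s b(1)]) (use \<tau>i b(1) n in auto)
    finally show ?thesis .
  qed
  moreover have "\<psi> x = 0" if "norm x \<le> norm p / (4 * ?n\<^sup>2)" for x
    using loc[OF that] by (simp add: \<psi>_def)
  ultimately show ?thesis using that by blast
qed

text \<open>Otherwise nonzero values occur arbitrarily far out. Scaled to value 1 in absolute value,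
  the functions from \<open>density_escape\<close> vanish on growing balls and tend to 0 pointwise,
  whatever the scaling factors are; this contradicts continuity.\<close>

lemma density_compact_support:
  assumes s: "s = real DIM('a)"
  obtains R where "\<And>p. R < norm p \<Longrightarrow> cube_density p = 0"
proof -
  have "\<exists>R. \<forall>p. R < norm p \<longrightarrow> cube_density p = 0"
  proof (rule ccontr)
    assume "\<not> ?thesis"
    then have "\<forall>k::nat. \<exists>p. real k < norm p \<and> cube_density p \<noteq> 0" by blast
    then obtain p where p: "\<And>k::nat. real k < norm (p k)" "\<And>k. cube_density (p k) \<noteq> 0" by metis
    let ?n = "real DIM('a)"
    have n: "1 \<le> ?n" using DIM_positive[where 'a = 'a] by (simp add: Suc_le_eq)
    have "\<exists>\<psi>. convex_on UNIV \<psi> \<and> Z \<psi> = cube_density (p k) \<and> (\<forall>x. norm x \<le> norm (p k) / (4 * ?n\<^sup>2) \<longrightarrow> \<psi> x = 0)" for k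
      using density_escape[OF s] by metis
    then obtain \<psi> where \<psi>: "\<And>k. convex_on UNIV (\<psi> k)" "\<And>k. Z (\<psi> k) = cube_density (p k)"
      "\<And>k x. norm x \<le> norm (p k) / (4 * ?n\<^sup>2) \<Longrightarrow> \<psi> k x = 0" by metis
    define r where "r k = \<bar>cube_density (p k)\<bar> powr (- 1 / s)" for k
    have r: "0 < r k" for k using p(2) by (simp add: r_def)
    have Zr: "\<bar>Z (\<lambda>x. r k * \<psi> k x)\<bar> = 1" for k
    proof -
      have "r k powr s = inverse \<bar>cube_density (p k)\<bar>"
      proof -
        have "- 1 / s * s = - 1" using s n by simp
        then show ?thesis by (simp only: r_def powr_powr) (simp add: powr_minus)
      qed
      then show ?thesis using homogeneous[OF \<psi>(1) r] \<psi>(2) p(2)[of k] by (simp add: abs_mult)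
    qed
    have c0: "convex_on UNIV (\<lambda>x::'a. 0::real)" by (simp add: convex_on_const)
    have "(\<lambda>k. Z (\<lambda>x. r k * \<psi> k x)) \<longlonglongrightarrow> Z (\<lambda>x. 0)"
    proof (rule continuous[OF _ c0])
      show "convex_on UNIV (\<lambda>x. r k * \<psi> k x)" for k using \<psi>(1) r[of k] by (intro convex_on_scale) auto
      fix x :: 'a
      obtain K :: nat where K: "norm x * (4 * ?n\<^sup>2) \<le> real K" using real_arch_simple by blast
      have "r k * \<psi> k x = 0" if "K \<le> k" for k
      proof -
        have "norm x * (4 * ?n\<^sup>2) \<le> norm (p k)" using K p(1)[of k] that by linarith
        then have "norm x \<le> norm (p k) / (4 * ?n\<^sup>2)" using n by (simp add: pos_le_divide_eq)
        then show ?thesis using \<psi>(3) by simp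
      qed
      then show "(\<lambda>k. r k * \<psi> k x) \<longlonglongrightarrow> 0"
        by (intro tendsto_eventually) (auto simp: eventually_sequentially)
    qed
    moreover have "Z (\<lambda>x. 0) = 0"
    proof -
      have "Z (\<lambda>x::'a. 0) = 2 powr s * Z (\<lambda>x. 0)" using homogeneous[OF c0, of 2] by simp
      moreover have "1 < 2 powr s" "s \<noteq> 0" using s n powr_less_mono[of 0 s 2] by simp_all
      ultimately show ?thesis by auto
    qed
    ultimately have "(\<lambda>k. \<bar>Z (\<lambda>x. r k * \<psi> k x)\<bar>) \<longlonglongrightarrow> 0" by (simp add: tendsto_rabs_zero)
    then show False by (simp add: Zr LIMSEQ_const_iff)
  qed
  then show ?thesis using that by blast
qed

end

section \<open>Integral representation in degree equal to the dimension\<close>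

lemma subpts_cube_support:
  assumes "x \<in> subpts (dconj (cbox 0 One) (\<lambda>z. p \<bullet> z)) y"
  shows "y \<in> cbox 0 (One :: 'a::euclidean_space)"
proof -
  let ?v = "dconj (cbox 0 One) (\<lambda>z::'a. p \<bullet> z)"
  have c: "continuous_on UNIV (\<lambda>z. p \<bullet> z)" by (intro continuous_intros)
  have ne: "cbox 0 One \<noteq> ({} :: 'a set)" by (simp add: box_ne_empty)
  \<comment> \<open>Increments of the conjugate in direction \<open>h\<close> never exceed the
    support function of the cube at \<open>h\<close>, and testing the axis directions and their
    negatives recognizes membership in a cube.\<close>
  have step: "\<exists>z\<in>cbox 0 One. y \<bullet> h \<le> z \<bullet> h" for h
  proof -
    obtain z where z: "z \<in> cbox 0 One" "?v (x + h) = z \<bullet> (x + h) - p \<bullet> z"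
      using dconj_attained[OF compact_cbox ne c] by metis
    have "?v x + y \<bullet> h \<le> ?v (x + h)" using subptsD[OF assms, of "x + h"] by simp
    moreover have "z \<bullet> x - p \<bullet> z \<le> ?v x" by (rule dconj_ge[OF compact_cbox c z(1)])
    ultimately have "y \<bullet> h \<le> z \<bullet> h" using z(2) by (simp add: inner_add_right)
    then show ?thesis using z(1) by blast
  qed
  have "0 \<le> y \<bullet> i \<and> y \<bullet> i \<le> 1" if i: "i \<in> Basis" for i
  proof -
    obtain z1 z2 where "z1 \<in> cbox 0 One" "y \<bullet> i \<le> z1 \<bullet> i" "z2 \<in> cbox 0 One" "y \<bullet> (- i) \<le> z2 \<bullet> (- i)"
      using step by blast
    moreover from this have "z1 \<bullet> i \<le> 1" "0 \<le> z2 \<bullet> i" using i by (auto simp: mem_box)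
    ultimately show ?thesis by simp
  qed
  then show ?thesis by (simp add: mem_box)
qed

text \<open>For \<open>y\<close> in the interior, the tilted function grows in every axis direction
  away from \<open>p\<close>; pushing \<open>y\<close> to the two faces orthogonal to
  \<open>i\<close> makes this precise.\<close>

lemma subpts_cube_interior:
  assumes "y \<in> box 0 (One :: 'a::euclidean_space)"
  shows "subpts (dconj (cbox 0 One) (\<lambda>z. p \<bullet> z)) y = {p}"
proof -
  let ?v = "dconj (cbox 0 One) (\<lambda>z::'a. p \<bullet> z)"
  have c: "continuous_on UNIV (\<lambda>z. p \<bullet> z)" by (intro continuous_intros)
  have v: "z \<bullet> (x - p) \<le> ?v x" if "z \<in> cbox 0 One" for z x
    using dconj_ge[OF compact_cbox c that, of x] by (simp add: inner_diff_right inner_commute)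
  have vp: "?v p = 0"
  proof -
    have "?v p = 0 \<bullet> p - p \<bullet> 0" by (rule dconj_eqI) (simp_all add: mem_box inner_commute[of p])
    then show ?thesis by simp
  qed
  have yc: "y \<in> cbox 0 One" using assms box_subset_cbox by blast
  have "p \<in> subpts ?v y"
    by (rule subptsI) (use v[OF yc] vp in auto)
  moreover have "x = p" if x: "x \<in> subpts ?v y" for x
  proof (rule euclidean_eqI)
    fix i :: 'a assume i: "i \<in> Basis"
    have ui: "0 < y \<bullet> i" "y \<bullet> i < 1" using assms i by (auto simp: mem_box)
    have le: "?v x + y \<bullet> (p - x) \<le> 0" using subptsD[OF x, of p] vp by simp
    have eq: "(y + t *\<^sub>R i) \<bullet> (x - p) = y \<bullet> (x - p) + t * (i \<bullet> (x - p))" for t by (simp add: inner_add_left)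
    have flip: "y \<bullet> (p - x) = - (y \<bullet> (x - p))" by (simp add: inner_diff_right)
    have mem: "y + t *\<^sub>R i \<in> cbox 0 One" if "0 \<le> y \<bullet> i + t" "y \<bullet> i + t \<le> 1" for t
    proof -
      have "0 \<le> (y + t *\<^sub>R i) \<bullet> j \<and> (y + t *\<^sub>R i) \<bullet> j \<le> 1" if j: "j \<in> Basis" for j
        using yc that i \<open>0 \<le> y \<bullet> i + t\<close> \<open>y \<bullet> i + t \<le> 1\<close> by (cases "j = i") (auto simp: mem_box inner_add_left inner_not_same_Basis)
      then show ?thesis by (simp add: mem_box)
    qed
    have "(1 - y \<bullet> i) * (i \<bullet> (x - p)) \<le> 0"
      using v[OF mem[of "1 - y \<bullet> i"], of x] le ui unfolding eq flip by simp
    then have 1: "i \<bullet> (x - p) \<le> 0" using ui by (simp add: mult_le_0_iff)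
    have "(- (y \<bullet> i)) * (i \<bullet> (x - p)) \<le> 0"
      using v[OF mem[of "- (y \<bullet> i)"], of x] le ui unfolding eq flip by simp
    then have "0 \<le> i \<bullet> (x - p)" using ui by (simp add: zero_le_mult_iff)
    then show "x \<bullet> i = p \<bullet> i" using 1 by (simp add: inner_diff_right inner_commute)
  qed
  ultimately show ?thesis by blast
qed

text \<open>The measure of this function is Lebesgue measure on the unit cube, placed over the
  single point \<open>p\<close>; its total mass 1 lets an integral recover the density at
  \<open>p\<close>.\<close>

lemma integral_gradval_cube:
  fixes f :: "'a::euclidean_space \<times> 'a \<Rightarrow> 'b::euclidean_space"
  assumes f: "f \<in> borel_measurable borel" and f': "\<And>x y. f (x, y) = h x"
  shows "integral\<^sup>L lborel (gradval (dconj (cbox 0 One) (\<lambda>z. p \<bullet> z)) f) = h p"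
proof -
  let ?v = "dconj (cbox 0 One) (\<lambda>z::'a. p \<bullet> z)"
  have c: "continuous_on UNIV (\<lambda>z. p \<bullet> z)" by (intro continuous_intros)
  have ne: "cbox 0 One \<noteq> ({} :: 'a set)" by (simp add: box_ne_empty)
  have cv: "convex_on UNIV ?v" by (rule dconj_convex[OF compact_cbox ne c])
  have "AE y in lebesgue. y \<notin> cbox 0 One - box 0 (One :: 'a)"
    using negligible_frontier_interval[of 0 "One :: 'a"] by (simp only: negligible_iff_null_sets AE_not_in)
  then have ae: "AE y in lborel. y \<notin> cbox 0 One - box 0 (One :: 'a)" by (simp add: AE_completion_iff)
  have "AE y in lborel. gradval ?v f y = indicator (box 0 One) y *\<^sub>R h p"
    using ae
  proof eventually_elim
    case (elim y)
    show ?case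
    proof (cases "y \<in> box 0 One")
      case True
      then show ?thesis using gradval_singleton[OF subpts_cube_interior[OF True], where f = f] f' by simp
    next
      case False
      then have "y \<notin> cbox 0 One" using elim by blast
      then have "subpts ?v y = {}" using subpts_cube_support by blast
      then show ?thesis using False by (simp add: gradval_empty)
    qed
  qed
  then have "integral\<^sup>L lborel (gradval ?v f) = integral\<^sup>L lborel (\<lambda>y::'a. indicator (box 0 One) y *\<^sub>R h p)"
  proof (intro integral_cong_AE)
    show "gradval ?v f \<in> borel_measurable lborel" by (rule gradval_measurable[OF cv f])
  qed auto
  also have "\<dots> = h p" by simp
  finally show ?thesis .
qed

lemma homogeneous_valuation_integral:
  fixes f :: "'a::euclidean_space \<times> 'a \<Rightarrow> real"
  assumes f: "continuous_on UNIV f" and K: "compact K" "\<And>x y. x \<notin> K \<Longrightarrow> f (x, y) = 0"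
    and inv: "\<And>x y a. f (x, y + a) = f (x, y)"
  shows "homogeneous_valuation (\<lambda>v. integral\<^sup>L lborel (gradval v f)) (real DIM('a))"
proof
  have fb: "f \<in> borel_measurable borel" using f by (rule borel_measurable_continuous_onI)
  fix v :: "'a \<Rightarrow> real" and a c
  assume v: "convex_on UNIV v"
  show "integral\<^sup>L lborel (gradval (\<lambda>x. v x + a \<bullet> x + c) f) = integral\<^sup>L lborel (gradval v f)"
    unfolding gradval_add_const using integral_gradval_add_linear[OF v fb, of a] fb by (simp add: inv)
next
  have fb: "f \<in> borel_measurable borel" using f by (rule borel_measurable_continuous_onI)
  fix v :: "'a \<Rightarrow> real" and r :: real
  assume v: "convex_on UNIV v" and r: "0 < r"
  have "f (x, r *\<^sub>R y) = f (x, y)" for x y using inv[of x y "r *\<^sub>R y - y"] by simp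
  then show "integral\<^sup>L lborel (gradval (\<lambda>x. r * v x) f) = r powr real DIM('a) * integral\<^sup>L lborel (gradval v f)"
    using integral_gradval_scale[OF v fb r] r by (simp add: powr_realpow)
qed (use gradval_seq_integral(2)[OF _ _ _ f K] integral_gradval_valuation[OF _ _ _ _ f K] in auto)

lemma homogeneous_valuation_diff:
  assumes "homogeneous_valuation Z s" "homogeneous_valuation Z' s"
  shows "homogeneous_valuation (\<lambda>v. Z v - Z' v) s"
proof -
  interpret A: homogeneous_valuation Z s by fact
  interpret B: homogeneous_valuation Z' s by fact
  show ?thesis
  proof
    fix v w :: "'a \<Rightarrow> real"
    assume "convex_on UNIV v" "convex_on UNIV w" "convex_on UNIV (\<lambda>x. max (v x) (w x))" "convex_on UNIV (\<lambda>x. min (v x) (w x))"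
    from A.valuation[OF this] B.valuation[OF this]
    show "Z (\<lambda>x. max (v x) (w x)) - Z' (\<lambda>x. max (v x) (w x)) + (Z (\<lambda>x. min (v x) (w x)) - Z' (\<lambda>x. min (v x) (w x)))
      = Z v - Z' v + (Z w - Z' w)" by simp
  qed (auto intro!: tendsto_diff A.continuous B.continuous simp: A.affine_invariant B.affine_invariant
      A.homogeneous B.homogeneous right_diff_distrib)
qed

context homogeneous_valuation
begin

text \<open>By \<open>integral_gradval_cube\<close> the integral and \<open>Z\<close> agree on all
  unit cube functions, so their difference satisfies the limit case \<open>m = s\<close> of
  \<open>vanishes\<close>.\<close>

theorem integral_representation:
  assumes s: "s = real DIM('a)"
  obtains R where "\<And>p. R < norm p \<Longrightarrow> cube_density p = 0"
    and "\<And>v. convex_on UNIV v \<Longrightarrow> Z v = integral\<^sup>L lborel (gradval v (\<lambda>(x, y). cube_density x))"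
proof -
  obtain R where R: "\<And>p. R < norm p \<Longrightarrow> cube_density p = 0" using density_compact_support[OF s] by blast
  let ?f = "\<lambda>(x, y::'a). cube_density x"
  have f: "continuous_on UNIV ?f"
    unfolding case_prod_beta by (rule continuous_on_compose2[OF density_continuous]) (auto intro: continuous_intros)
  have K: "compact (cball (0::'a) R)" "\<And>x y. x \<notin> cball 0 R \<Longrightarrow> ?f (x, y) = 0" using R by auto
  have I: "homogeneous_valuation (\<lambda>v. integral\<^sup>L lborel (gradval v ?f)) s"
    unfolding s by (rule homogeneous_valuation_integral[OF f K]) auto
  interpret D: homogeneous_valuation "\<lambda>v. Z v - integral\<^sup>L lborel (gradval v ?f)" s
    by (rule homogeneous_valuation_diff[OF _ I]) unfold_locales
  have "Z v = integral\<^sup>L lborel (gradval v ?f)" if v: "convex_on UNIV v" for v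
  proof -
    have "integral\<^sup>L lborel (gradval (dconj (cbox 0 One) (\<lambda>z. p \<bullet> z)) ?f) = cube_density p" for p
      by (rule integral_gradval_cube) (use f in \<open>auto intro: borel_measurable_continuous_onI\<close>)
    then have "Z v - integral\<^sup>L lborel (gradval v ?f) = 0"
      by (intro D.vanishes v) (auto simp: s cube_density_def)
    then show ?thesis by simp
  qed
  then show ?thesis using that R by blast
qed

end

subsection \<open>Hessian integrals\<close>

lemma Cc_support:
  assumes "\<zeta> \<in> Cc"
  obtains K where "compact K" "\<And>x. x \<notin> K \<Longrightarrow> \<zeta> x = 0" "continuous_on UNIV \<zeta>"
proof -
  have "\<zeta> x = 0" if "x \<notin> closure {x. \<zeta> x \<noteq> 0}" for x
  proof (rule ccontr)
    assume "\<zeta> x \<noteq> 0"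
    then have "x \<in> {x. \<zeta> x \<noteq> 0}" by simp
    from subsetD[OF closure_subset this] show False using that by contradiction
  qed
  moreover have "compact (closure {x. \<zeta> x \<noteq> 0})" "continuous_on UNIV \<zeta>" using assms by (simp_all add: Cc_def)
  ultimately show ?thesis by (intro that[of "closure {x. \<zeta> x \<noteq> 0}"])
qed

lemma CcI:
  fixes \<zeta> :: "real^'n::finite \<Rightarrow> real"
  assumes "continuous_on UNIV \<zeta>" "\<And>x. R < norm x \<Longrightarrow> \<zeta> x = 0"
  shows "\<zeta> \<in> Cc"
proof -
  have "{x. \<zeta> x \<noteq> 0} \<subseteq> cball 0 R" using assms(2) by (force simp: not_less[symmetric])
  then have "bounded {x. \<zeta> x \<noteq> 0}" using bounded_cball bounded_subset by blast
  then show ?thesis using assms(1) by (simp add: Cc_def compact_closure)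
qed

text \<open>Stated for general \<open>h\<close> to serve the vector integrand \<open>y\<close>, its
  translate \<open>y + a\<close> and the scalar integrand 1.\<close>

lemma Cc_integrand:
  fixes \<zeta> :: "real^'n::finite \<Rightarrow> real" and h :: "real^'n \<Rightarrow> 'b::euclidean_space"
  assumes "\<zeta> \<in> Cc" "continuous_on UNIV h"
  obtains K where "compact K" "\<And>x y. x \<notin> K \<Longrightarrow> (\<lambda>(x, y). \<zeta> x *\<^sub>R h y) (x, y) = 0"
    "continuous_on UNIV (\<lambda>(x, y). \<zeta> x *\<^sub>R h y)"
proof -
  obtain K where K: "compact K" "\<And>x. x \<notin> K \<Longrightarrow> \<zeta> x = 0" "continuous_on UNIV \<zeta>" 
    using Cc_support[OF assms(1)] by blast
  have "continuous_on UNIV (\<lambda>(x, y). \<zeta> x *\<^sub>R h y)"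
    unfolding case_prod_beta
    by (intro continuous_on_scaleR continuous_on_compose2[OF K(3)] continuous_on_compose2[OF assms(2)] continuous_on_fst continuous_on_snd continuous_on_id) auto
  then show ?thesis using that[of K] K by simp
qed

lemma hess_vec_eq:
  fixes v :: "'n::finite cvfun"
  assumes "\<zeta> \<in> Cc" "convex_on UNIV v"
  shows "hess_vec \<zeta> v = integral\<^sup>L lborel (gradval v (\<lambda>(x, y). \<zeta> x *\<^sub>R y))"
proof -
  obtain K where "continuous_on UNIV (\<lambda>(x, y :: real^'n). \<zeta> x *\<^sub>R y)"
    using Cc_integrand[OF assms(1) continuous_on_id] by metis
  from borel_measurable_continuous_onI[OF this] show ?thesis
    unfolding hess_vec_def Theta0_eq_MA[OF assms(2)] by (rule integral_MA[OF assms(2)])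
qed

text \<open>The associated scalar valuation, which plays the role of \<open>z\<^sup>0\<close>.\<close>

definition hess_mass :: "(real^'n \<Rightarrow> real) \<Rightarrow> ('n::finite) cvfun \<Rightarrow> real" where
  "hess_mass \<zeta> v = integral\<^sup>L lborel (gradval v (\<lambda>(x, y). \<zeta> x))"

lemma Cc_integrand_mass:
  fixes \<zeta> :: "real^'n::finite \<Rightarrow> real"
  assumes "\<zeta> \<in> Cc"
  obtains K where "compact K" "\<And>x y::real^'n. x \<notin> K \<Longrightarrow> (\<lambda>(x, y). \<zeta> x) (x, y) = 0"
    "continuous_on UNIV (\<lambda>(x, y::real^'n). \<zeta> x)"
  using Cc_integrand[OF assms continuous_on_const[of UNIV "1::real"]] by auto

lemma hess_vec_continuous:
  assumes "\<zeta> \<in> Cc"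
  shows "val_continuous (hess_vec \<zeta> :: ('n::finite) cvfun \<Rightarrow> _)"
  unfolding val_continuous_def
proof (intro allI impI)
  fix vs :: "nat \<Rightarrow> 'n cvfun" and v
  assume *: "\<forall>k. vs k \<in> Conv" "v \<in> Conv" "pw_conv vs v"
  obtain K where K: "compact K" "\<And>x y. x \<notin> K \<Longrightarrow> (\<lambda>(x, y :: real^'n). \<zeta> x *\<^sub>R y) (x, y) = 0"
    "continuous_on UNIV (\<lambda>(x, y :: real^'n). \<zeta> x *\<^sub>R y)"
    using Cc_integrand[OF assms continuous_on_id] by metis
  have cv: "convex_on UNIV (vs k)" "convex_on UNIV v" for k using * by (auto simp: Conv_def)
  show "(\<lambda>k. hess_vec \<zeta> (vs k)) \<longlonglongrightarrow> hess_vec \<zeta> v"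
    unfolding hess_vec_eq[OF assms cv(1)] hess_vec_eq[OF assms cv(2)]
    by (rule gradval_seq_integral(2)[OF cv _ K(3) K(1) K(2)]) (use *(3) in \<open>auto simp: pw_conv_def\<close>)
qed

lemma hess_vec_valuation:
  assumes "\<zeta> \<in> Cc"
  shows "is_valuation (hess_vec \<zeta> :: ('n::finite) cvfun \<Rightarrow> _)"
  unfolding is_valuation_def Conv_def mem_Collect_eq
proof (intro allI impI)
  fix v w :: "'n cvfun"
  assume cv: "convex_on UNIV v" "convex_on UNIV w" "convex_on UNIV (\<lambda>x. max (v x) (w x))" "convex_on UNIV (\<lambda>x. min (v x) (w x))"
  obtain K where K: "compact K" "\<And>x y. x \<notin> K \<Longrightarrow> (\<lambda>(x, y :: real^'n). \<zeta> x *\<^sub>R y) (x, y) = 0"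
    "continuous_on UNIV (\<lambda>(x, y :: real^'n). \<zeta> x *\<^sub>R y)"
    using Cc_integrand[OF assms continuous_on_id] by metis
  show "hess_vec \<zeta> (\<lambda>x. max (v x) (w x)) + hess_vec \<zeta> (\<lambda>x. min (v x) (w x)) = hess_vec \<zeta> v + hess_vec \<zeta> w"
    unfolding cv[THEN hess_vec_eq[OF assms]] by (rule integral_gradval_valuation[OF cv K(3) K(1) K(2)])
qed

lemma convex_on_add_linear: 
  fixes v :: "'a::euclidean_space \<Rightarrow> real"
  assumes "convex_on UNIV v"
  shows "convex_on UNIV (\<lambda>t. v t + a \<bullet> t + c)"
proof (rule convex_on_subgradientI)
  fix x obtain y where "x \<in> subpts v y" using subgradient_exists[OF assms] .
  then have "x \<in> subpts (\<lambda>t. v t + a \<bullet> t + c) (y + a)"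
    by (auto simp: subpts_def inner_diff_right inner_add_left algebra_simps)
  then show "\<exists>y. x \<in> subpts (\<lambda>t. v t + a \<bullet> t + c) y" ..
qed

text \<open>Adding \<open>a \<bullet> t\<close> shifts \<open>y\<close> by \<open>a\<close>; the
  extra term identifies \<open>hess_mass\<close> as the function \<open>z0\<close> of the Hessian
  integral.\<close>

lemma hess_vec_add_linear:
  fixes v :: "'n::finite cvfun"
  assumes \<zeta>: "\<zeta> \<in> Cc" and v: "convex_on UNIV v"
  shows "hess_vec \<zeta> (\<lambda>t. v t + a \<bullet> t) = hess_vec \<zeta> v + hess_mass \<zeta> v *\<^sub>R a"
proof -
  obtain K where K: "compact K" "\<And>x y. x \<notin> K \<Longrightarrow> (\<lambda>(x, y :: real^'n). \<zeta> x *\<^sub>R y) (x, y) = 0"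
    "continuous_on UNIV (\<lambda>(x, y :: real^'n). \<zeta> x *\<^sub>R y)"
    using Cc_integrand[OF \<zeta> continuous_on_id] by metis
  obtain K' where K': "compact K'" "\<And>x y::real^'n. x \<notin> K' \<Longrightarrow> (\<lambda>(x, y). \<zeta> x) (x, y) = 0"
    "continuous_on UNIV (\<lambda>(x, y::real^'n). \<zeta> x)" using Cc_integrand_mass[OF \<zeta>] by metis
  have cv: "convex_on UNIV (\<lambda>t. v t + a \<bullet> t)" using convex_on_add_linear[OF v, of a 0] by simp
  have c: "continuous_on UNIV (\<lambda>(x, y). \<zeta> x *\<^sub>R (y + a))"
    using Cc_integrand[OF \<zeta>, of "\<lambda>y. y + a"] continuous_on_add[OF continuous_on_id continuous_on_const] by metis
  have "hess_vec \<zeta> (\<lambda>t. v t + a \<bullet> t) = integral\<^sup>L lborel (gradval v (\<lambda>(x, y). \<zeta> x *\<^sub>R (y + a)))"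
    unfolding hess_vec_eq[OF \<zeta> cv]
    using integral_gradval_add_linear[OF v borel_measurable_continuous_onI[OF K(3)], of a] borel_measurable_continuous_onI[OF c]
    by simp
  also have "gradval v (\<lambda>(x, y). \<zeta> x *\<^sub>R (y + a)) = (\<lambda>y. gradval v (\<lambda>(x, y). \<zeta> x *\<^sub>R y) y + gradval v (\<lambda>(x, y). \<zeta> x) y *\<^sub>R a)"
    by (auto simp: fun_eq_iff gradval_def scaleR_add_right)
  also have "integral\<^sup>L lborel \<dots> = hess_vec \<zeta> v + hess_mass \<zeta> v *\<^sub>R a"
    unfolding hess_vec_eq[OF \<zeta> v] hess_mass_def
    using gradval_integrable[OF v K(3) K(1) K(2)] gradval_integrable[OF v K'(3) K'(1) K'(2)] by simp
  finally show ?thesis .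
qed

lemma hess_vec_vert: 
  assumes "\<zeta> \<in> Cc"
  shows "vert_transl_inv (hess_vec \<zeta> :: ('n::finite) cvfun \<Rightarrow> _)"
  unfolding vert_transl_inv_def
proof (intro ballI allI)
  fix v :: "'n cvfun" and c assume "v \<in> Conv"
  then have v: "convex_on UNIV v" "convex_on UNIV (\<lambda>t. v t + c)"
    using convex_on_add_linear[of v 0 c] by (auto simp: Conv_def)
  show "hess_vec \<zeta> (\<lambda>t. v t + c) = hess_vec \<zeta> v"
    unfolding v[THEN hess_vec_eq[OF assms]] gradval_add_const ..
qed

text \<open>Lebesgue measure contributes the dimension, the factor \<open>y\<close> one more
  degree.\<close>

lemma hess_vec_homogeneous:
  assumes \<zeta>: "\<zeta> \<in> Cc"
  shows "homogeneous_deg (real CARD('n) + 1) (hess_vec \<zeta> :: ('n::finite) cvfun \<Rightarrow> _)"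
  unfolding homogeneous_deg_def
proof (intro ballI allI impI)
  fix v :: "'n cvfun" and r :: real assume "v \<in> Conv" and r: "0 < r"
  then have v: "convex_on UNIV v" "convex_on UNIV (\<lambda>t. r * v t)" by (auto simp: Conv_def intro: convex_on_scale)
  obtain K where K: "continuous_on UNIV (\<lambda>(x, y :: real^'n). \<zeta> x *\<^sub>R y)"
    using Cc_integrand[OF \<zeta> continuous_on_id] by metis
  have "hess_vec \<zeta> (\<lambda>t. r * v t) = r ^ CARD('n) *\<^sub>R integral\<^sup>L lborel (gradval v (\<lambda>(x, y). \<zeta> x *\<^sub>R (r *\<^sub>R y)))"
    unfolding hess_vec_eq[OF \<zeta> v(2)] using integral_gradval_scale[OF v(1) borel_measurable_continuous_onI[OF K] r] by simp
  also have "gradval v (\<lambda>(x, y). \<zeta> x *\<^sub>R (r *\<^sub>R y)) = (\<lambda>y. r *\<^sub>R gradval v (\<lambda>(x, y). \<zeta> x *\<^sub>R y) y)"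
    by (auto simp: fun_eq_iff gradval_def)
  also have "r ^ CARD('n) *\<^sub>R integral\<^sup>L lborel \<dots> = (r ^ CARD('n) * r) *\<^sub>R hess_vec \<zeta> v"
    unfolding hess_vec_eq[OF \<zeta> v(1)] by simp
  also have "r ^ CARD('n) * r = r powr (real CARD('n) + 1)" using r by (simp add: powr_add powr_realpow)
  finally show "hess_vec \<zeta> (\<lambda>t. r * v t) = r powr (real CARD('n) + 1) *\<^sub>R hess_vec \<zeta> v" .
qed

text \<open>The orthogonal substitution is stated for real integrands, so the identity is proved
  coordinate by coordinate, with \<open>A\<close> pulled out of the integral by linearity.\<close>

lemma hess_vec_orthogonal:
  fixes v :: "'n::finite cvfun"
  assumes \<zeta>: "\<zeta> \<in> Cc" and v: "convex_on UNIV v" and A: "orthogonal_matrix A"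
    and inv: "\<And>x. \<zeta> (A *v x) = \<zeta> x"
  shows "hess_vec \<zeta> (\<lambda>t. v (transpose A *v t)) = A *v hess_vec \<zeta> v"
proof -
  obtain K where K: "compact K" "\<And>x y. x \<notin> K \<Longrightarrow> (\<lambda>(x, y :: real^'n). \<zeta> x *\<^sub>R y) (x, y) = 0"
    "continuous_on UNIV (\<lambda>(x, y :: real^'n). \<zeta> x *\<^sub>R y)"
    using Cc_integrand[OF \<zeta> continuous_on_id] by metis
  have bA: "bounded_linear (\<lambda>y. A *v y)" by (rule matrix_vector_mul_bounded_linear)
  have int: "integrable lborel (gradval v (\<lambda>(x, y). \<zeta> x *\<^sub>R y))" by (rule gradval_integrable[OF v K(3) K(1) K(2)])
  have cmp: "(integral\<^sup>L lborel g) $ i = integral\<^sup>L lborel (\<lambda>y. g y $ i)" if "integrable lborel g" for g :: "real^'n \<Rightarrow> real^'n" and i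
    using integral_bounded_linear[OF bounded_linear_vec_nth that] by simp
  have cv: "convex_on UNIV (\<lambda>t. v (transpose A *v t))"
    by (rule integral_gradval_orthogonal(1)[OF v A continuous_on_const[of _ 0] compact_empty]) auto
  have int': "integrable lborel (gradval (\<lambda>t. v (transpose A *v t)) (\<lambda>(x, y). \<zeta> x *\<^sub>R y))"
    by (rule gradval_integrable[OF cv K(3) K(1) K(2)])
  show ?thesis
  proof (rule vec_eq_iff[THEN iffD2], rule allI)
    fix i :: 'n
    have c: "continuous_on UNIV (\<lambda>(x, y). \<zeta> x * y $ i)" and K2: "\<And>x y. x \<notin> K \<Longrightarrow> (\<lambda>(x, y). \<zeta> x * y $ i) (x, y) = 0"
    proof -
      have "continuous_on UNIV (\<lambda>p. (case p of (x, y::real^'n) \<Rightarrow> \<zeta> x *\<^sub>R y) $ i)" 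
        using K(3) by (intro continuous_intros)
      then show "continuous_on UNIV (\<lambda>(x, y). \<zeta> x * y $ i)" by (simp add: case_prod_beta)
      show "(\<lambda>(x, y). \<zeta> x * y $ i) (x, y) = 0" if "x \<notin> K" for x y :: "real^'n"
        using K(2)[OF that, of y] by (auto simp: vec_eq_iff)
    qed
    have "hess_vec \<zeta> (\<lambda>t. v (transpose A *v t)) $ i = integral\<^sup>L lborel (gradval (\<lambda>t. v (transpose A *v t)) (\<lambda>(x, y). \<zeta> x * y $ i))"
      unfolding hess_vec_eq[OF \<zeta> cv] cmp[OF int']
      by (intro Bochner_Integration.integral_cong) (auto simp: gradval_def)
    also have "\<dots> = integral\<^sup>L lborel (gradval v (\<lambda>(x, y). \<zeta> x * (A *v y) $ i))"
      using integral_gradval_orthogonal(2)[OF v A c K(1) K2] inv by simp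
    also have "\<dots> = integral\<^sup>L lborel (\<lambda>y. (A *v gradval v (\<lambda>(x, y). \<zeta> x *\<^sub>R y) y) $ i)"
      by (intro Bochner_Integration.integral_cong) (auto simp: gradval_def matrix_vector_mult_scaleR)
    also have "\<dots> = integral\<^sup>L lborel (\<lambda>y. A *v gradval v (\<lambda>(x, y). \<zeta> x *\<^sub>R y) y) $ i"
      by (rule cmp[symmetric]) (rule integrable_bounded_linear[OF bA int])
    also have "\<dots> = (A *v hess_vec \<zeta> v) $ i"
      unfolding hess_vec_eq[OF \<zeta> v] integral_bounded_linear[OF bA int] ..
    finally show "hess_vec \<zeta> (\<lambda>t. v (transpose A *v t)) $ i = (A *v hess_vec \<zeta> v) $ i" .
  qed
qed

subsection \<open>Classification\<close>

lemma hess_mass_cube: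
  fixes \<zeta> :: "real^'n::finite \<Rightarrow> real"
  assumes "\<zeta> \<in> Cc"
  shows "hess_mass \<zeta> (dconj (cbox 0 One) (\<lambda>z. p \<bullet> z)) = \<zeta> p"
proof -
  obtain K where K: "continuous_on UNIV (\<lambda>(x, y :: real^'n). \<zeta> x)" using Cc_integrand_mass[OF assms] by metis
  show ?thesis
    unfolding hess_mass_def by (rule integral_gradval_cube[OF borel_measurable_continuous_onI[OF K]]) simp
qed

lemma hess_vec_representation:
  fixes z :: "('n::finite) cvfun \<Rightarrow> real^'n"
  assumes cont: "val_continuous z" and val: "is_valuation z" and cov: "dually_transl_cov z"
    and vert: "vert_transl_inv z" and hom: "homogeneous_deg (real CARD('n) + 1) z"
  shows "\<exists>\<zeta>\<in>Cc. \<forall>v\<in>Conv. z v = hess_vec \<zeta> v"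
proof -
  let ?n = "real CARD('n)"
  obtain z0 where z0: "\<And>v x. convex_on UNIV v \<Longrightarrow> z (\<lambda>t. v t + x \<bullet> t) = z v + z0 v *\<^sub>R x"
    using cov by (auto simp: dually_transl_cov_def Conv_def)
  have contD: "(\<lambda>k. z (vs k)) \<longlonglongrightarrow> z v" if "\<And>k. convex_on UNIV (vs k)" "convex_on UNIV v" "\<And>x. (\<lambda>k. vs k x) \<longlonglongrightarrow> v x" for vs v
    using cont that by (auto simp: val_continuous_def Conv_def pw_conv_def)
  have valD: "z (\<lambda>x. max (v x) (w x)) + z (\<lambda>x. min (v x) (w x)) = z v + z w"
    if "convex_on UNIV v" "convex_on UNIV w" "convex_on UNIV (\<lambda>x. max (v x) (w x))" "convex_on UNIV (\<lambda>x. min (v x) (w x))" for v w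
    using val that by (simp add: is_valuation_def Conv_def)
  have vertD: "z (\<lambda>t. v t + c) = z v" if "convex_on UNIV v" for v c
    using vert that by (simp add: vert_transl_inv_def Conv_def)
  have homD: "z (\<lambda>t. r * v t) = r powr (?n + 1) *\<^sub>R z v" if "convex_on UNIV v" "0 < r" for v r
    using hom that by (simp add: homogeneous_deg_def Conv_def)
  have lin: "convex_on UNIV (\<lambda>t. v t + x \<bullet> t)" if "convex_on UNIV v" for v and x :: "real^'n"
    using convex_on_add_linear[OF that, of x 0] by simp
  obtain i :: 'n where True by simp
  define e where "e = axis i (1::real)"
  have e: "e \<noteq> 0" by (simp add: e_def axis_eq_0_iff)
  have ee: "e \<bullet> e = 1" by (simp add: e_def inner_axis_axis)
  \<comment> \<open>\<open>z0\<close> is only given to exist. Testing with a unit vector expresses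
    it through \<open>z\<close> on convex functions, which is how it inherits continuity and the
    valuation property.\<close>
  have z0e: "z0 v = (z (\<lambda>t. v t + e \<bullet> t) - z v) \<bullet> e" if "convex_on UNIV v" for v
    using z0[OF that, of e] by (simp add: ee)
  have Z0: "homogeneous_valuation z0 (real DIM(real^'n))"
  proof
    fix vs :: "nat \<Rightarrow> 'n cvfun" and v
    assume *: "\<And>k. convex_on UNIV (vs k)" "convex_on UNIV v" "\<And>x. (\<lambda>k. vs k x) \<longlonglongrightarrow> v x"
    show "(\<lambda>k. z0 (vs k)) \<longlonglongrightarrow> z0 v"
      unfolding z0e[OF *(1)] z0e[OF *(2)]
      by (intro tendsto_intros contD lin *)
  next
    fix v w :: "'n cvfun"
    assume *: "convex_on UNIV v" "convex_on UNIV w" "convex_on UNIV (\<lambda>x. max (v x) (w x))" "convex_on UNIV (\<lambda>x. min (v x) (w x))"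
    have M: "(\<lambda>t. max (v t) (w t) + e \<bullet> t) = (\<lambda>t. max (v t + e \<bullet> t) (w t + e \<bullet> t))"
      and m: "(\<lambda>t. min (v t) (w t) + e \<bullet> t) = (\<lambda>t. min (v t + e \<bullet> t) (w t + e \<bullet> t))" by (auto simp: fun_eq_iff)
    have "z (\<lambda>t. max (v t) (w t) + e \<bullet> t) + z (\<lambda>t. min (v t) (w t) + e \<bullet> t) = z (\<lambda>t. v t + e \<bullet> t) + z (\<lambda>t. w t + e \<bullet> t)"
      unfolding M m by (rule valD) (use *[THEN lin[where x = e]] in \<open>simp_all only: M m\<close>)
    from arg_cong[OF this, of "\<lambda>u. u \<bullet> e"] arg_cong[OF valD[OF *], of "\<lambda>u. u \<bullet> e"]
    show "z0 (\<lambda>x. max (v x) (w x)) + z0 (\<lambda>x. min (v x) (w x)) = z0 v + z0 w"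
      unfolding *[THEN z0e] inner_add_left inner_diff_left by linarith
  next
    fix v :: "'n cvfun" and a c assume v: "convex_on UNIV v"
    have va: "convex_on UNIV (\<lambda>x. v x + a \<bullet> x + c)" by (rule convex_on_add_linear[OF v])
    have "z (\<lambda>t. v t + a \<bullet> t + c + e \<bullet> t) = z (\<lambda>t. (v t + (a + e) \<bullet> t) + c)" by (simp add: inner_add_left algebra_simps)
    also have "\<dots> = z v + z0 v *\<^sub>R (a + e)" by (simp add: vertD lin v z0)
    finally have 1: "z (\<lambda>t. v t + a \<bullet> t + c + e \<bullet> t) = z v + z0 v *\<^sub>R (a + e)" .
    have "z (\<lambda>t. v t + a \<bullet> t + c) = z v + z0 v *\<^sub>R a" by (simp add: vertD lin v z0)
    then show "z0 (\<lambda>x. v x + a \<bullet> x + c) = z0 v"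
      unfolding z0e[OF va] using 1 by (simp add: scaleR_add_right ee)
  next
    fix v :: "'n cvfun" and r :: real assume v: "convex_on UNIV v" and r: "0 < r"
    have rv: "convex_on UNIV (\<lambda>t. r * v t)" using v r by (intro convex_on_scale) auto
    \<comment> \<open>Pulling out \<open>r\<close> leaves the linear part
      \<open>(1 / r) *\<^sub>R e\<close>, so one degree is lost.\<close>
    have "(\<lambda>t. r * v t + e \<bullet> t) = (\<lambda>t. r * (v t + ((1 / r) *\<^sub>R e) \<bullet> t))" using r by (simp add: fun_eq_iff distrib_left)
    then have "z (\<lambda>t. r * v t + e \<bullet> t) = r powr (?n + 1) *\<^sub>R (z v + z0 v *\<^sub>R ((1 / r) *\<^sub>R e))"
      by (simp only: homD[OF lin[OF v] r] z0[OF v])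
    then have "z0 (\<lambda>t. r * v t) = r powr (?n + 1) * (z0 v * (1 / r))"
      unfolding z0e[OF rv] homD[OF v r] by (simp add: scaleR_add_right ee)
    also have "\<dots> = r powr ?n * z0 v" using r by (simp add: powr_add)
    finally show "z0 (\<lambda>x. r * v x) = r powr real DIM(real^'n) * z0 v" by simp
  qed
  interpret Z0: homogeneous_valuation z0 "real DIM(real^'n)" by (rule Z0)
  define \<zeta> where "\<zeta> = Z0.cube_density"
  obtain R where R: "\<And>p. R < norm p \<Longrightarrow> \<zeta> p = 0"
    and rep: "\<And>v. convex_on UNIV v \<Longrightarrow> z0 v = integral\<^sup>L lborel (gradval v (\<lambda>(x, y). \<zeta> x))"
    using Z0.integral_representation[OF refl] unfolding \<zeta>_def by metis
  have \<zeta>: "\<zeta> \<in> Cc" by (rule CcI[OF _ R]) (simp add: \<zeta>_def Z0.density_continuous)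
  have mass: "z0 v = hess_mass \<zeta> v" if "convex_on UNIV v" for v using rep[OF that] by (simp add: hess_mass_def)
  \<comment> \<open>Affine invariance holds because the linear terms of \<open>z\<close> and of its
    Hessian integral cancel: \<open>z0\<close> equals \<open>hess_mass \<zeta>\<close>.\<close>
  have Y: "homogeneous_valuation (\<lambda>v. (z v - hess_vec \<zeta> v) $ j) (?n + 1)" for j
  proof
    fix vs :: "nat \<Rightarrow> 'n cvfun" and v
    assume *: "\<And>k. convex_on UNIV (vs k)" "convex_on UNIV v" "\<And>x. (\<lambda>k. vs k x) \<longlonglongrightarrow> v x"
    have "(\<lambda>k. hess_vec \<zeta> (vs k)) \<longlonglongrightarrow> hess_vec \<zeta> v"
      using hess_vec_continuous[OF \<zeta>] * by (auto simp: val_continuous_def Conv_def pw_conv_def)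
    then show "(\<lambda>k. (z (vs k) - hess_vec \<zeta> (vs k)) $ j) \<longlonglongrightarrow> (z v - hess_vec \<zeta> v) $ j"
      by (intro tendsto_vec_nth tendsto_diff contD *)
  next
    fix v w :: "'n cvfun"
    assume *: "convex_on UNIV v" "convex_on UNIV w" "convex_on UNIV (\<lambda>x. max (v x) (w x))" "convex_on UNIV (\<lambda>x. min (v x) (w x))"
    have "hess_vec \<zeta> (\<lambda>x. max (v x) (w x)) + hess_vec \<zeta> (\<lambda>x. min (v x) (w x)) = hess_vec \<zeta> v + hess_vec \<zeta> w"
      using hess_vec_valuation[OF \<zeta>] * by (simp add: is_valuation_def Conv_def)
    with valD[OF *] show "(z (\<lambda>x. max (v x) (w x)) - hess_vec \<zeta> (\<lambda>x. max (v x) (w x))) $ j + (z (\<lambda>x. min (v x) (w x)) - hess_vec \<zeta> (\<lambda>x. min (v x) (w x))) $ j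
       = (z v - hess_vec \<zeta> v) $ j + (z w - hess_vec \<zeta> w) $ j"
      unfolding vector_add_component[symmetric] by (simp add: algebra_simps)
  next
    fix v :: "'n cvfun" and a c assume v: "convex_on UNIV v"
    have "hess_vec \<zeta> (\<lambda>x. v x + a \<bullet> x + c) = hess_vec \<zeta> (\<lambda>x. v x + a \<bullet> x)"
      using hess_vec_vert[OF \<zeta>] lin[OF v] by (simp add: vert_transl_inv_def Conv_def)
    then show "(z (\<lambda>x. v x + a \<bullet> x + c) - hess_vec \<zeta> (\<lambda>x. v x + a \<bullet> x + c)) $ j = (z v - hess_vec \<zeta> v) $ j"
      by (simp add: vertD lin v z0 hess_vec_add_linear[OF \<zeta> v] mass[OF v])
  next
    fix v :: "'n cvfun" and r :: real assume v: "convex_on UNIV v" and r: "0 < r"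
    have "hess_vec \<zeta> (\<lambda>x. r * v x) = r powr (?n + 1) *\<^sub>R hess_vec \<zeta> v"
      using hess_vec_homogeneous[OF \<zeta>] v r by (simp add: homogeneous_deg_def Conv_def)
    then show "(z (\<lambda>x. r * v x) - hess_vec \<zeta> (\<lambda>x. r * v x)) $ j = r powr (?n + 1) * (z v - hess_vec \<zeta> v) $ j"
      by (simp add: homD[OF v r] right_diff_distrib)
  qed
  have "z v = hess_vec \<zeta> v" if v: "convex_on UNIV v" for v
  proof -
    \<comment> \<open>The degree exceeds the dimension by one, so the limit case of
      \<open>vanishes\<close> is vacuous.\<close>
    have "(z v - hess_vec \<zeta> v) $ j = 0" for j
      by (rule homogeneous_valuation.vanishes[OF Y _ _ v]) simp_all
    then show ?thesis by (simp add: vec_eq_iff)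
  qed
  then show ?thesis using \<zeta> by (auto simp: Conv_def)
qed

lemma radial_in_Cc:
  assumes "\<alpha> \<in> Cc_halfline"
  shows "(\<lambda>x::real^'n::finite. \<alpha> (norm x)) \<in> Cc"
proof -
  have c: "continuous_on {0..} \<alpha>" and k: "compact (closure {t\<in>{0..}. \<alpha> t \<noteq> 0})"
    using assms by (auto simp: Cc_halfline_def)
  have "bounded {t\<in>{0..}. \<alpha> t \<noteq> 0}" using k compact_imp_bounded bounded_subset closure_subset by blast
  then obtain R where R: "\<And>t. 0 \<le> t \<Longrightarrow> \<alpha> t \<noteq> 0 \<Longrightarrow> \<bar>t\<bar> \<le> R" by (auto simp: bounded_iff)
  show ?thesis
  proof (rule CcI)
    show "continuous_on UNIV (\<lambda>x::real^'n. \<alpha> (norm x))"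
      by (rule continuous_on_compose2[OF c]) (auto intro: continuous_intros)
    show "\<alpha> (norm x) = 0" if "R < norm x" for x :: "real^'n" using R[of "norm x"] that by force
  qed
qed

lemma radial_profile:
  fixes \<zeta> :: "real^'n::finite \<Rightarrow> real"
  assumes \<zeta>: "\<zeta> \<in> Cc" and rad: "\<And>x y. norm x = norm y \<Longrightarrow> \<zeta> x = \<zeta> y"
  shows "\<exists>\<alpha>\<in>Cc_halfline. \<zeta> = (\<lambda>x. \<alpha> (norm x))"
proof -
  obtain i :: 'n where True by simp
  define e where "e = axis i (1::real)"
  have e: "norm e = 1" by (simp add: e_def)
  obtain K where K: "compact K" "\<And>x. x \<notin> K \<Longrightarrow> \<zeta> x = 0" "continuous_on UNIV \<zeta>" using Cc_support[OF \<zeta>] by blast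
  obtain R where R: "\<And>x. x \<in> K \<Longrightarrow> norm x \<le> R" using K(1) compact_imp_bounded bounded_iff by metis
  define \<alpha> where "\<alpha> t = \<zeta> (t *\<^sub>R e)" for t
  have "continuous_on {0..} \<alpha>"
    unfolding \<alpha>_def by (rule continuous_on_compose2[OF K(3)]) (auto intro: continuous_intros)
  moreover have "{t\<in>{0..}. \<alpha> t \<noteq> 0} \<subseteq> cball 0 R"
  proof
    fix t assume "t \<in> {t\<in>{0..}. \<alpha> t \<noteq> 0}"
    then have "t *\<^sub>R e \<in> K" using K(2) by (auto simp: \<alpha>_def)
    then show "t \<in> cball 0 R" using R[of "t *\<^sub>R e"] e by simp
  qed
  then have "compact (closure {t\<in>{0..}. \<alpha> t \<noteq> 0})" using bounded_cball bounded_subset compact_closure by blast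
  ultimately have "\<alpha> \<in> Cc_halfline" by (simp add: Cc_halfline_def)
  moreover have "\<zeta> x = \<alpha> (norm x)" for x unfolding \<alpha>_def by (rule rad) (simp add: e)
  ultimately show ?thesis by blast
qed

text \<open>Equivariance at \<open>v\<close> and at \<open>v\<close> plus a linear function isolates
  the mass: \<open>hess_mass\<close> takes equal values at \<open>v\<close> and at its transformed
  copy. On the cube function centered at \<open>p\<close> these values are \<open>\<zeta> p\<close>
  and \<open>\<zeta> (A *v p)\<close>.\<close>

lemma orthogonal_invariant_density:
  fixes A :: "real^'n::finite^'n"
  assumes \<zeta>: "\<zeta> \<in> Cc" and A: "orthogonal_matrix A"
    and eqv: "\<And>v :: 'n cvfun. convex_on UNIV v \<Longrightarrow> hess_vec \<zeta> (\<lambda>t. v (transpose A *v t)) = A *v hess_vec \<zeta> v"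
  shows "\<zeta> (A *v p) = \<zeta> p"
proof -
  let ?v = "dconj (cbox 0 One) (\<lambda>z :: real^'n. p \<bullet> z)"
  have "continuous_on UNIV (\<lambda>z. p \<bullet> z)" by (intro continuous_intros)
  moreover have "cbox 0 One \<noteq> ({} :: (real^'n) set)" by (simp add: box_ne_empty)
  ultimately have v: "convex_on UNIV ?v" using dconj_convex compact_cbox by blast
  let ?w = "\<lambda>t. ?v (transpose A *v t)"
  obtain K where K: "compact K" "\<And>x y::real^'n. x \<notin> K \<Longrightarrow> (\<lambda>(x, y). \<zeta> x) (x, y) = 0"
    "continuous_on UNIV (\<lambda>(x, y::real^'n). \<zeta> x)" using Cc_integrand_mass[OF \<zeta>] by metis
  have orth: "convex_on UNIV ?w"
    "hess_mass \<zeta> ?w = integral\<^sup>L lborel (gradval ?v (\<lambda>(x, y). (\<lambda>(x, y). \<zeta> x) (A *v x, A *v y)))"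
    unfolding hess_mass_def by (rule integral_gradval_orthogonal[OF v A K(3) K(1)], rule K(2), assumption)+
  obtain i :: 'n where True by simp
  define e where "e = axis i (1::real)"
  have e: "e \<noteq> 0" by (simp add: e_def axis_eq_0_iff)
  have inv: "A *v (transpose A *v x) = x" "transpose A *v (A *v x) = x" for x
    using A by (metis matrix_vector_mul_assoc matrix_vector_mul_lid orthogonal_matrix_def)+
  have va: "convex_on UNIV (\<lambda>t. ?v t + e \<bullet> t)" using convex_on_add_linear[OF v, of e 0] by simp
  have adj: "e \<bullet> (transpose A *v t) = (A *v e) \<bullet> t" for t
    by (metis dot_lmul_matrix vector_transpose_matrix inner_commute)
  have "hess_vec \<zeta> (\<lambda>t. ?w t + (A *v e) \<bullet> t) = A *v hess_vec \<zeta> (\<lambda>t. ?v t + e \<bullet> t)"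
    using eqv[OF va] unfolding adj .
  then have "hess_vec \<zeta> ?w + hess_mass \<zeta> ?w *\<^sub>R (A *v e) = A *v (hess_vec \<zeta> ?v + hess_mass \<zeta> ?v *\<^sub>R e)"
    by (simp only: hess_vec_add_linear[OF \<zeta> orth(1), of "A *v e"] hess_vec_add_linear[OF \<zeta> v, of e])
  then have "hess_mass \<zeta> ?w *\<^sub>R (A *v e) = hess_mass \<zeta> ?v *\<^sub>R (A *v e)"
    unfolding eqv[OF v] by (simp add: matrix_vector_right_distrib matrix_vector_mult_scaleR)
  moreover have "A *v e \<noteq> 0" using e inv(2)[of e] by (metis matrix_vector_mult_0_right)
  ultimately have "hess_mass \<zeta> ?w = hess_mass \<zeta> ?v" by simp
  moreover have "hess_mass \<zeta> ?w = \<zeta> (A *v p)"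
    unfolding orth(2)
  proof (rule integral_gradval_cube)
    have "continuous_on UNIV \<zeta>" using \<zeta> by (simp add: Cc_def)
    then have "continuous_on UNIV (\<lambda>q::(real^'n)\<times>(real^'n). \<zeta> (A *v fst q))"
      by (rule continuous_on_compose2)
        (auto intro!: continuous_on_compose2[OF linear_continuous_on[OF matrix_vector_mul_bounded_linear]] continuous_intros)
    then show "(\<lambda>(x, y). (\<lambda>(x, y). \<zeta> x) (A *v x, A *v y)) \<in> borel_measurable borel"
      by (intro borel_measurable_continuous_onI) (simp add: case_prod_beta)
  qed simp
  ultimately show ?thesis using hess_mass_cube[OF \<zeta>] by metis
qed

text \<open>In dimension one the reflection is this orthogonal matrix, so the lemmas on orthogonal
  matrices serve the rotation case and the reflection case alike.\<close>

lemma reflection_as_orthogonal: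
  defines "A \<equiv> (- mat 1 :: real^'n::finite^'n)"
  shows "orthogonal_matrix A" "A *v x = - x" "transpose A *v x = - x"
proof -
  have tA: "transpose A = A" by (auto simp: A_def transpose_def mat_def vec_eq_iff)
  show mul: "A *v x = - x" for x 
    using matrix_vector_mult_diff_rdistrib[of 0 "mat 1" x] by (simp add: A_def)
  show "transpose A *v x = - x" by (simp only: tA mul)
  have "A ** A = mat 1"
    by (rule matrix_eq[THEN iffD2]) (simp add: mul flip: matrix_vector_mul_assoc)
  then show "orthogonal_matrix A" by (simp add: orthogonal_matrix_def tA)
qed

lemma norm_eq_if_dim_1:
  fixes x y :: "real^'n::finite"
  assumes "CARD('n) = 1" "norm x = norm y"
  shows "x = y \<or> x = - y"
proof -
  obtain i :: 'n where i: "UNIV = {i}" using assms(1) card_1_singletonE by blast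
  have n: "norm z = \<bar>z $ i\<bar>" for z :: "real^'n" by (simp add: norm_vec_def i)
  have j: "j = i" for j using i by auto
  show ?thesis using assms(2) unfolding n by (auto simp: vec_eq_iff abs_eq_iff) (metis j)+
qed

theorem theorem5p9:
  fixes z :: "('n::finite) cvfun \<Rightarrow> real^'n"
  shows "((val_continuous z \<and> is_valuation z \<and> dually_transl_cov z \<and> vert_transl_inv z \<and>
            homogeneous_deg (real CARD('n) + 1) z)
          \<longleftrightarrow> (\<exists>\<zeta>\<in>Cc. \<forall>v\<in>Conv. z v = hess_vec \<zeta> v))
       \<and> (CARD('n) \<ge> 2 \<longrightarrow>
         ((val_continuous z \<and> is_valuation z \<and> dually_transl_cov z \<and> vert_transl_inv z \<and>
            homogeneous_deg (real CARD('n) + 1) z \<and> rotation_equivariant z)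
          \<longleftrightarrow> (\<exists>\<alpha>\<in>Cc_halfline. \<forall>v\<in>Conv. z v = m_star \<alpha> v)))
       \<and> (CARD('n) = 1 \<longrightarrow>
         ((val_continuous z \<and> is_valuation z \<and> dually_transl_cov z \<and> vert_transl_inv z \<and>
            homogeneous_deg (real CARD('n) + 1) z \<and> reflection_equivariant z)
          \<longleftrightarrow> (\<exists>\<alpha>\<in>Cc_halfline. \<forall>v\<in>Conv. z v = m_star \<alpha> v)))"
proof -
  let ?P = "val_continuous z \<and> is_valuation z \<and> dually_transl_cov z \<and> vert_transl_inv z \<and>
            homogeneous_deg (real CARD('n) + 1) z"
  have C: "v \<in> Conv \<longleftrightarrow> convex_on UNIV v" for v :: "'n cvfun" by (simp add: Conv_def)
  \<comment> \<open>\<open>z\<close> agrees with the integral only on convex functions, so the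
    modified functions have to be convex before rewriting.\<close>
  have if_hess_vec: "?P" if \<zeta>: "\<zeta> \<in> Cc" and eq: "\<And>v. convex_on UNIV v \<Longrightarrow> z v = hess_vec \<zeta> v" for \<zeta>
  proof (intro conjI)
    show "val_continuous z"
      using hess_vec_continuous[OF \<zeta>] by (simp add: val_continuous_def C eq)
    show "is_valuation z"
      using hess_vec_valuation[OF \<zeta>] by (simp add: is_valuation_def C eq)
    have "z (\<lambda>t. v t + x \<bullet> t) = z v + hess_mass \<zeta> v *\<^sub>R x" if "convex_on UNIV v" for v x
    proof -
      have "convex_on UNIV (\<lambda>t. v t + x \<bullet> t)" using convex_on_add_linear[OF that, of x 0] by simp
      then show ?thesis by (simp only: eq that hess_vec_add_linear[OF \<zeta> that])
    qed
    then show "dually_transl_cov z"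
      unfolding dually_transl_cov_def by (intro exI[of _ "hess_mass \<zeta>"] ballI allI) (simp only: C)
    have "z (\<lambda>t. v t + c) = z v" if "convex_on UNIV v" for v c
    proof -
      have "hess_vec \<zeta> (\<lambda>t. v t + c) = hess_vec \<zeta> v"
        using hess_vec_vert[OF \<zeta>] that by (simp add: vert_transl_inv_def C)
      moreover have "convex_on UNIV (\<lambda>t. v t + c)" using convex_on_add_linear[OF that, of 0 c] by simp
      ultimately show ?thesis by (simp only: eq that)
    qed
    then show "vert_transl_inv z" by (simp add: vert_transl_inv_def C)
    have "z (\<lambda>t. r * v t) = r powr (real CARD('n) + 1) *\<^sub>R z v" if "convex_on UNIV v" "0 < r" for v r
    proof -
      have "hess_vec \<zeta> (\<lambda>t. r * v t) = r powr (real CARD('n) + 1) *\<^sub>R hess_vec \<zeta> v"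
        using hess_vec_homogeneous[OF \<zeta>] that by (simp add: homogeneous_deg_def C)
      moreover have "convex_on UNIV (\<lambda>t. r * v t)" using that by (intro convex_on_scale) auto
      ultimately show ?thesis by (simp only: eq that(1))
    qed
    then show "homogeneous_deg (real CARD('n) + 1) z" by (simp add: homogeneous_deg_def C)
  qed
  have part1: "?P \<longleftrightarrow> (\<exists>\<zeta>\<in>Cc. \<forall>v\<in>Conv. z v = hess_vec \<zeta> v)"
    using hess_vec_representation[of z] if_hess_vec by (auto simp: C)
  have orth: "z (\<lambda>t. v (transpose A *v t)) = A *v z v"
    if \<alpha>: "\<alpha> \<in> Cc_halfline" and eq: "\<forall>v\<in>Conv. z v = m_star \<alpha> v" and v: "convex_on UNIV v" and A: "orthogonal_matrix A" for \<alpha> v A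
  proof -
    have iso: "norm (A *v x) = norm x" for x
    proof -
      have "transpose A *v (A *v x) = x"
        using A by (metis matrix_vector_mul_assoc matrix_vector_mul_lid orthogonal_matrix_def)
      then have "(A *v x) \<bullet> (A *v x) = x \<bullet> x" by (metis dot_lmul_matrix vector_transpose_matrix)
      then show ?thesis by (simp add: norm_eq_sqrt_inner)
    qed
    have cv: "convex_on UNIV (\<lambda>t. v (transpose A *v t))"
      by (rule integral_gradval_orthogonal(1)[OF v A continuous_on_const[of _ 0] compact_empty]) auto
    show ?thesis
      using hess_vec_orthogonal[OF radial_in_Cc[OF \<alpha>] v A] eq v cv iso by (simp add: C m_star_def)
  qed
  have radial: "\<exists>\<alpha>\<in>Cc_halfline. \<forall>v\<in>Conv. z v = m_star \<alpha> v"
    if \<zeta>: "\<zeta> \<in> Cc" and eq: "\<And>v. convex_on UNIV v \<Longrightarrow> z v = hess_vec \<zeta> v"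
      and rad: "\<And>x y. norm x = norm y \<Longrightarrow> \<zeta> x = \<zeta> y" for \<zeta>
    using radial_profile[OF \<zeta> rad] eq by (auto simp: m_star_def C)
  have dens: "\<zeta> (A *v p) = \<zeta> p"
    if \<zeta>: "\<zeta> \<in> Cc" and eq: "\<And>v. convex_on UNIV v \<Longrightarrow> z v = hess_vec \<zeta> v" and A: "orthogonal_matrix A"
      and eqv: "\<And>v. convex_on UNIV v \<Longrightarrow> z (\<lambda>t. v (transpose A *v t)) = A *v z v" for \<zeta> A p
  proof (rule orthogonal_invariant_density[OF \<zeta> A])
    fix v :: "'n cvfun" assume v: "convex_on UNIV v"
    have cv: "convex_on UNIV (\<lambda>t. v (transpose A *v t))"
      by (rule integral_gradval_orthogonal(1)[OF v A continuous_on_const[of _ 0] compact_empty]) auto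
    show "hess_vec \<zeta> (\<lambda>t. v (transpose A *v t)) = A *v hess_vec \<zeta> v"
      using eqv[OF v] eq[OF v] eq[OF cv] by simp
  qed
  have part2: "?P \<and> rotation_equivariant z \<longleftrightarrow> (\<exists>\<alpha>\<in>Cc_halfline. \<forall>v\<in>Conv. z v = m_star \<alpha> v)" if n: "CARD('n) \<ge> 2"
  proof
    assume P: "?P \<and> rotation_equivariant z"
    then obtain \<zeta> where \<zeta>: "\<zeta> \<in> Cc" "\<And>v. convex_on UNIV v \<Longrightarrow> z v = hess_vec \<zeta> v" using part1 by (auto simp: C)
    have "\<zeta> x = \<zeta> y" if xy: "norm x = norm y" for x y
    proof -
      \<comment> \<open>Dimension at least 2 enters here: the rotations act transitively on
        spheres.\<close>
      obtain f where f: "orthogonal_transformation f" "det (matrix f) = 1" "f x = y" using rotation_exists[OF n xy] .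
      let ?A = "matrix f"
      have A: "orthogonal_matrix ?A" using f(1) orthogonal_transformation_matrix by blast
      have "?A *v x = y" using f(1,3) by (simp add: orthogonal_transformation_linear)
      moreover have "\<zeta> (?A *v x) = \<zeta> x"
        by (rule dens[OF \<zeta> A]) (use P A f(2) in \<open>auto simp: rotation_equivariant_def C\<close>)
      ultimately show ?thesis by simp
    qed
    then show "\<exists>\<alpha>\<in>Cc_halfline. \<forall>v\<in>Conv. z v = m_star \<alpha> v" using radial[OF \<zeta>] by blast
  next
    assume "\<exists>\<alpha>\<in>Cc_halfline. \<forall>v\<in>Conv. z v = m_star \<alpha> v"
    then obtain \<alpha> where \<alpha>: "\<alpha> \<in> Cc_halfline" "\<forall>v\<in>Conv. z v = m_star \<alpha> v" by blast
    have "?P" using if_hess_vec[OF radial_in_Cc[OF \<alpha>(1)]] \<alpha>(2) by (simp add: C m_star_def)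
    moreover have "rotation_equivariant z" using orth[OF \<alpha>] by (simp add: rotation_equivariant_def C)
    ultimately show "?P \<and> rotation_equivariant z" by blast
  qed
  have part3: "?P \<and> reflection_equivariant z \<longleftrightarrow> (\<exists>\<alpha>\<in>Cc_halfline. \<forall>v\<in>Conv. z v = m_star \<alpha> v)" if n: "CARD('n) = 1"
  proof
    assume P: "?P \<and> reflection_equivariant z"
    then obtain \<zeta> where \<zeta>: "\<zeta> \<in> Cc" "\<And>v. convex_on UNIV v \<Longrightarrow> z v = hess_vec \<zeta> v" using part1 by (auto simp: C)
    \<comment> \<open>With \<open>A = - mat 1\<close>, invariance of the density says that \<zeta>
      is even, and in dimension one an even function depends only on the norm.\<close>
    have even: "\<zeta> (- x) = \<zeta> x" for x
      using dens[OF \<zeta> reflection_as_orthogonal(1), of x] P unfolding reflection_as_orthogonal(2,3)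
      by (simp add: reflection_equivariant_def C)
    have "\<zeta> x = \<zeta> y" if "norm x = norm y" for x y
      using norm_eq_if_dim_1[OF n that] even by metis
    then show "\<exists>\<alpha>\<in>Cc_halfline. \<forall>v\<in>Conv. z v = m_star \<alpha> v" using radial[OF \<zeta>] by blast
  next
    assume "\<exists>\<alpha>\<in>Cc_halfline. \<forall>v\<in>Conv. z v = m_star \<alpha> v"
    then obtain \<alpha> where \<alpha>: "\<alpha> \<in> Cc_halfline" "\<forall>v\<in>Conv. z v = m_star \<alpha> v" by blast
    have "?P" using if_hess_vec[OF radial_in_Cc[OF \<alpha>(1)]] \<alpha>(2) by (simp add: C m_star_def)
    moreover have "reflection_equivariant z"
      using orth[OF \<alpha> _ reflection_as_orthogonal(1)] unfolding reflection_as_orthogonal(2,3)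
      by (simp add: reflection_equivariant_def C)
    ultimately show "?P \<and> reflection_equivariant z" by blast
  qed
  show ?thesis using part1 part2 part3 by blast
qed

end
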